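(* Let $G(V,E)$ be a finite connected graph (loops and multiple edges allowed, $|E|\ge 1$) with all edges of length $1$, each edge $e_j$ parametrized by $x\in(0,1)$ (which gives an orientation on $G$), and let $q_j\in L^1(0,1)$ be a real-valued potential on $e_j$ for each $j$. Consider the eigenvalue problem $-y''+q_j(x)y=\lambda y$ on $e_j$ (for all $j$) with standard matching conditions at the vertices. Suppose that every non-loop edge of $G$ has the same effective resistance $r<1$. If $\lambda=0$ is the smallest eigenvalue and for infinitely many $k\in\mathbb{Z}^+$ there are $|E|-|V|+1$ eigenvalues (counting multiplicities) such that $\lambda=(2k\pi)^2+o(1)$, then $q_j=0$ a.e. on $(0,1)$ for every $j$. Moreover, if $G$ is bipartite, the same is true for $k$ instead of $2k$: if $\lambda=0$ is the smallest eigenvalue and for infinitely many $k\in\mathbb{Z}^+$ there are $|E|-|V|+1$ eigenvalues (counting multiplicities) such that $\lambda=(k\pi)^2+o(1)$, then $q_j=0$ a.e. on $(0,1)$ for every $j$. Here "for infinitely many $k$ there are $m$ eigenvalues (counting multiplicities) such that $\lambda=\mu_k+o(1)$" means: there are an infinite set $K\subset\mathbb{Z}^+$ and numbers $\varepsilon_k\ge 0$ ($k\in K$) with $\varepsilon_k\to0$ as $k\to\infty$ in $K$, such that for each $k\in K$ at least $m$ eigenvalues, counted with multiplicity, satisfy $|\lambda-\mu_k|\le\varepsilon_k$.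
   Context: Standard matching (Neumann/Kirchhoff) conditions: a function $y=(y_j)_{j}$ on $G$, with $y_j$ defined on $e_j\cong(0,1)$, satisfies (i) continuity: at each vertex $v$ all the boundary values of $y$ at $v$ coincide, i.e. $y_j(\kappa_j)=y_k(\kappa_k)$ whenever $e_j,e_k$ are attached to $v$, where $\kappa=0$ for an edge leaving $v$, $\kappa=1$ for an edge entering $v$ (both $0$ and $1$ occur for a loop); and (ii) for every vertex $v$, $\sum_{e_j\text{ leaves }v}y_j'(0)=\sum_{e_j\text{ enters }v}y_j'(1)$, with loops counted on both sides. Solutions of the differential equation are understood with $y_j,y_j'$ absolutely continuous. An eigenvalue is a $\lambda$ for which there is a nonzero $y$ satisfying the equation on every edge together with (i) and (ii); its multiplicity is the dimension of the space of such $y$. Effective resistance: regard $G$ as an electrical circuit in which each edge has unit resistance. The effective resistance of an edge $e$ is the effective resistance between its endpoints in this circuit; by a classical result of Kirchhoff it equals the number of spanning trees of $G$ containing $e$ divided by the number of all spanning trees of $G$. (If all edges of $G$ are loops, the hypothesis on effective resistances is vacuous.) *)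

theory Defs
  imports
    "HOL-Analysis.Analysis"
    "HOL-Library.Function_Algebras"
    "Graph_Theory.Digraph_Component"
begin

text \<open>
  A metric graph is a \<^typ>\<open>('v, 'e) pre_digraph\<close>: its arcs are the undirected edges of the
  graph, oriented by their parametrization, which runs from the tail (\<open>x = 0\<close>) to the head
  (\<open>x = 1\<close>). Loops and parallel arcs are allowed.
\<close>

definition nonloop :: "('v, 'e) pre_digraph \<Rightarrow> 'e \<Rightarrow> bool" where
  "nonloop G e \<longleftrightarrow> tail G e \<noteq> head G e"

definition bipartite :: "('v, 'e) pre_digraph \<Rightarrow> bool" where
  "bipartite G \<longleftrightarrow> (\<exists>A B. A \<union> B = verts G \<and> A \<inter> B = {} \<and>
     (\<forall>e\<in>arcs G. (tail G e \<in> A \<and> head G e \<in> B) \<or> (tail G e \<in> B \<and> head G e \<in> A)))"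


subsection \<open>Effective resistance\<close>

text \<open>
  A potential \<open>\<phi>\<close> drives, by Ohm's law with unit resistances, the current
  \<open>\<phi> (tail G e) - \<phi> (head G e)\<close> along \<open>e\<close>. Kirchhoff's current law says that the net current
  leaving a vertex is the one fed in from outside: \<open>1\<close> at \<open>u\<close>, \<open>-1\<close> at \<open>w\<close>, \<open>0\<close> elsewhere.
\<close>

definition unit_current_potential ::
  "('v, 'e) pre_digraph \<Rightarrow> 'v \<Rightarrow> 'v \<Rightarrow> ('v \<Rightarrow> real) \<Rightarrow> bool" where
  "unit_current_potential G u w \<phi> \<longleftrightarrow> (\<forall>v\<in>verts G.
     (\<Sum>e | e \<in> arcs G \<and> tail G e = v. \<phi> (tail G e) - \<phi> (head G e))
     - (\<Sum>e | e \<in> arcs G \<and> head G e = v. \<phi> (tail G e) - \<phi> (head G e))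
     = of_bool (v = u) - of_bool (v = w))"

text \<open>In a finite connected graph such a potential exists and is unique up to a constant.\<close>

definition effective_resistance :: "('v, 'e) pre_digraph \<Rightarrow> 'v \<Rightarrow> 'v \<Rightarrow> real" where
  "effective_resistance G u w = (THE r. \<exists>\<phi>. unit_current_potential G u w \<phi> \<and> r = \<phi> u - \<phi> w)"

definition edge_resistance :: "('v, 'e) pre_digraph \<Rightarrow> 'e \<Rightarrow> real" where
  "edge_resistance G e = effective_resistance G (tail G e) (head G e)"


subsection \<open>The eigenvalue problem\<close>

definition abs_continuous_on_interval :: "real \<Rightarrow> real \<Rightarrow> (real \<Rightarrow> real) \<Rightarrow> bool" where
  "abs_continuous_on_interval a b f \<longleftrightarrow>
     (\<forall>\<epsilon>>0. \<exists>\<delta>>0. \<forall>I :: (real \<times> real) set.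
        finite I \<and> (\<forall>(s, t)\<in>I. a \<le> s \<and> s \<le> t \<and> t \<le> b)
        \<and> disjoint_family_on (\<lambda>(s, t). {s<..<t}) I
        \<and> (\<Sum>(s, t)\<in>I. t - s) < \<delta>
        \<longrightarrow> (\<Sum>(s, t)\<in>I. \<bar>f t - f s\<bar>) < \<epsilon>)"

text \<open>
  \<open>sl_solution q lam y dy\<close>: \<open>y\<close> solves \<open>-y'' + q y = lam y\<close> on \<open>(0, 1)\<close> and \<open>y' = dy\<close>, where both are
  absolutely continuous; they extend to \<open>[0, 1]\<close>, with one-sided derivatives at the end points.
\<close>

definition sl_solution ::
  "(real \<Rightarrow> real) \<Rightarrow> real \<Rightarrow> (real \<Rightarrow> real) \<Rightarrow> (real \<Rightarrow> real) \<Rightarrow> bool" where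
  "sl_solution q lam y dy \<longleftrightarrow>
     abs_continuous_on_interval 0 1 y \<and> abs_continuous_on_interval 0 1 dy \<and>
     (\<forall>x\<in>{0..1}. (y has_real_derivative dy x) (at x within {0..1})) \<and>
     (AE x\<in>{0<..<1} in lebesgue.
        \<exists>ddy. (dy has_real_derivative ddy) (at x) \<and> - ddy + q x * y x = lam * y x)"

definition continuity_condition ::
  "('v, 'e) pre_digraph \<Rightarrow> ('e \<Rightarrow> real \<Rightarrow> real) \<Rightarrow> bool" where
  "continuity_condition G y \<longleftrightarrow> (\<forall>v\<in>verts G. \<exists>c. \<forall>e\<in>arcs G.
     (tail G e = v \<longrightarrow> y e 0 = c) \<and> (head G e = v \<longrightarrow> y e 1 = c))"

definition kirchhoff_condition ::
  "('v, 'e) pre_digraph \<Rightarrow> ('e \<Rightarrow> real \<Rightarrow> real) \<Rightarrow> bool" where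
  "kirchhoff_condition G dy \<longleftrightarrow> (\<forall>v\<in>verts G.
     (\<Sum>e | e \<in> arcs G \<and> tail G e = v. dy e 0) = (\<Sum>e | e \<in> arcs G \<and> head G e = v. dy e 1))"

text \<open>
  A function on the graph is represented by its extension by \<open>0\<close> to arguments outside
  \<open>arcs G \<times> [0, 1]\<close>, so that equality of functions is the equality of HOL.
\<close>

definition eigenspace ::
  "('v, 'e) pre_digraph \<Rightarrow> ('e \<Rightarrow> real \<Rightarrow> real) \<Rightarrow> real \<Rightarrow> ('e \<Rightarrow> real \<Rightarrow> real) set" where
  "eigenspace G q lam = {y.
     (\<forall>e x. e \<notin> arcs G \<or> x \<notin> {0..1} \<longrightarrow> y e x = 0) \<and>
     (\<exists>dy. (\<forall>e\<in>arcs G. sl_solution (q e) lam (y e) (dy e)) \<and>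
           continuity_condition G y \<and> kirchhoff_condition G dy)}"

definition is_eigenvalue ::
  "('v, 'e) pre_digraph \<Rightarrow> ('e \<Rightarrow> real \<Rightarrow> real) \<Rightarrow> real \<Rightarrow> bool" where
  "is_eigenvalue G q lam \<longleftrightarrow> (\<exists>y\<in>eigenspace G q lam. y \<noteq> 0)"

definition fun_scale :: "real \<Rightarrow> ('e \<Rightarrow> real \<Rightarrow> real) \<Rightarrow> 'e \<Rightarrow> real \<Rightarrow> real" where
  "fun_scale c y = (\<lambda>e x. c * y e x)"

lemma vector_space_fun_scale: "vector_space fun_scale"
  by unfold_locales (auto simp: fun_scale_def fun_eq_iff algebra_simps)

definition eigenvalue_multiplicity ::
  "('v, 'e) pre_digraph \<Rightarrow> ('e \<Rightarrow> real \<Rightarrow> real) \<Rightarrow> real \<Rightarrow> nat" where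
  "eigenvalue_multiplicity G q lam = vector_space.dim fun_scale (eigenspace G q lam)"

definition is_smallest_eigenvalue ::
  "('v, 'e) pre_digraph \<Rightarrow> ('e \<Rightarrow> real \<Rightarrow> real) \<Rightarrow> real \<Rightarrow> bool" where
  "is_smallest_eigenvalue G q lam \<longleftrightarrow>
     is_eigenvalue G q lam \<and> (\<forall>lam'. is_eigenvalue G q lam' \<longrightarrow> lam \<le> lam')"

text \<open>
  For infinitely many positive integers \<open>k\<close> there are \<open>m\<close> eigenvalues, counted with multiplicity,
  such that \<open>lam = \<mu> k + o(1)\<close>. The filter expresses \<open>k \<rightarrow> \<infinity>\<close> with \<open>k \<in> K\<close>.
\<close>

definition infinitely_often_eigenvalues_near ::
  "('v, 'e) pre_digraph \<Rightarrow> ('e \<Rightarrow> real \<Rightarrow> real) \<Rightarrow> int \<Rightarrow> (nat \<Rightarrow> real) \<Rightarrow> bool" where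
  "infinitely_often_eigenvalues_near G q m \<mu> \<longleftrightarrow>
     (\<exists>K \<epsilon>. infinite K \<and> K \<subseteq> {1..} \<and> (\<forall>k\<in>K. 0 \<le> \<epsilon> k) \<and>
        (\<epsilon> \<longlongrightarrow> 0) (inf sequentially (principal K)) \<and>
        (\<forall>k\<in>K. \<exists>F. finite F \<and> (\<forall>lam\<in>F. is_eigenvalue G q lam \<and> \<bar>lam - \<mu> k\<bar> \<le> \<epsilon> k) \<and>
                   m \<le> int (\<Sum>lam\<in>F. eigenvalue_multiplicity G q lam)))"

end

theory Submission
  imports Defs
begin

text \<open>
  Let \<open>Q\<^sub>e\<close> be the integral of \<open>q\<^sub>e\<close>. It suffices that \<open>\<Sum>\<^sub>e Q\<^sub>e = 0\<close>, since \<open>0\<close> is the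
  smallest eigenvalue (last paragraph).

  An eigenfunction with eigenvalue \<open>\<omega>\<^sup>2 + o(1)\<close>, \<open>\<omega> = 2 k \<pi>\<close>, is \<open>a\<^sub>e cos \<omega>x + b\<^sub>e sin \<omega>x + O(1/\<omega>)\<close> on the
  edge \<open>e\<close>. In the limit \<open>a\<close> is constant and \<open>b\<close> is a circulation, so that \<open>(a, b)\<close> ranges over a space
  of dimension \<open>m + 1\<close>, where \<open>m = |E| - |V| + 1\<close>. Testing the equation with \<open>cos \<omega>x\<close> and with \<open>c\<^sub>e sin \<omega>x\<close>
  for a circulation \<open>c\<close> gives \<open>\<Sum>\<^sub>e a\<^sub>e Q\<^sub>e = 0\<close> and \<open>\<Sum>\<^sub>e Q\<^sub>e b\<^sub>e c\<^sub>e = 0\<close> in the limit. The \<open>m\<close> eigenfunctions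
  yield \<open>m\<close> orthonormal limits. If \<open>\<Sum>\<^sub>e Q\<^sub>e\<close> were nonzero, then \<open>a = 0\<close> for all of them, hence the \<open>b\<close>'s would be an
  orthonormal basis of the circulations, and the trace of the compression of \<open>diag Q\<close> to the circulations would
  vanish. The diagonal entries of the orthogonal projection onto the circulations are \<open>1\<close> minus the effective
  resistances, so the trace is \<open>(1 - r) \<Sum>\<^sub>e Q\<^sub>e\<close> (loops have \<open>Q\<^sub>e = 0\<close>, being circulations themselves): a contradiction.

  For \<open>lam\<close> below the first Dirichlet eigenvalues of the edges the problem reduces to a quadratic form on the
  vertex values. It is positive for \<open>lam\<close> near \<open>-\<infinity>\<close>, and the first \<open>lam\<close> at which this fails is an
  eigenvalue; so at \<open>lam = 0\<close> the form is nonnegative. Its value at the constant \<open>1\<close> is \<open>\<Sum>\<^sub>e (Q\<^sub>e - \<integral>(y\<^sub>e'/y\<^sub>e)\<^sup>2)\<close>,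
  where \<open>y\<^sub>e\<close> solves the equation with boundary values \<open>1\<close>. Thus \<open>\<Sum>\<^sub>e Q\<^sub>e = 0\<close> forces \<open>y\<^sub>e = 1\<close>, that is \<open>q\<^sub>e = 0\<close>.
\<close>


section \<open>Absolutely continuous functions\<close>

text \<open>Two inner products are in play. Eigenfunctions of distinct eigenvalues are orthogonal in
  L^2, while those of one eigenvalue are orthonormalized through their initial data at x = 0, the
  values and the derivatives divided by the frequency. Up to the factor 1/2, the mean of cos^2 and
  of sin^2, both products have the same limit, so the limits are orthonormal whichever of the two
  relations was available. Initial data are preferred because they live in a space of fixed finite
  dimension, where bounded sequences have convergent subsequences. As q is merely integrable, the
  equation holds only almost everywhere, and every identity comes from integrating absolutely
  continuous functions. At the bottom of the spectrum the obstacle is that the form on the vertex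
  values has poles at the Dirichlet eigenvalues of the edges. As lam increases to a first such
  eigenvalue, the form at the constant 1 tends to -infinity, so positivity is lost before a pole is
  reached and the continuation in lam never meets one.\<close>

abbreviation "ac \<equiv> abs_continuous_on_interval"

definition short_intervals :: "real \<Rightarrow> real \<Rightarrow> real \<Rightarrow> (real \<times> real) set \<Rightarrow> bool" where
  "short_intervals a b \<delta> I \<longleftrightarrow> finite I \<and> (\<forall>(s, t)\<in>I. a \<le> s \<and> s \<le> t \<and> t \<le> b)
     \<and> disjoint_family_on (\<lambda>(s, t). {s<..<t}) I \<and> (\<Sum>(s, t)\<in>I. t - s) < \<delta>"

lemma short_intervalsD:
  assumes "short_intervals a b \<delta> I" "(s, t) \<in> I"
  shows "a \<le> s" "s \<le> t" "t \<le> b"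
  using assms unfolding short_intervals_def by blast+

lemma ac_iff:
  "ac a b f \<longleftrightarrow>
     (\<forall>\<epsilon>>0. \<exists>\<delta>>0. \<forall>I. short_intervals a b \<delta> I \<longrightarrow> (\<Sum>(s, t)\<in>I. \<bar>f t - f s\<bar>) < \<epsilon>)"
  unfolding abs_continuous_on_interval_def short_intervals_def ..

text \<open>Sums, products, the exponential and Lipschitz functions all come with a bound of their
  increments by those of one or two absolutely continuous functions, so the epsilon-delta argument
  is carried out once.\<close>

lemma ac_dominated:
  assumes f: "ac a b f" and g: "ac a b g" and AB: "0 \<le> A" "0 \<le> B"
    and le: "\<And>s t. a \<le> s \<Longrightarrow> s \<le> t \<Longrightarrow> t \<le> b \<Longrightarrow> \<bar>h t - h s\<bar> \<le> A * \<bar>f t - f s\<bar> + B * \<bar>g t - g s\<bar>"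
  shows "ac a b h"
  unfolding ac_iff
proof (intro allI impI)
  fix \<epsilon> :: real assume "0 < \<epsilon>"
  define e where "e = \<epsilon> / (A + B + 1)"
  have e: "0 < e" using \<open>0 < \<epsilon>\<close> AB by (simp add: e_def)
  obtain d1 where d1: "0 < d1"
    "\<forall>I. short_intervals a b d1 I \<longrightarrow> (\<Sum>(s, t)\<in>I. \<bar>f t - f s\<bar>) < e"
    using f e unfolding ac_iff by blast
  obtain d2 where d2: "0 < d2"
    "\<forall>I. short_intervals a b d2 I \<longrightarrow> (\<Sum>(s, t)\<in>I. \<bar>g t - g s\<bar>) < e"
    using g e unfolding ac_iff by blast
  show "\<exists>\<delta>>0. \<forall>I. short_intervals a b \<delta> I \<longrightarrow> (\<Sum>(s, t)\<in>I. \<bar>h t - h s\<bar>) < \<epsilon>"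
  proof (intro exI[of _ "min d1 d2"] conjI allI impI)
    show "0 < min d1 d2" using d1(1) d2(1) by simp
    fix I
    assume I: "short_intervals a b (min d1 d2) I"
    then have I1: "short_intervals a b d1 I" and I2: "short_intervals a b d2 I"
      by (auto simp: short_intervals_def)
    have "(\<Sum>(s, t)\<in>I. \<bar>h t - h s\<bar>) \<le> (\<Sum>(s, t)\<in>I. A * \<bar>f t - f s\<bar> + B * \<bar>g t - g s\<bar>)"
      using short_intervalsD[OF I] by (intro sum_mono) (auto intro: le)
    also have "\<dots> = A * (\<Sum>(s, t)\<in>I. \<bar>f t - f s\<bar>) + B * (\<Sum>(s, t)\<in>I. \<bar>g t - g s\<bar>)"
      by (simp add: sum.distrib sum_distrib_left split_def)
    also have "\<dots> \<le> A * e + B * e"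
      using d1(2) d2(2) I1 I2 AB by (intro add_mono mult_left_mono) (auto intro: less_imp_le)
    also have "\<dots> = (A + B) * e" by (simp add: algebra_simps)
    also have "\<dots> < (A + B + 1) * e" using e by simp
    also have "\<dots> = \<epsilon>" using AB by (simp add: e_def)
    finally show "(\<Sum>(s, t)\<in>I. \<bar>h t - h s\<bar>) < \<epsilon>" .
  qed
qed

lemma ac_id: "ac a b (\<lambda>x. x)"
proof -
  have "(\<Sum>(s, t)\<in>I. \<bar>t - s\<bar>) < \<epsilon>" if "short_intervals a b \<epsilon> I" for I \<epsilon>
  proof -
    have "(\<Sum>(s, t)\<in>I. \<bar>t - s\<bar>) = (\<Sum>(s, t)\<in>I. t - s)"
      using short_intervalsD[OF that] by (intro sum.cong) auto
    then show ?thesis using that by (simp add: short_intervals_def)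
  qed
  then show ?thesis unfolding ac_iff by blast
qed

lemma ac_lipschitz:
  assumes "\<And>s t. a \<le> s \<Longrightarrow> s \<le> t \<Longrightarrow> t \<le> b \<Longrightarrow> \<bar>h t - h s\<bar> \<le> L * (t - s)"
  shows "ac a b h"
proof (rule ac_dominated[OF ac_id ac_id, of "\<bar>L\<bar>" 0])
  fix s t assume *: "a \<le> s" "s \<le> t" "t \<le> b"
  have "\<bar>h t - h s\<bar> \<le> L * (t - s)" using assms[OF *] .
  also have "\<dots> \<le> \<bar>L\<bar> * \<bar>t - s\<bar>" using * by (simp add: mult_right_mono)
  finally show "\<bar>h t - h s\<bar> \<le> \<bar>L\<bar> * \<bar>t - s\<bar> + 0 * \<bar>t - s\<bar>" by simp
qed auto

lemma ac_C1:
  assumes "\<And>x. x \<in> {a..b} \<Longrightarrow> (f has_real_derivative f' x) (at x within {a..b})"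
    and "continuous_on {a..b} f'"
  shows "ac a b f"
proof -
  have "compact (f' ` {a..b})"
    by (intro compact_continuous_image assms) auto
  then obtain L where L: "\<And>x. x \<in> {a..b} \<Longrightarrow> norm (f' x) \<le> L"
    using compact_imp_bounded bounded_iff by (metis imageI)
  show ?thesis
  proof (rule ac_lipschitz)
    fix s t assume st: "a \<le> s" "s \<le> t" "t \<le> b"
    have "norm (f t - f s) \<le> L * norm (t - s)"
      using assms(1) L st
      by (intro field_differentiable_bound[of "{a..b}" f f']) auto
    then show "\<bar>f t - f s\<bar> \<le> L * (t - s)" using st by simp
  qed
qed

lemma ac_subinterval:
  assumes "ac a b f" "a \<le> c" "d \<le> b"
  shows "ac c d f"
proof -
  have "short_intervals c d \<delta> I \<Longrightarrow> short_intervals a b \<delta> I" for \<delta> I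
    using assms(2,3) unfolding short_intervals_def by force
  then show ?thesis using assms(1) unfolding ac_iff by meson
qed

lemma ac_continuous:
  assumes "ac a b f"
  shows "continuous_on {a..b} f"
  unfolding continuous_on_iff
proof (intro ballI allI impI)
  fix x \<epsilon> :: real assume x: "x \<in> {a..b}" and "0 < \<epsilon>"
  then obtain \<delta> where d: "0 < \<delta>"
    "\<forall>I. short_intervals a b \<delta> I \<longrightarrow> (\<Sum>(s, t)\<in>I. \<bar>f t - f s\<bar>) < \<epsilon>"
    using assms unfolding ac_iff by blast
  have "\<bar>f t - f s\<bar> < \<epsilon>" if "a \<le> s" "s \<le> t" "t \<le> b" "t - s < \<delta>" for s t
    using d(2)[rule_format, of "{(s, t)}"] that by (simp add: disjoint_family_on_def short_intervals_def)
  then show "\<exists>d>0. \<forall>x'\<in>{a..b}. dist x' x < d \<longrightarrow> dist (f x') (f x) < \<epsilon>"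
    using x d(1) by (intro exI[of _ \<delta>]) (force simp: dist_real_def abs_real_def split: if_splits)
qed

lemma ac_const: "ac a b (\<lambda>x. c)"
  by (rule ac_lipschitz[where L = 0]) simp

lemma ac_add:
  assumes "ac a b f" "ac a b g"
  shows "ac a b (\<lambda>x. f x + g x)"
  by (rule ac_dominated[OF assms, of 1 1]) auto

lemma ac_diff:
  assumes "ac a b f" "ac a b g"
  shows "ac a b (\<lambda>x. f x - g x)"
  by (rule ac_dominated[OF assms, of 1 1]) auto

lemma ac_mult:
  assumes "ac a b f" "ac a b g"
  shows "ac a b (\<lambda>x. f x * g x)"
proof -
  have "\<exists>B. \<forall>x\<in>{a..b}. \<bar>h x\<bar> \<le> B" if "ac a b h" for h
  proof -
    have "compact (h ` {a..b})"
      using that by (intro compact_continuous_image ac_continuous) auto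
    then show ?thesis
      using compact_imp_bounded bounded_iff by (metis imageI real_norm_def)
  qed
  then obtain A B where A: "\<And>x. x \<in> {a..b} \<Longrightarrow> \<bar>f x\<bar> \<le> A" and B: "\<And>x. x \<in> {a..b} \<Longrightarrow> \<bar>g x\<bar> \<le> B"
    using assms by metis
  show ?thesis
  proof (rule ac_dominated[OF assms, of "\<bar>B\<bar>" "\<bar>A\<bar>"])
    fix s t assume st: "a \<le> s" "s \<le> t" "t \<le> b"
    have "\<bar>f t * g t - f s * g s\<bar> = \<bar>(f t - f s) * g t + f s * (g t - g s)\<bar>"
      by (simp add: algebra_simps)
    also have "\<dots> \<le> \<bar>f t - f s\<bar> * \<bar>g t\<bar> + \<bar>f s\<bar> * \<bar>g t - g s\<bar>"
      by (metis abs_mult abs_triangle_ineq)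
    also have "\<dots> \<le> \<bar>f t - f s\<bar> * \<bar>B\<bar> + \<bar>A\<bar> * \<bar>g t - g s\<bar>"
      using A[of s] B[of t] st by (intro add_mono mult_left_mono mult_right_mono) auto
    finally show "\<bar>f t * g t - f s * g s\<bar> \<le> \<bar>B\<bar> * \<bar>f t - f s\<bar> + \<bar>A\<bar> * \<bar>g t - g s\<bar>"
      by (simp add: algebra_simps)
  qed auto
qed

section \<open>The fundamental theorem of calculus for absolutely continuous functions\<close>

lemma ac_division:
  assumes "ac a b f" "0 < \<epsilon>"
  shows "\<exists>\<delta>>0. \<forall>D. D division_of \<Union>D \<and> \<Union>D \<subseteq> {a..b} \<and> measure lebesgue (\<Union>D) < \<delta> \<longrightarrow>
       (\<Sum>K\<in>D. \<bar>f (Sup K) - f (Inf K)\<bar>) < \<epsilon>"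
proof -
  obtain \<delta> where d: "0 < \<delta>"
    "\<forall>I. short_intervals a b \<delta> I \<longrightarrow> (\<Sum>(s, t)\<in>I. \<bar>f t - f s\<bar>) < \<epsilon>"
    using assms unfolding ac_iff by blast
  have "(\<Sum>K\<in>D. \<bar>f (Sup K) - f (Inf K)\<bar>) < \<epsilon>"
    if D: "D division_of \<Union>D" "\<Union>D \<subseteq> {a..b}" "measure lebesgue (\<Union>D) < \<delta>" for D
  proof -
    let ?h = "\<lambda>K :: real set. (Inf K, Sup K)"
    have fin: "finite D" using D(1) by blast
    have K: "\<exists>u v. K = {u..v} \<and> u \<le> v \<and> a \<le> u \<and> v \<le> b" if KD: "K \<in> D" for K
    proof -
      obtain u v where uv: "K = {u..v}" "K \<noteq> {}"
        using division_ofD(3,4)[OF D(1) KD] by auto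
      moreover have "K \<subseteq> {a..b}" using D(2) KD by auto
      ultimately show ?thesis by auto
    qed
    have inj: "inj_on ?h D"
    proof (rule inj_onI)
      fix K L assume "K \<in> D" "L \<in> D" "?h K = ?h L"
      then show "K = L" using K[of K] K[of L] by auto
    qed
    have "short_intervals a b \<delta> (?h ` D)"
      unfolding short_intervals_def
    proof (intro conjI)
      show "finite (?h ` D)" using fin by simp
      show "\<forall>(s, t)\<in>?h ` D. a \<le> s \<and> s \<le> t \<and> t \<le> b"
        using K by fastforce
      show "disjoint_family_on (\<lambda>(s, t). {s<..<t}) (?h ` D)"
        unfolding disjoint_family_on_def
      proof (intro ballI impI)
        fix p p' assume p: "p \<in> ?h ` D" "p' \<in> ?h ` D" "p \<noteq> p'"
        then obtain K L where KL: "K \<in> D" "L \<in> D" "p = ?h K" "p' = ?h L" "K \<noteq> L" by blast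
        then have "interior K \<inter> interior L = {}" using division_ofD(5)[OF D(1)] by blast
        then show "(case p of (s, t) \<Rightarrow> {s<..<t}) \<inter> (case p' of (s, t) \<Rightarrow> {s<..<t}) = {}"
          using K[OF KL(1)] K[OF KL(2)] KL by auto
      qed
      have "(\<Sum>(s, t)\<in>?h ` D. t - s) = (\<Sum>K\<in>D. measure lebesgue K)"
        unfolding sum.reindex[OF inj] comp_def
        by (rule sum.cong) (auto dest!: K)
      also have "\<dots> = measure lebesgue (\<Union>D)" using content_division[OF D(1)] .
      finally show "(\<Sum>(s, t)\<in>?h ` D. t - s) < \<delta>" using D(3) by simp
    qed
    then have "(\<Sum>(s, t)\<in>?h ` D. \<bar>f t - f s\<bar>) < \<epsilon>" using d(2) by blast
    then show ?thesis
      unfolding sum.reindex[OF inj] comp_def by simp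
  qed
  with d(1) show ?thesis by blast
qed

text \<open>A Henstock-Kurzweil argument. At tags outside \<open>N\<close> the gauge comes from
  differentiability. At tags in \<open>N\<close> it is an open \<open>U\<close> around
  \<open>N\<close> of measure below the \<open>\<delta>\<close> of absolute continuity, so that the
  increments of \<open>f\<close> over those intervals add up to less than \<open>e / 2\<close>;
  there \<open>g'\<close> is 0 and the Riemann sum receives nothing.\<close>

theorem ac_has_integral:
  assumes ac: "ac a b f" and ab: "a \<le> b" and N: "negligible N"
    and deriv: "\<And>x. x \<in> {a..b} - N \<Longrightarrow> (f has_real_derivative g x) (at x within {a..b})"
  shows "(g has_integral f b - f a) {a..b}"
proof -
  define g' where "g' = (\<lambda>x. if x \<in> N then 0 else g x)"
  have "(g' has_integral f b - f a) (cbox a b)"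
    unfolding has_integral
  proof (intro allI impI)
    fix e :: real assume e: "0 < e"
    \<comment> \<open>Errors of \<open>e1\<close> times length add up to at most
      \<open>e / 2\<close>; the \<open>+ 1\<close> covers \<open>a = b\<close>.\<close>
    define e1 where "e1 = e / (2 * (b - a + 1))"
    have e1: "0 < e1" using e ab by (simp add: e1_def)
    have "\<forall>x. \<exists>d>0. x \<in> {a..b} - N \<longrightarrow>
        (\<forall>y\<in>{a..b}. \<bar>y - x\<bar> < d \<longrightarrow> \<bar>f y - f x - g x * (y - x)\<bar> \<le> e1 * \<bar>y - x\<bar>)"
      using deriv e1 unfolding has_field_derivative_def has_derivative_within_alt real_norm_def
      by (metis zero_less_one)
    then obtain d where d: "\<And>x. 0 < d x" "\<And>x y. x \<in> {a..b} - N \<Longrightarrow> y \<in> {a..b} \<Longrightarrow>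
        \<bar>y - x\<bar> < d x \<Longrightarrow> \<bar>f y - f x - g x * (y - x)\<bar> \<le> e1 * \<bar>y - x\<bar>"
      by metis
    obtain \<delta> where \<delta>: "0 < \<delta>"
      "\<forall>D. D division_of \<Union>D \<and> \<Union>D \<subseteq> {a..b} \<and> measure lebesgue (\<Union>D) < \<delta> \<longrightarrow>
         (\<Sum>K\<in>D. \<bar>f (Sup K) - f (Inf K)\<bar>) < e / 2"
      using ac_division[OF ac, of "e / 2"] e by auto
    have "N \<in> sets lebesgue" using N by (simp add: negligible_imp_sets)
    then obtain U where U: "open U" "N \<subseteq> U" "U - N \<in> lmeasurable" "emeasure lebesgue (U - N) < ennreal \<delta>"
      using sets_lebesgue_outer_open[OF _ \<delta>(1)] by blast
    have UN: "U = (U - N) \<union> N" using U(2) by blast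
    have Um: "U \<in> lmeasurable"
      using U(3) negligible_imp_measurable[OF N] UN by (metis fmeasurable.Un)
    have Ud: "measure lebesgue U < \<delta>"
    proof -
      have "measure lebesgue U = measure lebesgue (U - N)"
        by (metis Diff_Diff_Int N measure_Un_null_set U(3) UN fmeasurableD negligible_iff_null_sets)
      also have "\<dots> < \<delta>"
        using U(3,4) \<delta>(1) by (metis emeasure_eq_measure2 ennreal_less_iff measure_nonneg)
      finally show ?thesis .
    qed
    define \<gamma> where "\<gamma> = (\<lambda>x. if x \<in> N then U else ball x (d x))"
    have gauge: "gauge \<gamma>"
      using U(1,2) d(1) by (auto simp: gauge_def \<gamma>_def)
    have main: "norm ((\<Sum>(x, K)\<in>p. measure lborel K *\<^sub>R g' x) - (f b - f a)) < e"
      if p: "p tagged_division_of cbox a b" and fine: "\<gamma> fine p" for p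
    proof -
      have fin: "finite p" using p by blast
      define p1 where "p1 = {xK\<in>p. fst xK \<in> N}"
      define p2 where "p2 = {xK\<in>p. fst xK \<notin> N}"
      have p12: "p = p1 \<union> p2" "p1 \<inter> p2 = {}" "finite p1" "finite p2" "p1 \<subseteq> p" "p2 \<subseteq> p"
        using fin by (auto simp: p1_def p2_def)
      have K: "\<exists>u v. K = {u..v} \<and> u \<le> v \<and> a \<le> u \<and> v \<le> b \<and> u \<le> x \<and> x \<le> v" if xK: "(x, K) \<in> p" for x K
      proof -
        obtain u v where "K = {u..v}" using tagged_division_ofD(4)[OF p xK] by auto
        moreover have "x \<in> K" "K \<subseteq> {a..b}" using tagged_division_ofD(2,3)[OF p xK] by auto
        ultimately show ?thesis by auto
      qed
      have fba: "f b - f a = (\<Sum>(x, K)\<in>p. f (Sup K) - f (Inf K))"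
        using additive_tagged_division_1[of a b p f] ab p by auto
      let ?D = "\<lambda>xK. measure lborel (snd xK) * g' (fst xK) - (f (Sup (snd xK)) - f (Inf (snd xK)))"
      have "(\<Sum>(x, K)\<in>p. measure lborel K *\<^sub>R g' x) - (f b - f a) = sum ?D p"
        unfolding fba by (simp add: sum_subtractf split_def)
      also have "\<dots> = sum ?D p1 + sum ?D p2"
        unfolding p12(1) by (rule sum.union_disjoint[OF p12(3,4,2)])
      finally have eq: "(\<Sum>(x, K)\<in>p. measure lborel K *\<^sub>R g' x) - (f b - f a) = sum ?D p1 + sum ?D p2" .
      have "\<bar>sum ?D p1\<bar> < e / 2"
      proof -
        define D where "D = snd ` p1"
        have tp: "p1 tagged_partial_division_of cbox a b"
          using conjunct1[OF p[unfolded tagged_division_of_def]] p12(5)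
          by (rule tagged_partial_division_subset)
        have t1: "p1 tagged_division_of \<Union>D"
          unfolding D_def by (rule tagged_partial_division_of_Union_self[OF tp])
        have div: "D division_of \<Union>D"
          using division_of_tagged_division[OF t1] by (simp only: D_def[symmetric])
        have D1: "\<exists>x. (x, L) \<in> p \<and> x \<in> N" if "L \<in> D" for L
          using that by (auto simp: D_def p1_def)
        have "\<Union>D \<subseteq> {a..b}"
        proof (rule Union_least)
          fix L assume "L \<in> D"
          then obtain x where "(x, L) \<in> p" using D1 by blast
          then show "L \<subseteq> {a..b}" using tagged_division_ofD(3)[OF p] by auto
        qed
        moreover have "\<Union>D \<subseteq> U"
        proof (rule Union_least)
          fix L assume "L \<in> D"
          then obtain x where "(x, L) \<in> p" "x \<in> N" using D1 by blast
          then show "L \<subseteq> U" using fineD[OF fine, of x L] by (simp add: \<gamma>_def)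
        qed
        then have "measure lebesgue (\<Union>D) \<le> measure lebesgue U"
          using lmeasurable_division[OF div] Um by (intro measure_mono_fmeasurable) (auto intro: fmeasurableD)
        ultimately have less: "(\<Sum>K\<in>D. \<bar>f (Sup K) - f (Inf K)\<bar>) < e / 2"
          using \<delta>(2) div Ud by simp
        have "\<bar>sum ?D p1\<bar> \<le> (\<Sum>xK\<in>p1. \<bar>?D xK\<bar>)" by (rule sum_abs)
        also have "\<dots> = (\<Sum>(x, K)\<in>p1. if K = {} then 0 else \<bar>f (Sup K) - f (Inf K)\<bar>)"
        proof (rule sum.cong[OF refl])
          fix xK assume xK: "xK \<in> p1"
          obtain x K where [simp]: "xK = (x, K)" by force
          have "x \<in> N" "(x, K) \<in> p" using xK by (auto simp: p1_def)
          then show "\<bar>?D xK\<bar> = (case xK of (x, K) \<Rightarrow> if K = {} then 0 else \<bar>f (Sup K) - f (Inf K)\<bar>)"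
            using tagged_division_ofD(2)[OF p, of x K] by (auto simp: g'_def)
        qed
        also have "\<dots> = (\<Sum>K\<in>D. if K = {} then 0 else \<bar>f (Sup K) - f (Inf K)\<bar>)"
          unfolding D_def
        proof (rule sum.over_tagged_division_lemma[OF t1])
          fix u v :: real assume "box u v = {}"
          then have "cbox u v = {} \<or> u = v" by auto
          then show "(if cbox u v = {} then 0 else \<bar>f (Sup (cbox u v)) - f (Inf (cbox u v))\<bar>) = 0"
            by auto
        qed
        also have "\<dots> \<le> (\<Sum>K\<in>D. \<bar>f (Sup K) - f (Inf K)\<bar>)"
          by (rule sum_mono) auto
        finally show ?thesis using less by linarith
      qed
      moreover have "\<bar>sum ?D p2\<bar> \<le> e / 2"
      proof -
        have "\<bar>?D (x, K)\<bar> \<le> e1 * measure lborel K" if "(x, K) \<in> p2" for x K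
        proof -
          have xK: "(x, K) \<in> p" "x \<notin> N" using that by (auto simp: p2_def)
          obtain u v where uv: "K = {u..v}" "u \<le> v" "a \<le> u" "v \<le> b" "u \<le> x" "x \<le> v"
            using K[OF xK(1)] by blast
          have "K \<subseteq> ball x (d x)" using fineD[OF fine xK(1)] xK(2) by (simp add: \<gamma>_def)
          moreover have "u \<in> K" "v \<in> K" using uv by auto
          ultimately have "u \<in> ball x (d x)" "v \<in> ball x (d x)" by blast+
          then have *: "\<bar>f u - f x - g x * (u - x)\<bar> \<le> e1 * \<bar>u - x\<bar>" "\<bar>f v - f x - g x * (v - x)\<bar> \<le> e1 * \<bar>v - x\<bar>"
            using d(2)[of x u] d(2)[of x v] uv xK(2) by (simp_all add: dist_real_def)
          have "?D (x, K) = (f u - f x - g x * (u - x)) - (f v - f x - g x * (v - x))"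
            using uv xK(2) by (simp add: g'_def algebra_simps)
          then have "\<bar>?D (x, K)\<bar> \<le> e1 * \<bar>u - x\<bar> + e1 * \<bar>v - x\<bar>" using * by linarith
          also have "\<dots> = e1 * measure lborel K" using uv by (simp add: algebra_simps)
          finally show ?thesis .
        qed
        then have "\<bar>sum ?D p2\<bar> \<le> (\<Sum>xK\<in>p2. e1 * measure lborel (snd xK))"
          by (intro order_trans[OF sum_abs] sum_mono) auto
        also have "\<dots> \<le> (\<Sum>xK\<in>p. e1 * measure lborel (snd xK))"
          using p12 fin e1 by (intro sum_mono2) auto
        also have "\<dots> = e1 * (\<Sum>(x, K)\<in>p. measure lborel K)" by (simp add: sum_distrib_left split_def)
        also have "\<dots> = e1 * (b - a)"
          using additive_content_tagged_division[OF p] ab by simp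
        also have "\<dots> \<le> e1 * (b - a + 1)" using e1 by simp
        also have "\<dots> = e / 2" using ab by (simp add: e1_def field_simps)
        finally show ?thesis .
      qed
      ultimately show ?thesis unfolding eq by simp
    qed
    show "\<exists>\<gamma>. gauge \<gamma> \<and> (\<forall>\<D>. \<D> tagged_division_of cbox a b \<and> \<gamma> fine \<D> \<longrightarrow>
        norm ((\<Sum>(x, k)\<in>\<D>. measure lborel k *\<^sub>R g' x) - (f b - f a)) < e)"
      by (intro exI[of _ \<gamma>] conjI allI impI gauge; elim conjE) (rule main)
  qed
  then show ?thesis
    using has_integral_spike[OF N, of "{a..b}" g g' "f b - f a"] by (simp add: g'_def)
qed

lemma AE_on_iff_negligible:
  "(AE x\<in>S in lebesgue. P x) \<longleftrightarrow> negligible {x\<in>S. \<not> P x}"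
proof
  assume "AE x\<in>S in lebesgue. P x"
  then obtain N where "N \<in> null_sets lebesgue" "{x\<in>S. \<not> P x} \<subseteq> N"
    unfolding eventually_ae_filter by auto
  then show "negligible {x\<in>S. \<not> P x}"
    using negligible_iff_null_sets negligible_subset by blast
next
  assume "negligible {x\<in>S. \<not> P x}"
  then show "AE x\<in>S in lebesgue. P x"
    unfolding eventually_ae_filter negligible_iff_null_sets
    by (intro bexI[of _ "{x\<in>S. \<not> P x}"]) auto
qed

section \<open>Indefinite integrals: absolute continuity and differentiability almost
  everywhere\<close>

lemma sum_integrals_le:
  fixes k :: "real \<Rightarrow> real"
  assumes I: "short_intervals a b \<delta> I" and k: "k integrable_on {a..b}" and nn: "\<And>x. x \<in> {a..b} \<Longrightarrow> 0 \<le> k x"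
  shows "(\<Sum>(s, t)\<in>I. integral {s..t} k) \<le> integral {a..b} k"
proof -
  let ?T = "\<lambda>p :: real \<times> real. {fst p..snd p}"
  have sub: "?T p \<subseteq> {a..b}" if "p \<in> I" for p
    using short_intervalsD[OF I, of "fst p" "snd p"] that by auto
  have "(k has_integral (\<Sum>p\<in>I. integral (?T p) k)) (\<Union>p\<in>I. ?T p)"
  proof (rule has_integral_UN)
    show "finite I" using I by (simp add: short_intervals_def)
    show "(k has_integral integral (?T p) k) (?T p)" if "p \<in> I" for p
      using integrable_on_subinterval[OF k sub[OF that]] by (rule integrable_integral)
    show "pairwise (\<lambda>i i'. negligible (?T i \<inter> ?T i')) I"
    proof (rule pairwiseI)
      fix p p' assume p: "p \<in> I" "p' \<in> I" "p \<noteq> p'"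
      have "(case p of (s, t) \<Rightarrow> {s<..<t}) \<inter> (case p' of (s, t) \<Rightarrow> {s<..<t}) = {}"
        using I p unfolding short_intervals_def disjoint_family_on_def by blast
      then have "{fst p<..<snd p} \<inter> {fst p'<..<snd p'} = {}"
        by (simp add: split_def)
      then have "?T p \<inter> ?T p' \<subseteq> {fst p, snd p, fst p', snd p'}"
        by force
      then show "negligible (?T p \<inter> ?T p')"
        by (rule negligible_subset[rotated]) simp
    qed
  qed
  then have "(\<Sum>p\<in>I. integral (?T p) k) \<le> integral {a..b} k"
    using has_integral_subset_le[of "\<Union>p\<in>I. ?T p" "{a..b}" k] integrable_integral[OF k]
      UN_least[of I ?T "{a..b}", OF sub] nn by blast
  then show ?thesis by (simp add: split_def)
qed

text \<open>Truncation splits \<open>\<bar>g\<bar>\<close> into a part \<open>h n\<close> bounded by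
  \<open>n\<close>, which contributes at most \<open>n\<close> times the total length, and a
  remainder \<open>k\<close> whose whole integral is below \<open>\<epsilon> / 2\<close> once
  \<open>n\<close> is large. Only the first part constrains \<open>\<delta>\<close>.\<close>

lemma ac_indefinite_integral:
  fixes g :: "real \<Rightarrow> real"
  assumes g: "g absolutely_integrable_on {a..b}"
  shows "ac a b (\<lambda>x. integral {a..x} g)"
  unfolding ac_iff
proof (intro allI impI)
  fix \<epsilon> :: real assume \<epsilon>: "0 < \<epsilon>"
  define h where "h = (\<lambda>n x. min \<bar>g x\<bar> (real n))"
  have ag: "(\<lambda>x. \<bar>g x\<bar>) absolutely_integrable_on {a..b}"
    using absolutely_integrable_abs[OF g] by simp
  then have agi: "(\<lambda>x. \<bar>g x\<bar>) integrable_on {a..b}"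
    by (rule absolutely_integrable_on_def[THEN iffD1, THEN conjunct1])
  have h: "h n integrable_on {a..b}" for n
  proof -
    have "(\<lambda>x. real n) absolutely_integrable_on {a..b}"
      by (intro absolutely_integrable_on_const) simp
    from absolutely_integrable_min_1[OF ag this] show ?thesis
      unfolding h_def by (rule absolutely_integrable_on_def[THEN iffD1, THEN conjunct1])
  qed
  have "(\<lambda>n. integral {a..b} (h n)) \<longlonglongrightarrow> integral {a..b} (\<lambda>x. \<bar>g x\<bar>)"
  proof (rule dominated_convergence(2)[OF h agi])
    show "norm (h n x) \<le> \<bar>g x\<bar>" for n x by (simp add: h_def)
    show "(\<lambda>n. h n x) \<longlonglongrightarrow> \<bar>g x\<bar>" for x
    proof (rule tendsto_eventually)
      obtain n0 :: nat where "\<bar>g x\<bar> \<le> real n0" using real_arch_simple by blast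
      then show "\<forall>\<^sub>F n in sequentially. h n x = \<bar>g x\<bar>"
        unfolding eventually_sequentially h_def by (intro exI[of _ n0]) auto
    qed
  qed
  then obtain n where n: "\<bar>integral {a..b} (h n) - integral {a..b} (\<lambda>x. \<bar>g x\<bar>)\<bar> < \<epsilon> / 2"
    using \<epsilon> unfolding LIMSEQ_iff by (metis half_gt_zero order_refl real_norm_def)
  define k where "k = (\<lambda>x. \<bar>g x\<bar> - h n x)"
  have k: "k integrable_on {a..b}" unfolding k_def by (intro integrable_diff agi h)
  have k0: "0 \<le> k x" for x by (simp add: k_def h_def)
  have kint: "integral {a..b} k < \<epsilon> / 2"
    using n unfolding k_def by (subst integral_diff[OF agi h]) linarith
  define \<delta> where "\<delta> = \<epsilon> / (2 * (real n + 1))"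
  have \<delta>: "0 < \<delta>" using \<epsilon> by (simp add: \<delta>_def)
  have "(\<Sum>(s, t)\<in>I. \<bar>integral {a..t} g - integral {a..s} g\<bar>) < \<epsilon>" if I: "short_intervals a b \<delta> I" for I
  proof -
    have "\<bar>integral {a..t} g - integral {a..s} g\<bar> \<le> integral {s..t} k + real n * (t - s)"
      if st: "a \<le> s" "s \<le> t" "t \<le> b" for s t
    proof -
      have sub: "{s..t} \<subseteq> {a..b}" using st by auto
      have gi: "g integrable_on {a..t}"
        using g st by (meson absolutely_integrable_on_def atLeastatMost_subset_iff integrable_on_subinterval order_refl)
      have agst: "(\<lambda>x. \<bar>g x\<bar>) integrable_on {s..t}" "k integrable_on {s..t}" "h n integrable_on {s..t}"
        using integrable_on_subinterval[OF _ sub] agi k h by blast+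
      have "integral {a..t} g - integral {a..s} g = integral {s..t} g"
        using Henstock_Kurzweil_Integration.integral_combine[OF st(1,2) gi] by linarith
      then have "\<bar>integral {a..t} g - integral {a..s} g\<bar> \<le> integral {s..t} (\<lambda>x. \<bar>g x\<bar>)"
        using integral_norm_bound_integral[of g "{s..t}" "\<lambda>x. \<bar>g x\<bar>"] agst gi
          integrable_on_subinterval[of g "{a..t}" s t] st by simp
      also have "\<dots> = integral {s..t} (\<lambda>x. k x + h n x)" by (simp add: k_def)
      also have "\<dots> = integral {s..t} k + integral {s..t} (h n)"
        using agst by (intro integral_add)
      also have "integral {s..t} (h n) \<le> integral {s..t} (\<lambda>x. real n)"
        using agst by (intro integral_le) (auto simp: h_def)
      finally show ?thesis using st by (simp add: algebra_simps)
    qed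
    then have "(\<Sum>(s, t)\<in>I. \<bar>integral {a..t} g - integral {a..s} g\<bar>) \<le> (\<Sum>(s, t)\<in>I. integral {s..t} k + real n * (t - s))"
      using short_intervalsD[OF I] by (intro sum_mono) auto
    also have "\<dots> = (\<Sum>(s, t)\<in>I. integral {s..t} k) + real n * (\<Sum>(s, t)\<in>I. t - s)"
      by (simp add: sum.distrib sum_distrib_left split_def)
    also have "\<dots> \<le> integral {a..b} k + real n * \<delta>"
      using sum_integrals_le[OF I k k0] I by (intro add_mono mult_left_mono) (auto simp: short_intervals_def)
    also have "\<dots> < \<epsilon> / 2 + \<epsilon> / 2"
    proof (rule add_less_le_mono[OF kint])
      have "real n * \<delta> \<le> (real n + 1) * \<delta>" using \<delta> by simp
      also have "\<dots> = \<epsilon> / 2"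
        using add_pos_nonneg[of 1 "real n"] by (simp add: \<delta>_def field_simps del: of_nat_Suc)
      finally show "real n * \<delta> \<le> \<epsilon> / 2" .
    qed
    finally show ?thesis by simp
  qed
  with \<delta> show "\<exists>\<delta>>0. \<forall>I. short_intervals a b \<delta> I \<longrightarrow> (\<Sum>(s, t)\<in>I. \<bar>integral {a..t} g - integral {a..s} g\<bar>) < \<epsilon>"
    by blast
qed

lemma has_real_derivative_right_left:
  fixes F :: "real \<Rightarrow> real"
  assumes "\<And>e. 0 < e \<Longrightarrow> \<exists>d>0. \<forall>h. 0 < h \<and> h < d \<longrightarrow> \<bar>F (x + h) - F x - D * h\<bar> \<le> e * h"
    and "\<And>e. 0 < e \<Longrightarrow> \<exists>d>0. \<forall>h. 0 < h \<and> h < d \<longrightarrow> \<bar>F x - F (x - h) - D * h\<bar> \<le> e * h"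
  shows "(F has_real_derivative D) (at x)"
  unfolding has_field_derivative_def has_derivative_at_alt
proof (intro conjI allI impI)
  show "bounded_linear ((*) D)" by (rule bounded_linear_mult_right)
  fix e :: real assume "0 < e"
  obtain d1 where d1: "0 < d1" "\<forall>h. 0 < h \<and> h < d1 \<longrightarrow> \<bar>F (x + h) - F x - D * h\<bar> \<le> e * h"
    using assms(1)[OF \<open>0 < e\<close>] by blast
  obtain d2 where d2: "0 < d2" "\<forall>h. 0 < h \<and> h < d2 \<longrightarrow> \<bar>F x - F (x - h) - D * h\<bar> \<le> e * h"
    using assms(2)[OF \<open>0 < e\<close>] by blast
  show "\<exists>d>0. \<forall>y. norm (y - x) < d \<longrightarrow> norm (F y - F x - D * (y - x)) \<le> e * norm (y - x)"
  proof (intro exI[of _ "min d1 d2"] conjI allI impI)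
    show "0 < min d1 d2" using d1 d2 by simp
    fix y assume y: "norm (y - x) < min d1 d2"
    consider "y = x" | "y > x" | "y < x" by linarith
    then show "norm (F y - F x - D * (y - x)) \<le> e * norm (y - x)"
    proof cases
      case 1 then show ?thesis by simp
    next
      case 2 then show ?thesis using d1(2)[rule_format, of "y - x"] y by simp
    next
      case 3
      then have "\<bar>F x - F y - D * (x - y)\<bar> \<le> e * (x - y)" using d2(2)[rule_format, of "x - y"] y by simp
      moreover have "F y - F x - D * (y - x) = - (F x - F y - D * (x - y))" by (simp add: algebra_simps)
      ultimately show ?thesis using 3 by simp
    qed
  qed
qed

text \<open>\<open>integrable_ccontinuous_explicit\<close> controls averages over intervals to the
  right of a point. Averages to the left are those of the reflected function \<open>f (- x)\<close>,
  whose exceptional set is reflected back. One null set serves all base points \<open>a\<close>,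
  since increments of the integral do not depend on \<open>a\<close>.\<close>

theorem lebesgue_differentiation:
  fixes f :: "real \<Rightarrow> real"
  assumes f: "\<And>a b. f integrable_on {a..b}"
  obtains N where "negligible N"
    "\<And>a x. x \<notin> N \<Longrightarrow> a < x \<Longrightarrow> ((\<lambda>u. integral {a..u} f) has_real_derivative f x) (at x)"
proof -
  have fm: "(\<lambda>x. f (- x)) integrable_on {a..b}" for a b
    using f[of "-b" "-a"] Henstock_Kurzweil_Integration.integrable_reflect_real[where f = f and a = "-b" and b = "-a"] by simp
  have right: "\<exists>N. negligible N \<and> (\<forall>x e. x \<notin> N \<and> 0 < e \<longrightarrow>
      (\<exists>d>0. \<forall>h. 0 < h \<and> h < d \<longrightarrow> \<bar>integral {x..x + h} g - g x * h\<bar> \<le> e * h))"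
    if g: "\<And>a b. g integrable_on {a..b}" for g :: "real \<Rightarrow> real"
  proof -
    obtain N where N: "negligible N" "\<And>x e. \<lbrakk>x \<notin> N; 0 < e\<rbrakk> \<Longrightarrow> \<exists>d>0. \<forall>h. 0 < h \<and> h < d \<longrightarrow>
         norm(integral (cbox x (x + h *\<^sub>R One)) g /\<^sub>R h ^ DIM(real) - g x) < e"
      using integrable_ccontinuous_explicit[of g] g by auto
    have "\<exists>d>0. \<forall>h. 0 < h \<and> h < d \<longrightarrow> \<bar>integral {x..x + h} g - g x * h\<bar> \<le> e * h"
      if xe: "x \<notin> N" "0 < e" for x e
    proof -
      obtain d where d: "0 < d" "\<forall>h. 0 < h \<and> h < d \<longrightarrow>
         norm(integral (cbox x (x + h *\<^sub>R One)) g /\<^sub>R h ^ DIM(real) - g x) < e"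
        using N(2)[OF xe] by blast
      have "\<bar>integral {x..x + h} g - g x * h\<bar> \<le> e * h" if h: "0 < h" "h < d" for h
      proof -
        have "\<bar>integral {x..x + h} g / h - g x\<bar> < e"
          using d(2)[rule_format, of h] h by (simp add: divide_inverse mult.commute)
        moreover have "\<bar>integral {x..x + h} g - g x * h\<bar> = \<bar>integral {x..x + h} g / h - g x\<bar> * h"
        proof -
          have "integral {x..x + h} g - g x * h = (integral {x..x + h} g / h - g x) * h"
            using h by (simp add: field_simps)
          then show ?thesis using h by (simp add: abs_mult)
        qed
        ultimately show ?thesis using h by simp
      qed
      with d(1) show ?thesis by blast
    qed
    with N(1) show ?thesis by blast
  qed
  obtain N1 where N1: "negligible N1" "\<forall>x e. x \<notin> N1 \<and> 0 < e \<longrightarrow>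
      (\<exists>d>0. \<forall>h. 0 < h \<and> h < d \<longrightarrow> \<bar>integral {x..x + h} f - f x * h\<bar> \<le> e * h)"
    using right[OF f] by blast
  obtain N2 where N2: "negligible N2" "\<forall>x e. x \<notin> N2 \<and> 0 < e \<longrightarrow>
      (\<exists>d>0. \<forall>h. 0 < h \<and> h < d \<longrightarrow> \<bar>integral {x..x + h} (\<lambda>x. f (- x)) - f (- x) * h\<bar> \<le> e * h)"
    using right[OF fm] by blast
  have neg: "negligible (uminus ` N2)"
    by (rule negligible_differentiable_image_negligible[OF _ N2(1)]) (auto intro!: derivative_intros)
  show thesis
  proof (rule that)
    show "negligible (N1 \<union> uminus ` N2)" using N1(1) neg by (rule negligible_Un)
    fix a x assume x: "x \<notin> N1 \<union> uminus ` N2" and ax: "a < x"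
    have x2: "- x \<notin> N2" using x by force
    show "((\<lambda>u. integral {a..u} f) has_real_derivative f x) (at x)"
    proof (rule has_real_derivative_right_left)
      fix e :: real assume e: "0 < e"
      obtain d where d: "0 < d" "\<forall>h. 0 < h \<and> h < d \<longrightarrow> \<bar>integral {x..x + h} f - f x * h\<bar> \<le> e * h"
        using N1(2) x e by blast
      have "integral {a..x + h} f - integral {a..x} f = integral {x..x + h} f" if "0 < h" for h
        using Henstock_Kurzweil_Integration.integral_combine[of a x "x + h" f] f ax that by force
      with d show "\<exists>d>0. \<forall>h. 0 < h \<and> h < d \<longrightarrow> \<bar>integral {a..x + h} f - integral {a..x} f - f x * h\<bar> \<le> e * h"
        by (intro exI[of _ d]) auto
      obtain d where d: "0 < d" "\<forall>h. 0 < h \<and> h < d \<longrightarrow> \<bar>integral {-x..-x + h} (\<lambda>x. f (- x)) - f x * h\<bar> \<le> e * h"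
        using N2(2)[rule_format, of "- x" e] x2 e by auto
      have "integral {a..x} f - integral {a..x - h} f = integral {-x..-x + h} (\<lambda>x. f (- x))"
        if "0 < h" "h < x - a" for h
        using Henstock_Kurzweil_Integration.integral_combine[of a "x - h" x f] f ax that
          Henstock_Kurzweil_Integration.integral_reflect_real[where a = "x - h" and b = x and f = f]
        by (simp add: algebra_simps)
      with d ax show "\<exists>d>0. \<forall>h. 0 < h \<and> h < d \<longrightarrow> \<bar>integral {a..x} f - integral {a..x - h} f - f x * h\<bar> \<le> e * h"
        by (intro exI[of _ "min d (x - a)"]) auto
    qed
  qed
qed


section \<open>Functions with an almost everywhere derivative, and solutions of the equation\<close>

lemma continuous_on_interval_bounded:
  fixes f :: "real \<Rightarrow> real"
  assumes "continuous_on {a..b} f"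
  obtains B where "\<And>x. x \<in> {a..b} \<Longrightarrow> \<bar>f x\<bar> \<le> B"
proof -
  have "bounded (f ` {a..b})"
    using assms by (intro compact_imp_bounded compact_continuous_image) auto
  then obtain B where "\<forall>y\<in>f ` {a..b}. norm y \<le> B" unfolding bounded_iff by blast
  then show thesis by (intro that[of B]) auto
qed

text \<open>The Sobolev space W^{1,1} with weak derivative \<open>f'\<close>. Absolute continuity is
  included because a derivative almost everywhere alone would not recover \<open>f\<close> by
  integration.\<close>

definition has_ae_derivative :: "(real \<Rightarrow> real) \<Rightarrow> (real \<Rightarrow> real) \<Rightarrow> bool" where
  "has_ae_derivative f f' \<longleftrightarrow> ac 0 1 f \<and>
     (\<exists>N. negligible N \<and> (\<forall>x\<in>{0<..<1} - N. (f has_real_derivative f' x) (at x)))"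

lemma has_ae_derivativeI:
  assumes "ac 0 1 f" "negligible N" "\<And>x. x \<in> {0<..<1} \<Longrightarrow> x \<notin> N \<Longrightarrow> (f has_real_derivative f' x) (at x)"
  shows "has_ae_derivative f f'"
  unfolding has_ae_derivative_def by (intro conjI exI[of _ N] assms ballI) (use assms in auto)

lemma has_ae_derivative_ac: "has_ae_derivative f f' \<Longrightarrow> ac 0 1 f"
  by (simp add: has_ae_derivative_def)

lemma has_ae_derivative_continuous: "has_ae_derivative f f' \<Longrightarrow> continuous_on {0..1} f"
  by (simp add: has_ae_derivative_def ac_continuous)

lemma has_ae_derivative_integral:
  assumes f: "has_ae_derivative f f'" and x: "0 \<le> x" "x \<le> 1"
  shows "(f' has_integral f x - f 0) {0..x}"
proof -
  obtain N where N: "negligible N" "\<And>x. x \<in> {0<..<1} - N \<Longrightarrow> (f has_real_derivative f' x) (at x)"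
    using f unfolding has_ae_derivative_def by blast
  show ?thesis
  proof (rule ac_has_integral)
    show "ac 0 x f" using ac_subinterval[OF has_ae_derivative_ac[OF f]] x by simp
    show "negligible (N \<union> {0, 1})" using N(1) by (simp add: negligible_Un)
    show "(f has_real_derivative f' t) (at t within {0..x})" if "t \<in> {0..x} - (N \<union> {0, 1})" for t
      by (rule has_field_derivative_at_within, rule N(2)) (use that x in auto)
  qed (use x in simp)
qed

lemma has_ae_derivative_mult:
  assumes "has_ae_derivative f f'" "has_ae_derivative g g'"
  shows "has_ae_derivative (\<lambda>x. f x * g x) (\<lambda>x. f' x * g x + f x * g' x)"
proof -
  obtain N M where N: "negligible N" "\<And>x. x \<in> {0<..<1} - N \<Longrightarrow> (f has_real_derivative f' x) (at x)"
    and M: "negligible M" "\<And>x. x \<in> {0<..<1} - M \<Longrightarrow> (g has_real_derivative g' x) (at x)"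
    using assms unfolding has_ae_derivative_def by blast
  show ?thesis
  proof (rule has_ae_derivativeI[OF ac_mult negligible_Un[OF N(1) M(1)]])
    fix x :: real assume "x \<in> {0<..<1}" "x \<notin> N \<union> M"
    then show "((\<lambda>x. f x * g x) has_real_derivative f' x * g x + f x * g' x) (at x)"
      using DERIV_mult[OF N(2) M(2), of x] by (simp add: algebra_simps)
  qed (use assms has_ae_derivative_ac in auto)
qed

lemma has_ae_derivative_diff:
  assumes "has_ae_derivative f f'" "has_ae_derivative g g'"
  shows "has_ae_derivative (\<lambda>x. f x - g x) (\<lambda>x. f' x - g' x)"
proof -
  obtain N M where N: "negligible N" "\<And>x. x \<in> {0<..<1} - N \<Longrightarrow> (f has_real_derivative f' x) (at x)"
    and M: "negligible M" "\<And>x. x \<in> {0<..<1} - M \<Longrightarrow> (g has_real_derivative g' x) (at x)"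
    using assms unfolding has_ae_derivative_def by blast
  show ?thesis
  proof (rule has_ae_derivativeI[OF ac_diff negligible_Un[OF N(1) M(1)]])
    fix x :: real assume "x \<in> {0<..<1}" "x \<notin> N \<union> M"
    then show "((\<lambda>x. f x - g x) has_real_derivative f' x - g' x) (at x)"
      using DERIV_diff[OF N(2) M(2), of x] by (simp add: algebra_simps)
  qed (use assms has_ae_derivative_ac in auto)
qed

lemma has_ae_derivative_C1:
  assumes "\<And>x. x \<in> {0..1} \<Longrightarrow> (f has_real_derivative f' x) (at x within {0..1})"
    and "continuous_on {0..1} f'"
  shows "has_ae_derivative f f'"
proof (rule has_ae_derivativeI[OF ac_C1[OF assms] negligible_empty])
  fix x :: real assume "x \<in> {0<..<1}"
  then show "(f has_real_derivative f' x) (at x)"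
    using assms(1)[of x] at_within_interior[of x "{0..1}"] by simp
qed auto

lemma has_ae_derivative_cong:
  assumes "has_ae_derivative f f'" "\<And>x. x \<in> {0<..<1} \<Longrightarrow> f' x = g x"
  shows "has_ae_derivative f g"
proof -
  obtain N where "ac 0 1 f" "negligible N" "\<And>x. x \<in> {0<..<1} - N \<Longrightarrow> (f has_real_derivative f' x) (at x)"
    using assms(1) unfolding has_ae_derivative_def by blast
  then show ?thesis using assms(2) by (intro has_ae_derivativeI[of f N]) force+
qed

text \<open>On values at most \<open>B\<close> the exponential is Lipschitz with constant
  \<open>exp B\<close>, by \<open>1 + x \<le> exp x\<close>, so absolute continuity
  survives.\<close>

lemma has_ae_derivative_exp:
  assumes f: "has_ae_derivative f f'"
  shows "has_ae_derivative (\<lambda>x. exp (f x)) (\<lambda>x. exp (f x) * f' x)"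
proof -
  obtain N where N: "negligible N" "\<And>x. x \<in> {0<..<1} - N \<Longrightarrow> (f has_real_derivative f' x) (at x)"
    using assms unfolding has_ae_derivative_def by blast
  obtain B where B: "\<And>x. x \<in> {0..1} \<Longrightarrow> \<bar>f x\<bar> \<le> B"
    using continuous_on_interval_bounded[OF has_ae_derivative_continuous[OF f]] by blast
  show ?thesis
  proof (rule has_ae_derivativeI[OF _ N(1)])
    show "ac 0 1 (\<lambda>x. exp (f x))"
    proof (rule ac_dominated[OF has_ae_derivative_ac[OF f] ac_id, of "exp B" 0])
      fix s t :: real assume st: "0 \<le> s" "s \<le> t" "t \<le> 1"
      have exp_le: "exp v - exp u \<le> exp B * \<bar>v - u\<bar>" if "v \<le> B" for u v :: real
      proof -
        have "exp v * (1 - exp (u - v)) \<le> exp v * (v - u)"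
        proof (rule mult_left_mono)
          show "1 - exp (u - v) \<le> v - u" using exp_ge_add_one_self[of "u - v"] by linarith
        qed simp
        then have "exp v - exp u \<le> exp v * (v - u)" by (simp add: right_diff_distrib flip: exp_add)
        also have "\<dots> \<le> exp v * \<bar>v - u\<bar>" by (rule mult_left_mono) auto
        also have "\<dots> \<le> exp B * \<bar>v - u\<bar>" using that by (intro mult_right_mono) auto
        finally show ?thesis .
      qed
      have "f s \<le> B" "f t \<le> B" using B[of s] B[of t] st by auto
      from exp_le[OF this(1), of "f t"] exp_le[OF this(2), of "f s"]
      have "\<bar>exp (f t) - exp (f s)\<bar> \<le> exp B * \<bar>f t - f s\<bar>"
        unfolding abs_minus_commute[of "f s"] by linarith
      then show "\<bar>exp (f t) - exp (f s)\<bar> \<le> exp B * \<bar>f t - f s\<bar> + 0 * \<bar>t - s\<bar>" by simp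
    qed auto
    fix x :: real assume "x \<in> {0<..<1}" "x \<notin> N"
    then show "((\<lambda>x. exp (f x)) has_real_derivative exp (f x) * f' x) (at x)"
      using DERIV_chain2[OF DERIV_exp N(2)] by blast
  qed
qed

lemma has_ae_derivative_integral_fun:
  fixes g :: "real \<Rightarrow> real"
  assumes g: "g absolutely_integrable_on {0..1}"
  shows "has_ae_derivative (\<lambda>x. integral {0..x} g) g"
proof -
  define g0 where "g0 = (\<lambda>x. if x \<in> {0..1} then g x else 0)"
  have "g0 integrable_on UNIV"
    using g unfolding g0_def integrable_restrict_UNIV absolutely_integrable_on_def by blast
  then have "g0 integrable_on {a..b}" for a b
    by (rule integrable_on_subinterval) simp
  then obtain N where N: "negligible N"
    "\<And>a x. x \<notin> N \<Longrightarrow> a < x \<Longrightarrow> ((\<lambda>u. integral {a..u} g0) has_real_derivative g0 x) (at x)"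
    using lebesgue_differentiation by metis
  show ?thesis
  proof (rule has_ae_derivativeI[OF ac_indefinite_integral[OF g] N(1)])
    fix x :: real assume x: "x \<in> {0<..<1}" "x \<notin> N"
    have "((\<lambda>u. integral {0..u} g0) has_real_derivative g x) (at x)"
      using N(2)[of x 0] x by (simp add: g0_def)
    then show "((\<lambda>u. integral {0..u} g) has_real_derivative g x) (at x)"
    proof (rule has_field_derivative_transform_within_open)
      show "integral {0..u} g0 = integral {0..u} g" if "u \<in> {0<..<1}" for u
        using that by (intro integral_cong) (auto simp: g0_def)
    qed (use x in auto)
  qed
qed

lemma absolutely_integrable_mult_continuous:
  fixes p y :: "real \<Rightarrow> real"
  assumes "p absolutely_integrable_on {a..b}" "continuous_on {a..b} y"
  shows "(\<lambda>x. p x * y x) absolutely_integrable_on {a..b}"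
proof -
  have "(\<lambda>x. y x * p x) absolutely_integrable_on {a..b}"
  proof (rule absolutely_integrable_bounded_measurable_product_real)
    show "y \<in> borel_measurable (lebesgue_on {a..b})"
      using assms(2) by (intro continuous_imp_measurable_on_sets_lebesgue) auto
    show "bounded (y ` {a..b})"
      using assms(2) by (intro compact_imp_bounded compact_continuous_image) auto
  qed (use assms in auto)
  then show ?thesis by (simp add: mult.commute)
qed

text \<open>The equation fixes the existentially quantified \<open>ddy\<close> as
  \<open>(q x - lam) * y x\<close>. In this first-order form the solution theory reduces to the
  calculus of \<open>has_ae_derivative\<close>; absolute continuity of \<open>y\<close> follows from
  the continuity of \<open>dy\<close>.\<close>

lemma sl_solution_iff:
  "sl_solution q lam y dy \<longleftrightarrow>
     (\<forall>x\<in>{0..1}. (y has_real_derivative dy x) (at x within {0..1})) \<and>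
     has_ae_derivative dy (\<lambda>x. (q x - lam) * y x)" (is "?L \<longleftrightarrow> ?R")
proof
  assume L: ?L
  then have "negligible {x\<in>{0<..<1}. \<not> (\<exists>ddy. (dy has_real_derivative ddy) (at x) \<and> - ddy + q x * y x = lam * y x)}"
    (is "negligible ?N")
    unfolding sl_solution_def AE_on_iff_negligible by blast
  moreover have "(dy has_real_derivative (q x - lam) * y x) (at x)" if x: "x \<in> {0<..<1}" "x \<notin> ?N" for x
  proof -
    obtain d where "(dy has_real_derivative d) (at x)" "- d + q x * y x = lam * y x" using x by blast
    moreover from this have "d = (q x - lam) * y x" by (simp add: algebra_simps)
    ultimately show ?thesis by simp
  qed
  ultimately have "has_ae_derivative dy (\<lambda>x. (q x - lam) * y x)"
    using L by (intro has_ae_derivativeI[of dy ?N]) (auto simp: sl_solution_def)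
  then show ?R using L by (simp add: sl_solution_def)
next
  assume R: ?R
  then obtain N where N: "negligible N" "\<And>x. x \<in> {0<..<1} - N \<Longrightarrow> (dy has_real_derivative (q x - lam) * y x) (at x)"
    unfolding has_ae_derivative_def by blast
  have "{x\<in>{0<..<1}. \<not> (\<exists>ddy. (dy has_real_derivative ddy) (at x) \<and> - ddy + q x * y x = lam * y x)} \<subseteq> N"
  proof
    fix x :: real
    assume x: "x \<in> {x\<in>{0<..<1}. \<not> (\<exists>ddy. (dy has_real_derivative ddy) (at x) \<and> - ddy + q x * y x = lam * y x)}"
    have "- ((q x - lam) * y x) + q x * y x = lam * y x" by (simp add: algebra_simps)
    then show "x \<in> N" using x N(2)[of x] by blast
  qed
  then have "AE x\<in>{0<..<1} in lebesgue. \<exists>ddy. (dy has_real_derivative ddy) (at x) \<and> - ddy + q x * y x = lam * y x"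
    unfolding AE_on_iff_negligible using N(1) negligible_subset by blast
  moreover have "ac 0 1 y"
    using R by (intro ac_C1[where f' = dy] has_ae_derivative_continuous) auto
  moreover have "ac 0 1 dy" using R has_ae_derivative_ac by blast
  ultimately show ?L using R unfolding sl_solution_def by blast
qed

lemma sl_solution_deriv:
  "sl_solution q lam y dy \<Longrightarrow> x \<in> {0..1} \<Longrightarrow> (y has_real_derivative dy x) (at x within {0..1})"
  by (simp add: sl_solution_def)

lemma sl_solution_has_ae_derivative:
  assumes "sl_solution q lam y dy"
  shows "has_ae_derivative y dy" "has_ae_derivative dy (\<lambda>x. (q x - lam) * y x)"
proof -
  show *: "has_ae_derivative dy (\<lambda>x. (q x - lam) * y x)" using assms sl_solution_iff by blast
  show "has_ae_derivative y dy"
    using assms has_ae_derivative_continuous[OF *]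
    by (intro has_ae_derivative_C1) (auto simp: sl_solution_def)
qed

lemma sl_solution_continuous:
  assumes "sl_solution q lam y dy"
  shows "continuous_on {0..1} y" "continuous_on {0..1} dy"
  by (rule has_ae_derivative_continuous, rule sl_solution_has_ae_derivative[OF assms])+

lemma sl_solution_lincomb:
  assumes "sl_solution q lam y dy" "sl_solution q lam w dw"
  shows "sl_solution q lam (\<lambda>x. a * y x + b * w x) (\<lambda>x. a * dy x + b * dw x)"
proof -
  note A = sl_solution_has_ae_derivative[OF assms(1)] and B = sl_solution_has_ae_derivative[OF assms(2)]
  obtain N M where N: "negligible N" "\<And>x. x \<in> {0<..<1} - N \<Longrightarrow> (dy has_real_derivative (q x - lam) * y x) (at x)"
    and M: "negligible M" "\<And>x. x \<in> {0<..<1} - M \<Longrightarrow> (dw has_real_derivative (q x - lam) * w x) (at x)"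
    using A(2) B(2) unfolding has_ae_derivative_def by blast
  have "has_ae_derivative (\<lambda>x. a * dy x + b * dw x) (\<lambda>x. (q x - lam) * (a * y x + b * w x))"
  proof (rule has_ae_derivativeI[OF ac_add negligible_Un[OF N(1) M(1)]])
    show "ac 0 1 (\<lambda>x. a * dy x)" "ac 0 1 (\<lambda>x. b * dw x)"
      using A(2) B(2) by (simp_all add: ac_mult ac_const has_ae_derivative_ac)
    fix x :: real assume "x \<in> {0<..<1}" "x \<notin> N \<union> M"
    then have "((\<lambda>x. a * dy x + b * dw x) has_real_derivative a * ((q x - lam) * y x) + b * ((q x - lam) * w x)) (at x)"
      by (intro DERIV_add DERIV_cmult N(2) M(2)) auto
    then show "((\<lambda>x. a * dy x + b * dw x) has_real_derivative (q x - lam) * (a * y x + b * w x)) (at x)"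
      by (simp add: algebra_simps)
  qed
  then show ?thesis
    unfolding sl_solution_iff
    using assms by (auto intro!: DERIV_add DERIV_cmult simp: sl_solution_def)
qed

text \<open>Taking \<open>p = 0\<close>, the second factor may be any trigonometric or affine test function.\<close>

lemma sl_green:
  assumes y: "sl_solution q lam y dy" and w: "sl_solution p mu w dw" and x: "0 \<le> x" "x \<le> 1"
  shows "((\<lambda>t. (q t - lam - (p t - mu)) * (y t * w t)) has_integral
    (dy x * w x - y x * dw x) - (dy 0 * w 0 - y 0 * dw 0)) {0..x}"
proof -
  note A = sl_solution_has_ae_derivative[OF y] and B = sl_solution_has_ae_derivative[OF w]
  have "has_ae_derivative (\<lambda>t. dy t * w t - y t * dw t)
      (\<lambda>t. ((q t - lam) * y t * w t + dy t * dw t) - (dy t * dw t + y t * ((p t - mu) * w t)))"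
    by (intro has_ae_derivative_diff has_ae_derivative_mult A B)
  then have "has_ae_derivative (\<lambda>t. dy t * w t - y t * dw t)
      (\<lambda>t. (q t - lam - (p t - mu)) * (y t * w t))"
    by (rule has_ae_derivative_cong) (simp add: algebra_simps)
  from has_ae_derivative_integral[OF this x] show ?thesis .
qed

lemma sl_solution_smooth:
  assumes "\<And>x. (w has_real_derivative dw x) (at x)" "\<And>x. (dw has_real_derivative - mu * w x) (at x)"
  shows "sl_solution (\<lambda>x. 0) mu w dw"
proof -
  have "continuous_on {0..1} (\<lambda>x. - mu * w x)"
    using assms(1) by (intro continuous_intros DERIV_continuous_on) (auto intro: has_field_derivative_at_within)
  then have "has_ae_derivative dw (\<lambda>x. - mu * w x)"
    using assms(2) by (intro has_ae_derivative_C1) (auto intro: has_field_derivative_at_within)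
  then show ?thesis
    unfolding sl_solution_iff using assms(1) by (auto intro: has_field_derivative_at_within)
qed


section \<open>Initial value problems with integrable potential\<close>

lemma absolutely_integrable_subinterval:
  fixes p :: "real \<Rightarrow> real"
  assumes "p absolutely_integrable_on {0..1}" "0 \<le> x" "x \<le> 1"
  shows "p absolutely_integrable_on {0..x}"
  using assms by (intro set_integrable_subset[OF assms(1)]) auto

lemma continuous_on_indefinite_integral:
  fixes p :: "real \<Rightarrow> real"
  assumes "p absolutely_integrable_on {0..1}"
  shows "continuous_on {0..1} (\<lambda>x. integral {0..x} p)"
  using assms by (intro indefinite_integral_continuous_1) (simp add: absolutely_integrable_on_def)

text \<open>A Bielecki weight. Because of the factor 2, integrating \<open>\<bar>p\<bar>\<close>
  times the weight returns less than half of the weight, which yields both the contraction and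
  Gronwall's inequality without iterated integrals.\<close>

definition gronwall_weight :: "(real \<Rightarrow> real) \<Rightarrow> real \<Rightarrow> real" where
  "gronwall_weight p x = exp (2 * integral {0..x} (\<lambda>t. \<bar>p t\<bar>))"

context
  fixes p :: "real \<Rightarrow> real"
  assumes p: "p absolutely_integrable_on {0..1}"
begin

lemma abs_weight_integrable: "(\<lambda>t. \<bar>p t\<bar>) absolutely_integrable_on {0..1}"
  using absolutely_integrable_abs[OF p] by simp

lemma weight_mult_integrable:
  assumes "continuous_on {0..1} f" "0 \<le> x" "x \<le> 1"
  shows "(\<lambda>t. p t * f t) absolutely_integrable_on {0..x}"
    "(\<lambda>t. \<bar>p t\<bar> * f t) absolutely_integrable_on {0..x}"
  using absolutely_integrable_subinterval[OF absolutely_integrable_mult_continuous[OF p assms(1)] assms(2,3)]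
    absolutely_integrable_subinterval[OF absolutely_integrable_mult_continuous[OF abs_weight_integrable assms(1)] assms(2,3)]
  by auto

lemma gronwall_weight_ae: 
  "has_ae_derivative (gronwall_weight p) (\<lambda>x. gronwall_weight p x * (2 * \<bar>p x\<bar>))"
proof -
  have "has_ae_derivative (\<lambda>x. 2 * integral {0..x} (\<lambda>t. \<bar>p t\<bar>)) (\<lambda>x. 0 * integral {0..x} (\<lambda>t. \<bar>p t\<bar>) + 2 * \<bar>p x\<bar>)"
    by (intro has_ae_derivative_mult has_ae_derivative_integral_fun abs_weight_integrable has_ae_derivative_C1)
      (auto intro!: derivative_eq_intros)
  from has_ae_derivative_exp[OF this] show ?thesis
    by (simp add: gronwall_weight_def[abs_def])
qed

lemma gronwall_weight_continuous: "continuous_on {0..1} (gronwall_weight p)"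
  by (rule has_ae_derivative_continuous[OF gronwall_weight_ae])

lemma gronwall_weight_integral:
  assumes "0 \<le> x" "x \<le> 1"
  shows "((\<lambda>t. \<bar>p t\<bar> * gronwall_weight p t) has_integral (gronwall_weight p x - 1) / 2) {0..x}"
proof -
  have "((\<lambda>t. gronwall_weight p t * (2 * \<bar>p t\<bar>)) has_integral gronwall_weight p x - 1) {0..x}"
    using has_ae_derivative_integral[OF gronwall_weight_ae assms] by (simp add: gronwall_weight_def)
  from has_integral_mult_right[OF this, of "1 / 2"] show ?thesis by (simp add: mult.commute)
qed

lemma gronwall_weight_mono:
  assumes "0 \<le> s" "s \<le> t" "t \<le> 1"
  shows "gronwall_weight p s \<le> gronwall_weight p t"
proof -
  have "integral {0..s} (\<lambda>t. \<bar>p t\<bar>) \<le> integral {0..t} (\<lambda>t. \<bar>p t\<bar>)"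
    using absolutely_integrable_subinterval[OF abs_weight_integrable] assms
    by (intro integral_subset_le) (auto simp: absolutely_integrable_on_def)
  then show ?thesis by (simp add: gronwall_weight_def)
qed

lemma gronwall_weight_ge_1:
  assumes "0 \<le> x" "x \<le> 1"
  shows "1 \<le> gronwall_weight p x"
  using gronwall_weight_mono[of 0 x] assms by (simp add: gronwall_weight_def)

lemma weighted_integral_bound:
  assumes f: "continuous_on {0..1} f" and g: "continuous_on {0..1} g" and x: "0 \<le> x" "x \<le> 1"
    and le: "\<And>t. 0 \<le> t \<Longrightarrow> t \<le> x \<Longrightarrow> \<bar>f t\<bar> \<le> g t"
  shows "\<bar>integral {0..x} (\<lambda>t. p t * f t)\<bar> \<le> integral {0..x} (\<lambda>t. \<bar>p t\<bar> * g t)"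
proof -
  have "norm (integral {0..x} (\<lambda>t. p t * f t)) \<le> integral {0..x} (\<lambda>t. \<bar>p t\<bar> * g t)"
    using weight_mult_integrable[OF f x] weight_mult_integrable[OF g x] le
    by (intro integral_norm_bound_integral)
      (auto simp: absolutely_integrable_on_def abs_mult intro!: mult_left_mono)
  then show ?thesis by simp
qed

text \<open>At a maximum point \<open>x0\<close> of \<open>\<bar>y\<bar> / W\<close>, with value
  \<open>n\<close>, the hypothesis becomes \<open>n * W x0 \<le> A + n * (W x0 - 1) / 2\<close>. As
  the weight is at least 1, this bounds \<open>n\<close>.\<close>

lemma gronwall:
  assumes y: "continuous_on {0..1} y" and A: "0 \<le> A"
    and le: "\<And>x. 0 \<le> x \<Longrightarrow> x \<le> 1 \<Longrightarrow> \<bar>y x\<bar> \<le> A + integral {0..x} (\<lambda>t. \<bar>p t\<bar> * \<bar>y t\<bar>)"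
    and x: "0 \<le> x" "x \<le> 1"
  shows "\<bar>y x\<bar> \<le> 2 * A * gronwall_weight p x"
proof -
  let ?W = "gronwall_weight p"
  let ?r = "\<lambda>t. \<bar>y t\<bar> / ?W t"
  have W0: "0 < ?W t" for t by (simp add: gronwall_weight_def)
  have "continuous_on {0..1} ?r"
    using W0 by (intro continuous_intros y gronwall_weight_continuous) (metis less_irrefl)
  then obtain x0 where x0: "x0 \<in> {0..1}" "\<And>t. t \<in> {0..1} \<Longrightarrow> ?r t \<le> ?r x0"
    using continuous_attains_sup[of "{0..1::real}" ?r] by auto
  define n where "n = ?r x0"
  have n0: "0 \<le> n" using W0[of x0] by (simp add: n_def)
  have yn: "\<bar>y t\<bar> \<le> n * ?W t" if "t \<in> {0..1}" for t
    using x0(2)[OF that] W0[of t] by (simp add: n_def pos_divide_le_eq)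
  have hi: "((\<lambda>t. \<bar>p t\<bar> * ?W t) has_integral (?W x0 - 1) / 2) {0..x0}"
    using x0(1) by (intro gronwall_weight_integral) auto
  have "n * ?W x0 = \<bar>y x0\<bar>" using W0[of x0] by (simp add: n_def)
  also have "\<dots> \<le> A + integral {0..x0} (\<lambda>t. \<bar>p t\<bar> * \<bar>y t\<bar>)" using le x0(1) by simp
  also have "integral {0..x0} (\<lambda>t. \<bar>p t\<bar> * \<bar>y t\<bar>) \<le> integral {0..x0} (\<lambda>t. n * (\<bar>p t\<bar> * ?W t))"
  proof (rule integral_le)
    show "(\<lambda>t. \<bar>p t\<bar> * \<bar>y t\<bar>) integrable_on {0..x0}"
      using weight_mult_integrable(2)[of "\<lambda>t. \<bar>y t\<bar>" x0] x0(1) y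
      by (auto intro: continuous_intros simp: absolutely_integrable_on_def)
    show "(\<lambda>t. n * (\<bar>p t\<bar> * ?W t)) integrable_on {0..x0}"
      using hi by (intro integrable_on_mult_right) (rule has_integral_integrable)
    show "\<bar>p t\<bar> * \<bar>y t\<bar> \<le> n * (\<bar>p t\<bar> * ?W t)" if "t \<in> {0..x0}" for t
      using mult_left_mono[OF yn[of t], of "\<bar>p t\<bar>"] that x0(1) by (simp add: mult.left_commute)
  qed
  also have "integral {0..x0} (\<lambda>t. n * (\<bar>p t\<bar> * ?W t)) = n * ((?W x0 - 1) / 2)"
    using integral_unique[OF has_integral_mult_right[OF hi, of n]] by simp
  finally have "n * ?W x0 / 2 + n / 2 \<le> A" by (simp add: field_simps)
  moreover have "n * 1 \<le> n * ?W x0"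
    using gronwall_weight_ge_1[of x0] x0(1) n0 by (intro mult_left_mono) auto
  ultimately have "n \<le> 2 * A" using A n0 by linarith
  then have "n * ?W x \<le> 2 * A * ?W x" using W0[of x] by simp
  then show ?thesis using yn[of x] x by simp
qed

text \<open>The solution \<open>u\<close> of \<open>u'' = p f\<close> with
  \<open>u(0) = u'(0) = 0\<close>; an initial value problem is a fixed point equation for
  it.\<close>

definition picard :: "(real \<Rightarrow> real) \<Rightarrow> real \<Rightarrow> real" where
  "picard f x = integral {0..x} (\<lambda>s. integral {0..s} (\<lambda>t. p t * f t))"

lemma continuous_weighted_integral:
  assumes "continuous_on {0..1} f"
  shows "continuous_on {0..1} (\<lambda>s. integral {0..s} (\<lambda>t. p t * f t))"
  by (rule continuous_on_indefinite_integral[OF absolutely_integrable_mult_continuous[OF p assms]])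

lemma integrable_weighted_integral:
  assumes "continuous_on {0..1} f" "0 \<le> x" "x \<le> 1"
  shows "(\<lambda>s. integral {0..s} (\<lambda>t. p t * f t)) integrable_on {0..x}"
  using continuous_weighted_integral[OF assms(1)] assms(2,3)
  by (intro integrable_continuous_interval) (auto elim: continuous_on_subset)

lemma continuous_picard:
  assumes "continuous_on {0..1} f"
  shows "continuous_on {0..1} (picard f)"
  unfolding picard_def[abs_def]
  using integrable_weighted_integral[OF assms, of 1] by (intro indefinite_integral_continuous_1) simp

lemma picard_deriv:
  assumes "continuous_on {0..1} f" "x \<in> {0..1}"
  shows "(picard f has_real_derivative integral {0..x} (\<lambda>t. p t * f t)) (at x within {0..1})"
  unfolding picard_def[abs_def] by (rule integral_has_real_derivative[OF continuous_weighted_integral[OF assms(1)] assms(2)])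

text \<open>The inner integral already gains the factor 1/2 by
  \<open>gronwall_weight_integral\<close>. The outer one, over an interval of length at most 1,
  loses nothing because the weight is increasing.\<close>

lemma picard_weighted_bound:
  assumes f: "continuous_on {0..1} f" and K: "0 \<le> K"
    and le: "\<And>t. t \<in> {0..1} \<Longrightarrow> \<bar>f t\<bar> \<le> K * gronwall_weight p t" and x: "0 \<le> x" "x \<le> 1"
  shows "\<bar>picard f x\<bar> \<le> K / 2 * gronwall_weight p x"
proof -
  let ?W = "gronwall_weight p"
  have inner: "\<bar>integral {0..s} (\<lambda>t. p t * f t)\<bar> \<le> K / 2 * ?W x" if s: "0 \<le> s" "s \<le> x" for s
  proof -
    have "\<bar>integral {0..s} (\<lambda>t. p t * f t)\<bar> \<le> integral {0..s} (\<lambda>t. \<bar>p t\<bar> * (K * ?W t))"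
      using s x le by (intro weighted_integral_bound f continuous_intros gronwall_weight_continuous) auto
    also have "\<dots> = K * ((?W s - 1) / 2)"
      using integral_unique[OF has_integral_mult_right[OF gronwall_weight_integral[of s], of K]] s x
      by (simp add: mult.left_commute)
    also have "\<dots> \<le> K * (?W x / 2)"
      using gronwall_weight_mono[of s x] s x K by (intro mult_left_mono) auto
    finally show ?thesis by simp
  qed
  have "norm (picard f x) \<le> integral {0..x} (\<lambda>s. K / 2 * ?W x)"
    unfolding picard_def
    using inner integrable_weighted_integral[OF f x] by (intro integral_norm_bound_integral) auto
  also have "\<dots> = x * (K / 2 * ?W x)" using x by simp
  also have "\<dots> \<le> 1 * (K / 2 * ?W x)"
    using x K gronwall_weight_ge_1[of x] by (intro mult_right_mono) auto
  finally show ?thesis by simp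
qed

lemma picard_diff:
  assumes f: "continuous_on {0..1} f" and g: "continuous_on {0..1} g" and x: "0 \<le> x" "x \<le> 1"
  shows "picard f x - picard g x = picard (\<lambda>t. f t - g t) x"
proof -
  have "picard f x - picard g x = integral {0..x} (\<lambda>s. integral {0..s} (\<lambda>t. p t * f t) - integral {0..s} (\<lambda>t. p t * g t))"
    unfolding picard_def by (rule integral_diff[symmetric]) (intro integrable_weighted_integral f g x)+
  also have "\<dots> = picard (\<lambda>t. f t - g t) x"
    unfolding picard_def
  proof (rule integral_cong)
    fix s assume "s \<in> {0..x}"
    then have s: "0 \<le> s" "s \<le> 1" using x by auto
    have "integral {0..s} (\<lambda>t. p t * f t) - integral {0..s} (\<lambda>t. p t * g t) = integral {0..s} (\<lambda>t. p t * f t - p t * g t)"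
      using weight_mult_integrable(1)[OF f s] weight_mult_integrable(1)[OF g s]
      by (intro integral_diff[symmetric]) (auto simp: absolutely_integrable_on_def)
    then show "integral {0..s} (\<lambda>t. p t * f t) - integral {0..s} (\<lambda>t. p t * g t) = integral {0..s} (\<lambda>t. p t * (f t - g t))"
      by (simp add: right_diff_distrib)
  qed
  finally show ?thesis .
qed

text \<open>In the norm weighted by \<^const>\<open>gronwall_weight\<close> the Picard operator is a contraction by \<open>1/2\<close>.\<close>

lemma picard_fixed_point:
  assumes g: "continuous_on {0..1} g"
  obtains y where "continuous_on {0..1} y" "\<And>x. x \<in> {0..1} \<Longrightarrow> y x = g x + picard y x"
proof -
  let ?W = "gronwall_weight p"
  define Y where "Y = rec_nat g (\<lambda>_ f x. g x + picard f x)"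
  have Y0: "Y 0 = g" and YS: "Y (Suc n) = (\<lambda>x. g x + picard (Y n) x)" for n
    by (simp_all add: Y_def)
  have cont: "continuous_on {0..1} (Y n)" for n
    by (induction n) (auto simp: Y0 YS g intro!: continuous_intros continuous_picard)
  obtain C where C: "\<And>x. x \<in> {0..1} \<Longrightarrow> \<bar>picard g x\<bar> \<le> C"
    using continuous_on_interval_bounded[OF continuous_picard[OF g]] by blast
  have C0: "0 \<le> C" using C[of 0] by simp
  have step: "\<bar>Y (Suc n) x - Y n x\<bar> \<le> C / 2 ^ n * ?W x" if "x \<in> {0..1}" for n x
    using that
  proof (induction n arbitrary: x)
    case 0
    have "C * 1 \<le> C * ?W x" using gronwall_weight_ge_1[of x] 0 C0 by (intro mult_left_mono) auto
    then show ?case using C[OF 0] by (simp add: YS Y0)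
  next
    case (Suc n)
    have "Y (Suc (Suc n)) x - Y (Suc n) x = picard (\<lambda>t. Y (Suc n) t - Y n t) x"
      using picard_diff[OF cont[of "Suc n"] cont[of n], of x] Suc.prems by (simp add: YS)
    moreover have "\<bar>picard (\<lambda>t. Y (Suc n) t - Y n t) x\<bar> \<le> (C / 2 ^ n) / 2 * ?W x"
      using Suc C0 by (intro picard_weighted_bound continuous_on_diff cont) auto
    ultimately show ?case by (simp add: field_simps)
  qed
  define u where "u = (\<lambda>n x. Y (Suc n) x - Y n x)"
  have sumu: "(\<Sum>i<n. u i x) = Y n x - g x" for n x
    by (induction n) (auto simp: u_def Y0)
  have "uniform_limit {0..1} (\<lambda>n x. \<Sum>i<n. u i x) (\<lambda>x. suminf (\<lambda>i. u i x)) sequentially"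
  proof (rule Weierstrass_m_test)
    fix n x assume x: "x \<in> {0..1::real}"
    have "norm (u n x) \<le> C / 2 ^ n * ?W x" using step[OF x] by (simp add: u_def)
    also have "\<dots> \<le> C / 2 ^ n * ?W 1"
      using gronwall_weight_mono[of x 1] x C0 by (intro mult_left_mono) auto
    finally show "norm (u n x) \<le> C * ?W 1 * (1 / 2) ^ n" by (simp add: field_simps power_divide)
  next
    show "summable (\<lambda>n. C * ?W 1 * (1 / 2) ^ n)"
      by (intro summable_mult summable_geometric) auto
  qed
  then have ul: "uniform_limit {0..1} (\<lambda>n x. Y n x - g x) (\<lambda>x. suminf (\<lambda>i. u i x)) sequentially"
    by (simp add: sumu)
  define y where "y = (\<lambda>x. g x + suminf (\<lambda>i. u i x))"
  have ul': "uniform_limit {0..1} Y y sequentially"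
    using uniform_limit_add[OF _ ul, of "\<lambda>n. g" g] uniform_limit_const by (force simp: y_def)
  have y: "continuous_on {0..1} y"
    by (rule uniform_limit_theorem[OF _ ul']) (auto simp: cont)
  have "y x = g x + picard y x" if x: "x \<in> {0..1}" for x
  proof -
    have "(\<lambda>n. picard (Y n) x) \<longlonglongrightarrow> picard y x"
    proof (rule LIMSEQ_I)
      fix e :: real assume e: "0 < e"
      define e' where "e' = e / ?W 1"
      have e': "0 < e'" using e gronwall_weight_ge_1[of 1] by (simp add: e'_def)
      have "\<forall>\<^sub>F n in sequentially. \<forall>t\<in>{0..1}. dist (Y n t) (y t) < e'"
        using ul' e' unfolding uniform_limit_iff by blast
      then obtain N where N: "\<And>n t. n \<ge> N \<Longrightarrow> t \<in> {0..1} \<Longrightarrow> dist (Y n t) (y t) < e'"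
        unfolding eventually_sequentially by blast
      have "norm (picard (Y n) x - picard y x) < e" if n: "n \<ge> N" for n
      proof -
        have "\<bar>Y n t - y t\<bar> \<le> e' * ?W t" if t: "t \<in> {0..1}" for t
        proof -
          have "e' * 1 \<le> e' * ?W t" using gronwall_weight_ge_1[of t] t e' by (intro mult_left_mono) auto
          then show ?thesis using N[OF n t] by (simp add: dist_real_def)
        qed
        then have "\<bar>picard (\<lambda>t. Y n t - y t) x\<bar> \<le> e' / 2 * ?W x"
          using x e' by (intro picard_weighted_bound continuous_on_diff cont y) auto
        also have "\<dots> \<le> e' / 2 * ?W 1"
          using gronwall_weight_mono[of x 1] x e' by (intro mult_left_mono) auto
        also have "\<dots> < e" using e gronwall_weight_ge_1[of 1] by (simp add: e'_def)
        finally show ?thesis using picard_diff[OF cont[of n] y, of x] x by simp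
      qed
      then show "\<exists>no. \<forall>n\<ge>no. norm (picard (Y n) x - picard y x) < e" by blast
    qed
    then have "(\<lambda>n. g x + picard (Y n) x) \<longlonglongrightarrow> g x + picard y x" by (intro tendsto_intros)
    then have "(\<lambda>n. Y (Suc n) x) \<longlonglongrightarrow> g x + picard y x" by (simp add: YS)
    moreover have "(\<lambda>n. Y (Suc n) x) \<longlonglongrightarrow> y x"
      using tendsto_uniform_limitI[OF ul' x] by (rule LIMSEQ_Suc)
    ultimately show ?thesis using LIMSEQ_unique by blast
  qed
  with y show thesis by (rule that)
qed

end

theorem sl_solution_exists:
  assumes q: "q absolutely_integrable_on {0..1}"
  obtains y dy where "sl_solution q lam y dy" "y 0 = \<alpha>" "dy 0 = \<beta>"
proof -
  define p where "p = (\<lambda>t. q t - lam)"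
  have p: "p absolutely_integrable_on {0..1}"
    unfolding p_def using q by (intro set_integral_diff absolutely_integrable_on_const) auto
  obtain y where y: "continuous_on {0..1} y" "\<And>x. x \<in> {0..1} \<Longrightarrow> y x = (\<alpha> + \<beta> * x) + picard p y x"
  proof -
    have "continuous_on {0..1} (\<lambda>x. \<alpha> + \<beta> * x)" by (intro continuous_intros)
    from picard_fixed_point[OF p this] show thesis using that by blast
  qed
  \<comment> \<open>Written as a difference so that \<open>has_ae_derivative_diff\<close> applies,
    with the constant \<open>- \<beta>\<close> as second function.\<close>
  define dy where "dy = (\<lambda>x. integral {0..x} (\<lambda>t. p t * y t) - (- \<beta>))"
  have "sl_solution q lam y dy"
    unfolding sl_solution_iff
  proof (intro conjI ballI)
    fix x :: real assume x: "x \<in> {0..1}"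
    have "((\<lambda>x. (\<alpha> + \<beta> * x) + picard p y x) has_real_derivative dy x) (at x within {0..1})"
      unfolding dy_def by (auto intro!: derivative_eq_intros picard_deriv[OF p y(1) x])
    then show "(y has_real_derivative dy x) (at x within {0..1})"
      by (rule has_field_derivative_transform_within[OF _ zero_less_one x]) (simp add: y(2))
  next
    have "has_ae_derivative dy (\<lambda>x. p x * y x - 0)"
      unfolding dy_def
      by (intro has_ae_derivative_diff has_ae_derivative_integral_fun
          absolutely_integrable_mult_continuous p y has_ae_derivative_C1) auto
    then show "has_ae_derivative dy (\<lambda>x. (q x - lam) * y x)" by (simp add: p_def)
  qed
  moreover have "y 0 = \<alpha>" using y(2)[of 0] by (simp add: picard_def[OF p])
  moreover have "dy 0 = \<beta>" by (simp add: dy_def)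
  ultimately show thesis by (rule that)
qed

section \<open>A priori bounds and dependence on the spectral parameter\<close>

lemma absolutely_integrable_diff_const:
  fixes q :: "real \<Rightarrow> real"
  assumes "q absolutely_integrable_on {0..1}"
  shows "(\<lambda>t. q t - c) absolutely_integrable_on {0..1}"
  using assms by (intro set_integral_diff absolutely_integrable_on_const) auto

lemma sl_solution_integral:
  assumes "sl_solution q lam y dy" "0 \<le> x" "x \<le> 1"
  shows "((\<lambda>t. (q t - lam) * y t) has_integral dy x - dy 0) {0..x}"
  by (rule has_ae_derivative_integral[OF sl_solution_has_ae_derivative(2)[OF assms(1)] assms(2,3)])

text \<open>Green's identity against the affine function \<open>t \<mapsto> x - t\<close>. It
  vanishes at the end point \<open>x\<close>, so \<open>dy x\<close> drops out and an integral
  equation for \<open>y\<close> alone remains.\<close>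

lemma sl_solution_volterra:
  assumes "sl_solution q lam y dy" "0 \<le> x" "x \<le> 1"
  shows "((\<lambda>t. (q t - lam) * (y t * (x - t))) has_integral y x - y 0 - dy 0 * x) {0..x}"
proof -
  have "sl_solution (\<lambda>x. 0) 0 (\<lambda>t. x - t) (\<lambda>t. - 1)"
    by (intro sl_solution_smooth) (auto intro!: derivative_eq_intros)
  from sl_green[OF assms(1) this assms(2,3)] show ?thesis by (simp add: algebra_simps)
qed

lemma integrable_weighted:
  fixes p f :: "real \<Rightarrow> real"
  assumes "p absolutely_integrable_on {0..1}" "continuous_on {0..1} f" "0 \<le> x" "x \<le> 1"
  shows "(\<lambda>t. p t * f t) integrable_on {0..x}" "(\<lambda>t. \<bar>p t\<bar> * f t) integrable_on {0..x}"
  using weight_mult_integrable[OF assms] by (simp_all add: absolutely_integrable_on_def)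

lemma sl_solution_bound:
  assumes q: "q absolutely_integrable_on {0..1}" and y: "sl_solution q lam y dy" and x: "0 \<le> x" "x \<le> 1"
  shows "\<bar>y x\<bar> \<le> 2 * (\<bar>y 0\<bar> + \<bar>dy 0\<bar>) * gronwall_weight (\<lambda>t. q t - lam) x"
proof -
  note p = absolutely_integrable_diff_const[OF q, of lam]
  note c = sl_solution_continuous(1)[OF y]
  show ?thesis
  proof (rule gronwall[OF p c _ _ x])
    fix x :: real assume x: "0 \<le> x" "x \<le> 1"
    have "integral {0..x} (\<lambda>t. (q t - lam) * (y t * (x - t))) = y x - y 0 - dy 0 * x"
      using sl_solution_volterra[OF y x] by (rule integral_unique)
    moreover have "\<bar>integral {0..x} (\<lambda>t. (q t - lam) * (y t * (x - t)))\<bar> \<le> integral {0..x} (\<lambda>t. \<bar>q t - lam\<bar> * \<bar>y t\<bar>)"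
    proof (rule weighted_integral_bound[OF p _ _ x])
      show "\<bar>y t * (x - t)\<bar> \<le> \<bar>y t\<bar>" if "0 \<le> t" "t \<le> x" for t
        using mult_left_mono[of "\<bar>x - t\<bar>" 1 "\<bar>y t\<bar>"] that x by (simp add: abs_mult)
    qed (intro continuous_intros c)+
    moreover have "\<bar>dy 0 * x\<bar> \<le> \<bar>dy 0\<bar>"
      using mult_left_mono[of "\<bar>x\<bar>" 1 "\<bar>dy 0\<bar>"] x by (simp add: abs_mult)
    ultimately show "\<bar>y x\<bar> \<le> \<bar>y 0\<bar> + \<bar>dy 0\<bar> + integral {0..x} (\<lambda>t. \<bar>q t - lam\<bar> * \<bar>y t\<bar>)"
      by linarith
  qed simp
qed

lemma sl_solution_zero:
  assumes "q absolutely_integrable_on {0..1}" "sl_solution q lam y dy" "y 0 = 0" "dy 0 = 0" "x \<in> {0..1}"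
  shows "y x = 0"
  using sl_solution_bound[OF assms(1,2), of x] assms(3-5) by simp

lemma integral_abs_diff_le:
  fixes q :: "real \<Rightarrow> real"
  assumes q: "q absolutely_integrable_on {0..1}"
  shows "integral {0..1} (\<lambda>t. \<bar>q t - c\<bar>) \<le> integral {0..1} (\<lambda>t. \<bar>q t\<bar>) + \<bar>c\<bar>"
proof -
  have "integral {0..1} (\<lambda>t. \<bar>q t - c\<bar>) \<le> integral {0..1} (\<lambda>t. \<bar>q t\<bar> + \<bar>c\<bar>)"
    using abs_weight_integrable[OF absolutely_integrable_diff_const[OF q]] abs_weight_integrable[OF q]
    by (intro integral_le integrable_add) (auto simp: absolutely_integrable_on_def)
  also have "\<dots> = integral {0..1} (\<lambda>t. \<bar>q t\<bar>) + \<bar>c\<bar>"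
    using abs_weight_integrable[OF q] by (subst integral_add) (auto simp: absolutely_integrable_on_def)
  finally show ?thesis .
qed

text \<open>The difference of the two solutions satisfies a Volterra equation with zero initial data
  and inhomogeneity of size \<open>\<bar>lam - mu\<bar>\<close> times the supremum of
  \<open>w\<close>, to which Gronwall applies. The restriction to
  \<open>\<bar>lam - mu\<bar> \<le> 1\<close> lets one \<open>Q\<close> bound the integrals of
  \<open>\<bar>q - lam\<bar>\<close>, so \<open>C\<close> does not depend on
  \<open>lam\<close>.\<close>

lemma sl_solution_param_continuous:
  assumes q: "q absolutely_integrable_on {0..1}" and w: "sl_solution q mu w dw"
  obtains C where "0 \<le> C" "\<And>lam y dy x. \<bar>lam - mu\<bar> \<le> 1 \<Longrightarrow> sl_solution q lam y dy \<Longrightarrow>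
      y 0 = w 0 \<Longrightarrow> dy 0 = dw 0 \<Longrightarrow> x \<in> {0..1} \<Longrightarrow>
      \<bar>y x - w x\<bar> \<le> C * \<bar>lam - mu\<bar> \<and> \<bar>dy x - dw x\<bar> \<le> C * \<bar>lam - mu\<bar>"
proof -
  note wc = sl_solution_continuous(1)[OF w]
  obtain B where B: "\<And>x. x \<in> {0..1} \<Longrightarrow> \<bar>w x\<bar> \<le> B"
    using continuous_on_interval_bounded[OF wc] by blast
  have B0: "0 \<le> B" using B[of 0] by simp
  define Q where "Q = integral {0..1} (\<lambda>t. \<bar>q t\<bar>) + (\<bar>mu\<bar> + 1)"
  define E where "E = 2 * B * exp (2 * Q)"
  have E0: "0 \<le> E" using B0 by (simp add: E_def)
  have "\<bar>y x - w x\<bar> \<le> E * \<bar>lam - mu\<bar> \<and> \<bar>dy x - dw x\<bar> \<le> (Q * E + B) * \<bar>lam - mu\<bar>"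
    if lam: "\<bar>lam - mu\<bar> \<le> 1" and y: "sl_solution q lam y dy" and ini: "y 0 = w 0" "dy 0 = dw 0" and x: "x \<in> {0..1}"
    for lam y dy x
  proof -
    define e where "e = \<bar>lam - mu\<bar>"
    have e0: "0 \<le> e" by (simp add: e_def)
    note p = absolutely_integrable_diff_const[OF q, of lam]
    note yc = sl_solution_continuous(1)[OF y]
    have dc: "continuous_on {0..1} (\<lambda>t. y t - w t)" by (intro continuous_intros yc wc)
    have Qp: "integral {0..1} (\<lambda>t. \<bar>q t - lam\<bar>) \<le> Q"
      using integral_abs_diff_le[OF q, of lam] lam by (simp add: Q_def)
    have W: "gronwall_weight (\<lambda>t. q t - lam) s \<le> exp (2 * Q)" if "s \<in> {0..1}" for s
      using gronwall_weight_mono[OF p, of s 1] that Qp by (simp add: gronwall_weight_def)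
    have Bi: "\<bar>integral {0..s} (\<lambda>t. (mu - lam) * (w t * f t))\<bar> \<le> B * e"
      if s: "s \<in> {0..1}" and f: "continuous_on {0..1} f" "\<And>t. t \<in> {0..s} \<Longrightarrow> \<bar>f t\<bar> \<le> 1" for s f
    proof -
      have "norm (integral {0..s} (\<lambda>t. (mu - lam) * (w t * f t))) \<le> integral {0..s} (\<lambda>t. e * B)"
      proof (rule integral_norm_bound_integral)
        show "(\<lambda>t. (mu - lam) * (w t * f t)) integrable_on {0..s}"
          using s by (intro integrable_continuous_interval continuous_on_subset[of "{0..1}" _ "{0..s}"]
              continuous_intros wc f) auto
        show "norm ((mu - lam) * (w t * f t)) \<le> e * B" if "t \<in> {0..s}" for t
        proof -
          have "\<bar>w t\<bar> * \<bar>f t\<bar> \<le> B * 1" using B[of t] f(2)[OF that] that s by (intro mult_mono) auto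
          then show ?thesis
            using mult_left_mono[of "\<bar>w t\<bar> * \<bar>f t\<bar>" B e] e0
            by (simp add: abs_mult e_def abs_minus_commute)
        qed
      qed (rule integrable_const_ivl)
      also have "\<dots> = s * (e * B)" using s by simp
      also have "\<dots> \<le> 1 * (e * B)" using s e0 B0 by (intro mult_right_mono) auto
      finally show ?thesis by (simp add: mult.commute)
    qed
    \<comment> \<open>The factor \<open>f\<close> is the kernel \<open>x - t\<close> for the
      estimate of \<open>y\<close> and 1 for the estimate of \<open>dy\<close>.\<close>
    have split: "integral {0..s} (\<lambda>t. (q t - lam) * (y t * f t)) - integral {0..s} (\<lambda>t. (q t - mu) * (w t * f t))
        = integral {0..s} (\<lambda>t. (q t - lam) * ((y t - w t) * f t)) + integral {0..s} (\<lambda>t. (mu - lam) * (w t * f t))"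
      if s: "s \<in> {0..1}" and f: "continuous_on {0..1} f" for s f
    proof -
      have s': "0 \<le> s" "s \<le> 1" using s by auto
      have i1: "(\<lambda>t. (q t - lam) * (y t * f t)) integrable_on {0..s}"
        "(\<lambda>t. (q t - mu) * (w t * f t)) integrable_on {0..s}"
        "(\<lambda>t. (q t - lam) * ((y t - w t) * f t)) integrable_on {0..s}"
        by (rule integrable_weighted(1)[OF absolutely_integrable_diff_const[OF q] _ s'];
            intro continuous_intros yc wc f)+
      have i2: "(\<lambda>t. (mu - lam) * (w t * f t)) integrable_on {0..s}"
        using s by (intro integrable_continuous_interval continuous_on_subset[of "{0..1}" _ "{0..s}"]
              continuous_intros wc f) auto
      show ?thesis
        unfolding integral_diff[OF i1(1,2), symmetric] integral_add[OF i1(3) i2, symmetric]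
        by (intro integral_cong) (simp add: algebra_simps)
    qed
    have d: "\<bar>y s - w s\<bar> \<le> E * e" if s: "s \<in> {0..1}" for s
    proof -
      have "\<bar>y s - w s\<bar> \<le> 2 * (B * e) * gronwall_weight (\<lambda>t. q t - lam) s"
      proof (rule gronwall[OF p dc])
        fix x :: real assume x: "0 \<le> x" "x \<le> 1"
        have xc: "continuous_on {0..1} (\<lambda>t. x - t)" by (intro continuous_intros)
        have "y x - w x = integral {0..x} (\<lambda>t. (q t - lam) * (y t * (x - t))) - integral {0..x} (\<lambda>t. (q t - mu) * (w t * (x - t)))"
          using integral_unique[OF sl_solution_volterra[OF y x]] integral_unique[OF sl_solution_volterra[OF w x]] ini by simp
        also have "\<dots> = integral {0..x} (\<lambda>t. (q t - lam) * ((y t - w t) * (x - t))) + integral {0..x} (\<lambda>t. (mu - lam) * (w t * (x - t)))"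
          using x by (intro split xc) auto
        finally have eq: "y x - w x = \<dots>" .
        have b1: "\<bar>integral {0..x} (\<lambda>t. (q t - lam) * ((y t - w t) * (x - t)))\<bar> \<le> integral {0..x} (\<lambda>t. \<bar>q t - lam\<bar> * \<bar>y t - w t\<bar>)"
        proof (rule weighted_integral_bound[OF p _ _ x])
          show "\<bar>(y t - w t) * (x - t)\<bar> \<le> \<bar>y t - w t\<bar>" if "0 \<le> t" "t \<le> x" for t
            using mult_left_mono[of "\<bar>x - t\<bar>" 1 "\<bar>y t - w t\<bar>"] that x by (simp add: abs_mult)
        qed (intro continuous_intros dc xc)+
        have "\<bar>integral {0..x} (\<lambda>t. (mu - lam) * (w t * (x - t)))\<bar> \<le> B * e"
          using x by (intro Bi xc) auto
        then show "\<bar>y x - w x\<bar> \<le> B * e + integral {0..x} (\<lambda>t. \<bar>q t - lam\<bar> * \<bar>y t - w t\<bar>)"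
          using eq b1 by linarith
      qed (use B0 e0 s in auto)
      also have "\<dots> \<le> 2 * (B * e) * exp (2 * Q)"
        using B0 e0 s by (intro mult_left_mono W) auto
      also have "\<dots> = E * e" by (simp add: E_def)
      finally show ?thesis .
    qed
    have x': "0 \<le> x" "x \<le> 1" using x by auto
    have "dy x - dw x = integral {0..x} (\<lambda>t. (q t - lam) * (y t * 1)) - integral {0..x} (\<lambda>t. (q t - mu) * (w t * 1))"
      using integral_unique[OF sl_solution_integral[OF y x']] integral_unique[OF sl_solution_integral[OF w x']] ini by simp
    also have "\<dots> = integral {0..x} (\<lambda>t. (q t - lam) * ((y t - w t) * 1)) + integral {0..x} (\<lambda>t. (mu - lam) * (w t * 1))"
      using x by (intro split) auto
    finally have eq: "dy x - dw x = integral {0..x} (\<lambda>t. (q t - lam) * (y t - w t)) + integral {0..x} (\<lambda>t. (mu - lam) * (w t * 1))"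
      by simp
    have "\<bar>integral {0..x} (\<lambda>t. (q t - lam) * (y t - w t))\<bar> \<le> integral {0..x} (\<lambda>t. \<bar>q t - lam\<bar> * (E * e))"
      using d x by (intro weighted_integral_bound[OF p] dc continuous_intros) auto
    also have "\<dots> = (E * e) * integral {0..x} (\<lambda>t. \<bar>q t - lam\<bar>)" by (simp add: mult.commute)
    also have "\<dots> \<le> (E * e) * integral {0..1} (\<lambda>t. \<bar>q t - lam\<bar>)"
    proof (intro mult_left_mono integral_subset_le)
      show "(\<lambda>t. \<bar>q t - lam\<bar>) integrable_on {0..x}" "(\<lambda>t. \<bar>q t - lam\<bar>) integrable_on {0..1}"
        using integrable_weighted(2)[OF p continuous_on_const x', of 1] integrable_weighted(2)[OF p continuous_on_const, of 1 1] by auto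
    qed (use x E0 e0 in auto)
    also have "\<dots> \<le> (E * e) * Q" using Qp E0 e0 by (intro mult_left_mono) auto
    finally have b1: "\<bar>integral {0..x} (\<lambda>t. (q t - lam) * (y t - w t))\<bar> \<le> E * e * Q" .
    have "\<bar>integral {0..x} (\<lambda>t. (mu - lam) * (w t * 1))\<bar> \<le> B * e"
      using x by (intro Bi) auto
    then have "\<bar>dy x - dw x\<bar> \<le> (Q * E + B) * e" using eq b1 by (simp add: algebra_simps)
    then show ?thesis using d[OF x] by (simp add: e_def)
  qed
  note main = this
  define C where "C = max E (Q * E + B)"
  show thesis
  proof (rule that[of C])
    show "0 \<le> C" using E0 by (simp add: C_def)
    fix lam y dy x
    assume a: "\<bar>lam - mu\<bar> \<le> 1" "sl_solution q lam y dy" "y 0 = w 0" "dy 0 = dw 0" "x \<in> {0..1::real}"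
    have "E * \<bar>lam - mu\<bar> \<le> C * \<bar>lam - mu\<bar>" "(Q * E + B) * \<bar>lam - mu\<bar> \<le> C * \<bar>lam - mu\<bar>"
      by (auto simp: C_def intro!: mult_right_mono)
    then show "\<bar>y x - w x\<bar> \<le> C * \<bar>lam - mu\<bar> \<and> \<bar>dy x - dw x\<bar> \<le> C * \<bar>lam - mu\<bar>"
      using main[OF a] by linarith
  qed
qed


section \<open>Fundamental solutions\<close>

text \<open>A solution and its derivative are chosen together as a pair. Their values outside [0, 1]
  remain arbitrary.\<close>

definition ivp_solution :: "(real \<Rightarrow> real) \<Rightarrow> real \<Rightarrow> real \<Rightarrow> real \<Rightarrow> (real \<Rightarrow> real) \<times> (real \<Rightarrow> real)" where
  "ivp_solution q lam \<alpha> \<beta> =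
     (SOME ydy. sl_solution q lam (fst ydy) (snd ydy) \<and> fst ydy 0 = \<alpha> \<and> snd ydy 0 = \<beta>)"

text \<open>The fundamental system at 0. For \<open>q = 0\<close> and \<open>lam > 0\<close> it
  consists of \<open>cos (sqrt lam * x)\<close> and \<open>sin (sqrt lam * x) / sqrt lam\<close>, so
  the zeros of \<open>sn q lam 1\<close> in \<open>lam\<close> are the Dirichlet
  eigenvalues.\<close>

definition cs :: "(real \<Rightarrow> real) \<Rightarrow> real \<Rightarrow> real \<Rightarrow> real" where "cs q lam = fst (ivp_solution q lam 1 0)"
definition dcs :: "(real \<Rightarrow> real) \<Rightarrow> real \<Rightarrow> real \<Rightarrow> real" where "dcs q lam = snd (ivp_solution q lam 1 0)"
definition sn :: "(real \<Rightarrow> real) \<Rightarrow> real \<Rightarrow> real \<Rightarrow> real" where "sn q lam = fst (ivp_solution q lam 0 1)"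
definition dsn :: "(real \<Rightarrow> real) \<Rightarrow> real \<Rightarrow> real \<Rightarrow> real" where "dsn q lam = snd (ivp_solution q lam 0 1)"

lemma sl_solution_cong:
  assumes "sl_solution q lam y dy" "\<And>x. x \<in> {0..1} \<Longrightarrow> w x = y x"
  shows "sl_solution q lam w dy"
  unfolding sl_solution_iff
proof (intro conjI ballI)
  fix x :: real assume x: "x \<in> {0..1}"
  show "(w has_real_derivative dy x) (at x within {0..1})"
    by (rule has_field_derivative_transform_within[OF sl_solution_deriv[OF assms(1) x] zero_less_one x])
      (simp add: assms(2))
next
  show "has_ae_derivative dy (\<lambda>x. (q x - lam) * w x)"
    by (rule has_ae_derivative_cong[OF sl_solution_has_ae_derivative(2)[OF assms(1)]]) (simp add: assms(2))
qed

lemma sl_positive_from_nonzero: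
  assumes y: "sl_solution q lam y dy" and ini: "y 0 = 0" "0 < dy 0"
    and nz: "\<And>x. x \<in> {0<..1} \<Longrightarrow> y x \<noteq> 0" and x: "x \<in> {0<..1}"
  shows "0 < y x"
proof (rule ccontr)
  assume "\<not> 0 < y x"
  then have yx: "y x < 0" using nz[OF x] by linarith
  obtain d where d: "0 < d" "\<And>h. 0 < h \<Longrightarrow> h < d \<Longrightarrow> h \<le> 1 \<Longrightarrow> y 0 < y h"
    using has_real_derivative_pos_inc_right[OF sl_solution_deriv[OF y, of 0] ini(2)] by force
  define h where "h = min (d / 2) x"
  have h: "0 < h" "h \<le> x" "h < d" using d(1) x by (auto simp: h_def)
  have "0 < y h" using d(2)[of h] h x ini by simp
  have "continuous_on {h..x} y"
    by (rule continuous_on_subset[OF sl_solution_continuous(1)[OF y]]) (use h x in auto)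
  then obtain t where "h \<le> t" "t \<le> x" "y t = 0"
    using IVT2'[of y x 0 h] yx \<open>0 < y h\<close> h by force
  then show False using nz[of t] h x by auto
qed

context
  fixes q :: "real \<Rightarrow> real"
  assumes q: "q absolutely_integrable_on {0..1}"
begin

lemma ivp_solution:
  "sl_solution q lam (fst (ivp_solution q lam \<alpha> \<beta>)) (snd (ivp_solution q lam \<alpha> \<beta>))"
  "fst (ivp_solution q lam \<alpha> \<beta>) 0 = \<alpha>" "snd (ivp_solution q lam \<alpha> \<beta>) 0 = \<beta>"
proof -
  obtain y dy where "sl_solution q lam y dy" "y 0 = \<alpha>" "dy 0 = \<beta>"
    by (rule sl_solution_exists[OF q])
  then have "\<exists>ydy. sl_solution q lam (fst ydy) (snd ydy) \<and> fst ydy 0 = \<alpha> \<and> snd ydy 0 = \<beta>"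
    by (intro exI[of _ "(y, dy)"]) simp
  from someI_ex[OF this] show
    "sl_solution q lam (fst (ivp_solution q lam \<alpha> \<beta>)) (snd (ivp_solution q lam \<alpha> \<beta>))"
    "fst (ivp_solution q lam \<alpha> \<beta>) 0 = \<alpha>" "snd (ivp_solution q lam \<alpha> \<beta>) 0 = \<beta>"
    unfolding ivp_solution_def by blast+
qed

lemma cs: "sl_solution q lam (cs q lam) (dcs q lam)" "cs q lam 0 = 1" "dcs q lam 0 = 0"
  unfolding cs_def dcs_def by (rule ivp_solution)+

lemma sn: "sl_solution q lam (sn q lam) (dsn q lam)" "sn q lam 0 = 0" "dsn q lam 0 = 1"
  unfolding sn_def dsn_def by (rule ivp_solution)+

lemma wronskian:
  assumes "sl_solution q lam y dy" "sl_solution q lam w dw" "x \<in> {0..1}"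
  shows "dy x * w x - y x * dw x = dy 0 * w 0 - y 0 * dw 0"
proof -
  have x: "0 \<le> x" "x \<le> 1" using assms(3) by auto
  have "((\<lambda>t. 0) has_integral (dy x * w x - y x * dw x) - (dy 0 * w 0 - y 0 * dw 0)) {0..x}"
    using sl_green[OF assms(1,2) x] by simp
  then have "(dy x * w x - y x * dw x) - (dy 0 * w 0 - y 0 * dw 0) = 0"
    by (rule has_integral_unique) simp
  then show ?thesis by simp
qed

lemma wronskian_cs_sn: "x \<in> {0..1} \<Longrightarrow> cs q lam x * dsn q lam x - sn q lam x * dcs q lam x = 1"
  using wronskian[OF sn(1) cs(1), of x lam] sn(2,3)[of lam] cs(2,3)[of lam] by (simp add: mult.commute)

lemma fundamental_param_tendsto:
  assumes "x \<in> {0..1}"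
  shows "((\<lambda>lam. cs q lam x) \<longlongrightarrow> cs q mu x) (at mu)"
    "((\<lambda>lam. sn q lam x) \<longlongrightarrow> sn q mu x) (at mu)" "((\<lambda>lam. dsn q lam x) \<longlongrightarrow> dsn q mu x) (at mu)"
proof -
  have *: "(f \<longlongrightarrow> f mu) (at mu)" if "\<And>lam. \<bar>lam - mu\<bar> \<le> 1 \<Longrightarrow> \<bar>f lam - f mu\<bar> \<le> C * \<bar>lam - mu\<bar>" for f :: "real \<Rightarrow> real" and C
  proof -
    have "((\<lambda>lam. f lam - f mu) \<longlongrightarrow> 0) (at mu)"
    proof (rule Lim_null_comparison)
      show "\<forall>\<^sub>F lam in at mu. norm (f lam - f mu) \<le> C * \<bar>lam - mu\<bar>"
        unfolding eventually_at using that by (intro exI[of _ 1]) (auto simp: dist_real_def)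
      have "((\<lambda>lam. C * \<bar>lam - mu\<bar>) \<longlongrightarrow> C * \<bar>mu - mu\<bar>) (at mu)" by (intro tendsto_intros)
      then show "((\<lambda>lam. C * \<bar>lam - mu\<bar>) \<longlongrightarrow> 0) (at mu)" by simp
    qed
    then show ?thesis by (simp add: LIM_zero_iff)
  qed
  obtain C where C: "\<And>lam y dy x. \<bar>lam - mu\<bar> \<le> 1 \<Longrightarrow> sl_solution q lam y dy \<Longrightarrow>
      y 0 = cs q mu 0 \<Longrightarrow> dy 0 = dcs q mu 0 \<Longrightarrow> x \<in> {0..1} \<Longrightarrow>
      \<bar>y x - cs q mu x\<bar> \<le> C * \<bar>lam - mu\<bar> \<and> \<bar>dy x - dcs q mu x\<bar> \<le> C * \<bar>lam - mu\<bar>"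
    by (rule sl_solution_param_continuous[OF q cs(1)[of mu]]) blast
  obtain D where D: "\<And>lam y dy x. \<bar>lam - mu\<bar> \<le> 1 \<Longrightarrow> sl_solution q lam y dy \<Longrightarrow>
      y 0 = sn q mu 0 \<Longrightarrow> dy 0 = dsn q mu 0 \<Longrightarrow> x \<in> {0..1} \<Longrightarrow>
      \<bar>y x - sn q mu x\<bar> \<le> D * \<bar>lam - mu\<bar> \<and> \<bar>dy x - dsn q mu x\<bar> \<le> D * \<bar>lam - mu\<bar>"
    by (rule sl_solution_param_continuous[OF q sn(1)[of mu]]) blast
  show "((\<lambda>lam. cs q lam x) \<longlongrightarrow> cs q mu x) (at mu)"
    using C[OF _ cs(1), of _ x] assms by (intro *[of _ C]) (simp add: cs(2,3))
  show "((\<lambda>lam. sn q lam x) \<longlongrightarrow> sn q mu x) (at mu)"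
    using D[OF _ sn(1), of _ x] assms by (intro *[of _ D]) (simp add: sn(2,3))
  show "((\<lambda>lam. dsn q lam x) \<longlongrightarrow> dsn q mu x) (at mu)"
    using D[OF _ sn(1), of _ x] assms by (intro *[of _ D]) (simp add: sn(2,3))
qed

text \<open>Uniform closeness of the solutions is not enough, because \<open>sn\<close> vanishes at
  0. The quotient \<open>sn / x\<close>, extended by its limit 1, has a positive minimum
  \<open>c\<close>, while closeness of the derivatives makes the error at \<open>x\<close> at most
  \<open>D * d * x\<close>, with \<open>D * d < c\<close>.\<close>

lemma sn_positive_open:
  assumes pos: "\<And>x. x \<in> {0<..1} \<Longrightarrow> 0 < sn q mu x"
  shows "\<forall>\<^sub>F lam in at mu. \<forall>x\<in>{0<..1}. 0 < sn q lam x"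
proof -
  define g where "g = (\<lambda>x. if x = 0 then 1 else sn q mu x / x)"
  have "continuous_on {0..1} g"
    unfolding continuous_on
  proof
    fix x :: real assume x: "x \<in> {0..1}"
    show "(g \<longlongrightarrow> g x) (at x within {0..1})"
    proof (cases "x = 0")
      case True
      have "((\<lambda>t. sn q mu t / t) \<longlongrightarrow> 1) (at 0 within {0..1})"
        using sl_solution_deriv[OF sn(1)[of mu], of 0] sn(2,3)[of mu] by (simp add: has_field_derivative_iff)
      then have "(g \<longlongrightarrow> 1) (at 0 within {0..1})"
        by (rule Lim_transform_eventually) (auto simp: g_def eventually_at_filter)
      then show ?thesis using True by (simp add: g_def)
    next
      case False
      have "((\<lambda>t. sn q mu t / t) \<longlongrightarrow> sn q mu x / x) (at x within {0..1})"
        using sl_solution_continuous(1)[OF sn(1)[of mu]] x False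
        by (intro tendsto_intros) (auto simp: continuous_on)
      moreover have "\<forall>\<^sub>F t in at x within {0..1}. sn q mu t / t = g t"
        unfolding eventually_at using False by (intro exI[of _ "\<bar>x\<bar>"]) (auto simp: g_def dist_real_def)
      ultimately show ?thesis
        using False by (simp add: g_def Lim_transform_eventually)
    qed
  qed
  then obtain x0 where x0: "x0 \<in> {0..1}" "\<And>x. x \<in> {0..1} \<Longrightarrow> g x0 \<le> g x"
    using continuous_attains_inf[of "{0..1::real}" g] by auto
  define c where "c = g x0"
  have c: "0 < c" using pos[of x0] x0(1) by (auto simp: c_def g_def)
  have le: "c * x \<le> sn q mu x" if "x \<in> {0..1}" for x
  proof (cases "x = 0")
    case False
    have "c \<le> sn q mu x / x" using x0(2)[OF that] False by (simp add: c_def g_def[THEN fun_cong, of x])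
    then show ?thesis using False that by (simp add: field_simps)
  qed (simp add: sn(2))
  obtain D where D: "0 \<le> D" "\<And>lam y dy x. \<bar>lam - mu\<bar> \<le> 1 \<Longrightarrow> sl_solution q lam y dy \<Longrightarrow>
      y 0 = sn q mu 0 \<Longrightarrow> dy 0 = dsn q mu 0 \<Longrightarrow> x \<in> {0..1} \<Longrightarrow>
      \<bar>y x - sn q mu x\<bar> \<le> D * \<bar>lam - mu\<bar> \<and> \<bar>dy x - dsn q mu x\<bar> \<le> D * \<bar>lam - mu\<bar>"
    by (rule sl_solution_param_continuous[OF q sn(1)[of mu]]) blast
  define d where "d = min 1 (c / (2 * (D + 1)))"
  have d: "0 < d" "d \<le> 1" "D * d < c"
  proof -
    show "0 < d" "d \<le> 1" using c D(1) by (auto simp: d_def)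
    have "D * d \<le> D * (c / (2 * (D + 1)))" using D(1) by (intro mult_left_mono) (auto simp: d_def)
    also have "\<dots> < c" using c D(1) by (simp add: field_simps) (smt (verit) mult_nonneg_nonneg)
    finally show "D * d < c" .
  qed
  have "0 < sn q lam x" if lam: "\<bar>lam - mu\<bar> < d" and x: "x \<in> {0<..1}" for lam x
  proof -
    have "norm ((sn q lam x - sn q mu x) - (sn q lam 0 - sn q mu 0)) \<le> D * d * norm (x - 0)"
    proof (rule field_differentiable_bound[of "{0..1}" "\<lambda>t. sn q lam t - sn q mu t" "\<lambda>t. dsn q lam t - dsn q mu t"])
      fix t :: real assume t: "t \<in> {0..1}"
      show "((\<lambda>t. sn q lam t - sn q mu t) has_real_derivative dsn q lam t - dsn q mu t) (at t within {0..1})"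
        by (intro DERIV_diff sl_solution_deriv[OF sn(1) t])
      have "\<bar>dsn q lam t - dsn q mu t\<bar> \<le> D * \<bar>lam - mu\<bar>"
        using D(2)[OF _ sn(1), of lam t] t lam d(2) by (simp add: sn(2,3))
      also have "\<dots> \<le> D * d" using D(1) lam by (intro mult_left_mono) auto
      finally show "norm (dsn q lam t - dsn q mu t) \<le> D * d" by simp
    qed (use x in auto)
    then have "\<bar>sn q lam x - sn q mu x\<bar> \<le> D * d * x" using x by (simp add: sn(2))
    moreover have "D * d * x < c * x" using d(3) x by simp
    moreover have "c * x \<le> sn q mu x" using le[of x] x by simp
    ultimately show ?thesis by linarith
  qed
  then show ?thesis unfolding eventually_at using d(1) by (intro exI[of _ d]) (auto simp: dist_real_def)
qed

text \<open>The Riccati trial function \<open>z\<close> vanishes at both end points and absorbs the singular part of \<open>q\<close>: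
  with it, \<open>y y' - z y\<^sup>2\<close> has derivative \<open>(y' - z y)\<^sup>2 + (\<integral>q - lam - z\<^sup>2) y\<^sup>2\<close>.\<close>

lemma coercive:
  obtains L where "\<And>lam y dy x. lam \<le> L \<Longrightarrow> sl_solution q lam y dy \<Longrightarrow> 0 < x \<Longrightarrow> x \<le> 1 \<Longrightarrow>
      x = 1 \<or> y x = 0 \<Longrightarrow> y x * dy x \<le> y 0 * dy 0 \<Longrightarrow> y 0 = 0 \<and> dy 0 = 0"
proof -
  define Q where "Q = integral {0..1} q"
  define z where "z = (\<lambda>x. integral {0..x} q - Q * x)"
  have z: "has_ae_derivative z (\<lambda>x. q x - Q)"
    unfolding z_def by (intro has_ae_derivative_diff has_ae_derivative_integral_fun q has_ae_derivative_C1)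
      (auto intro!: derivative_eq_intros)
  have z01: "z 0 = 0" "z 1 = 0" by (auto simp: z_def Q_def)
  obtain B where B: "\<And>x. x \<in> {0..1} \<Longrightarrow> \<bar>z x\<bar> \<le> B"
    using continuous_on_interval_bounded[OF has_ae_derivative_continuous[OF z]] by blast
  show thesis
  \<comment> \<open>This bound makes the coefficient \<open>Q - lam - (z t)\<^sup>2\<close> at least
    1. The term \<open>z * y\<^sup>2\<close> drops out at the right end point because either
    \<open>z\<close> or \<open>y\<close> vanishes there.\<close>
  proof (rule that[of "Q - B\<^sup>2 - 1"])
    fix lam y dy x
    assume lam: "lam \<le> Q - B\<^sup>2 - 1" and y: "sl_solution q lam y dy" and x: "0 < x" "x \<le> 1"
      and endp: "x = 1 \<or> y x = 0" and le: "y x * dy x \<le> y 0 * dy 0"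
    note Y = sl_solution_has_ae_derivative[OF y]
    have "has_ae_derivative (\<lambda>t. y t * dy t - z t * (y t * y t))
        (\<lambda>t. (dy t * dy t + y t * ((q t - lam) * y t)) - ((q t - Q) * (y t * y t) + z t * (dy t * y t + y t * dy t)))"
      by (intro has_ae_derivative_diff has_ae_derivative_mult Y z)
    then have "has_ae_derivative (\<lambda>t. y t * dy t - z t * (y t * y t))
        (\<lambda>t. (dy t - z t * y t)\<^sup>2 + (Q - lam - (z t)\<^sup>2) * (y t)\<^sup>2)"
      by (rule has_ae_derivative_cong) (simp add: algebra_simps power2_eq_square)
    from has_ae_derivative_integral[OF this, of x]
    have int: "((\<lambda>t. (dy t - z t * y t)\<^sup>2 + (Q - lam - (z t)\<^sup>2) * (y t)\<^sup>2) has_integral y x * dy x - y 0 * dy 0) {0..x}"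
      using x endp z01 by auto
    define g where "g = (\<lambda>t. (dy t - z t * y t)\<^sup>2 + (y t)\<^sup>2)"
    have gc: "continuous_on {0..x} g"
      unfolding g_def
      by (rule continuous_on_subset[of "{0..1}"],
          intro continuous_intros sl_solution_continuous[OF y] has_ae_derivative_continuous[OF z]) (use x in auto)
    have "integral {0..x} g \<le> y x * dy x - y 0 * dy 0"
    proof (rule has_integral_le[OF integrable_integral int])
      show "g integrable_on {0..x}" using gc by (rule integrable_continuous_interval)
      fix t assume t: "t \<in> {0..x}"
      have "(z t)\<^sup>2 \<le> B\<^sup>2" using B[of t] t x by (simp add: abs_le_square_iff[symmetric])
      then have "1 * (y t)\<^sup>2 \<le> (Q - lam - (z t)\<^sup>2) * (y t)\<^sup>2"
        using lam by (intro mult_right_mono) auto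
      then show "g t \<le> (dy t - z t * y t)\<^sup>2 + (Q - lam - (z t)\<^sup>2) * (y t)\<^sup>2" by (simp add: g_def)
    qed
    then have "integral {0..x} g \<le> 0" using le by simp
    moreover have "0 \<le> integral {0..x} g"
      using gc by (intro integral_nonneg integrable_continuous_interval) (auto simp: g_def)
    ultimately have "integral {0..x} g = 0" by simp
    then have "g 0 = 0"
      using integral_eq_0_iff[OF gc] x by (auto simp: g_def)
    then show "y 0 = 0 \<and> dy 0 = 0" by (simp add: g_def z01 sum_power2_eq_zero_iff)
  qed
qed

end


section \<open>The boundary form of an edge\<close>

text \<open>The Dirichlet-to-Neumann form of the edge: the outward derivatives of the solution with
  boundary values \<open>a\<close>, \<open>b\<close>, paired with \<open>a'\<close>,
  \<open>b'\<close>. It has this meaning when \<open>lam\<close> is not a Dirichlet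
  eigenvalue.\<close>

definition edge_polar :: "(real \<Rightarrow> real) \<Rightarrow> real \<Rightarrow> real \<Rightarrow> real \<Rightarrow> real \<Rightarrow> real \<Rightarrow> real" where
  "edge_polar q lam a b a' b' =
     (cs q lam 1 * a * a' - a * b' - a' * b + dsn q lam 1 * b * b') / sn q lam 1"

abbreviation "edge_form q lam a b \<equiv> edge_polar q lam a b a b"

definition bvp :: "(real \<Rightarrow> real) \<Rightarrow> real \<Rightarrow> real \<Rightarrow> real \<Rightarrow> real \<Rightarrow> real" where
  "bvp q lam a b x = a * cs q lam x + (b - a * cs q lam 1) / sn q lam 1 * sn q lam x"

definition dbvp :: "(real \<Rightarrow> real) \<Rightarrow> real \<Rightarrow> real \<Rightarrow> real \<Rightarrow> real \<Rightarrow> real" where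
  "dbvp q lam a b x = a * dcs q lam x + (b - a * cs q lam 1) / sn q lam 1 * dsn q lam x"

context
  fixes q :: "real \<Rightarrow> real"
  assumes q: "q absolutely_integrable_on {0..1}"
begin

lemma bvp:
  assumes "sn q lam 1 \<noteq> 0"
  shows "sl_solution q lam (bvp q lam a b) (dbvp q lam a b)" "bvp q lam a b 0 = a" "bvp q lam a b 1 = b"
    "b' * dbvp q lam a b 1 - a' * dbvp q lam a b 0 = edge_polar q lam a b a' b'"
proof -
  show "sl_solution q lam (bvp q lam a b) (dbvp q lam a b)"
    unfolding bvp_def[abs_def] dbvp_def[abs_def] by (intro sl_solution_lincomb cs sn q)
  show "bvp q lam a b 0 = a" by (simp add: bvp_def cs(2)[OF q] sn(2)[OF q])
  show "bvp q lam a b 1 = b" using assms by (simp add: bvp_def)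
  have W: "sn q lam 1 * dcs q lam 1 = cs q lam 1 * dsn q lam 1 - 1"
    using wronskian_cs_sn[OF q, of 1 lam] by simp
  have "dbvp q lam a b 1 = (b * dsn q lam 1 - a) / sn q lam 1"
  proof -
    have "dbvp q lam a b 1 * sn q lam 1 = a * (sn q lam 1 * dcs q lam 1) + (b - a * cs q lam 1) * dsn q lam 1"
      using assms by (simp add: dbvp_def field_simps)
    also have "\<dots> = b * dsn q lam 1 - a" unfolding W by (simp add: algebra_simps)
    finally show ?thesis using assms by (simp add: eq_divide_eq)
  qed
  moreover have "dbvp q lam a b 0 = (b - a * cs q lam 1) / sn q lam 1"
    by (simp add: dbvp_def cs(3)[OF q] sn(3)[OF q])
  ultimately show "b' * dbvp q lam a b 1 - a' * dbvp q lam a b 0 = edge_polar q lam a b a' b'"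
    by (simp add: edge_polar_def diff_divide_distrib[symmetric] algebra_simps)
qed

lemma edge_polar_tendsto:
  assumes "sn q mu 1 \<noteq> 0"
  shows "((\<lambda>lam. edge_polar q lam a b a' b') \<longlongrightarrow> edge_polar q mu a b a' b') (at mu)"
  unfolding edge_polar_def using assms
  by (intro tendsto_intros fundamental_param_tendsto[OF q]) auto

text \<open>\<open>coercive\<close> serves twice: applied to \<open>sn\<close> at a zero
  \<open>x\<close> it excludes the zero, and applied at \<open>x = 1\<close> to the solution with
  boundary values \<open>a\<close>, \<open>b\<close> it excludes a nonpositive form.\<close>

lemma edge_positive_low:
  "\<forall>\<^sub>F lam in at_bot. (\<forall>x\<in>{0<..1}. 0 < sn q lam x) \<and> (\<forall>a b. (a, b) \<noteq> (0, 0) \<longrightarrow> 0 < edge_form q lam a b)"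
proof -
  obtain L where L: "\<And>lam y dy x. lam \<le> L \<Longrightarrow> sl_solution q lam y dy \<Longrightarrow> 0 < x \<Longrightarrow> x \<le> 1 \<Longrightarrow>
      x = 1 \<or> y x = 0 \<Longrightarrow> y x * dy x \<le> y 0 * dy 0 \<Longrightarrow> y 0 = 0 \<and> dy 0 = 0"
    by (rule coercive[OF q]) blast
  have "(\<forall>x\<in>{0<..1}. 0 < sn q lam x) \<and> (\<forall>a b. (a, b) \<noteq> (0, 0) \<longrightarrow> 0 < edge_form q lam a b)"
    if lam: "lam \<le> L" for lam
  proof -
    have nz: "sn q lam x \<noteq> 0" if x: "x \<in> {0<..1}" for x
      using L[OF lam sn(1)[OF q], of x] x sn(2,3)[OF q, of lam] by auto
    have pos: "\<forall>x\<in>{0<..1}. 0 < sn q lam x"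
      using sl_positive_from_nonzero[OF sn(1)[OF q] sn(2)[OF q], of lam] nz sn(3)[OF q, of lam] by auto
    have "0 < edge_form q lam a b" if ab: "(a, b) \<noteq> (0, 0)" for a b
    proof (rule ccontr)
      assume "\<not> 0 < edge_form q lam a b"
      then have le: "b * dbvp q lam a b 1 \<le> a * dbvp q lam a b 0"
        using bvp(4)[of lam b a b a] nz[of 1] by simp
      have s1: "sn q lam 1 \<noteq> 0" using nz by simp
      have 0: "bvp q lam a b 0 = 0 \<and> dbvp q lam a b 0 = 0"
        by (rule L[OF lam bvp(1)[OF s1], of 1]) (use le bvp(2,3)[OF s1] in simp_all)
      then have "bvp q lam a b 1 = 0" 
        using sl_solution_zero[OF q bvp(1)[OF s1], of a b 1] by simp
      then show False using 0 bvp(2,3)[OF s1] ab by simp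
    qed
    with pos show ?thesis by blast
  qed
  then show ?thesis unfolding eventually_at_bot_linorder by blast
qed

text \<open>Positivity of \<open>sn\<close> for smaller parameters only gives nonnegativity in the
  limit. An interior zero would then be a minimum, hence a double zero, against the Wronskian
  identity. At the end point 1 a zero is possible, but only with negative slope.\<close>

lemma sn_nonneg_imp_pos:
  assumes nn: "\<And>x. x \<in> {0..1} \<Longrightarrow> 0 \<le> sn q mu x"
  shows "x \<in> {0<..<1} \<Longrightarrow> 0 < sn q mu x"
    and "sn q mu 1 = 0 \<Longrightarrow> dsn q mu 1 < 0"
proof -
  assume x: "x \<in> {0<..<1}"
  show "0 < sn q mu x"
  proof (rule ccontr)
    assume "\<not> 0 < sn q mu x"
    then have s0: "sn q mu x = 0" using nn[of x] x by auto
    have "(sn q mu has_real_derivative dsn q mu x) (at x)"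
      using sl_solution_deriv[OF sn(1)[OF q], of x mu] at_within_interior[of x "{0..1}"] x by simp
    then have "dsn q mu x = 0"
      by (rule DERIV_local_min[of _ _ _ "min x (1 - x)"]) (use x nn s0 in \<open>auto simp: abs_real_def split: if_splits\<close>)
    then show False using wronskian_cs_sn[OF q, of x mu] s0 x by simp
  qed
next
  assume s1: "sn q mu 1 = 0"
  have "dsn q mu 1 \<noteq> 0" using wronskian_cs_sn[OF q, of 1 mu] s1 by auto
  moreover have "\<not> 0 < dsn q mu 1"
  proof
    assume "0 < dsn q mu 1"
    then obtain d where d: "0 < d" "\<And>h. 0 < h \<Longrightarrow> 1 - h \<in> {0..1} \<Longrightarrow> h < d \<Longrightarrow> sn q mu (1 - h) < sn q mu 1"
      using has_real_derivative_pos_inc_left[OF sl_solution_deriv[OF sn(1)[OF q], of 1 mu]] by auto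
    have "sn q mu (1 - min (d / 2) 1) < 0" using d(2)[of "min (d / 2) 1"] d(1) s1 by auto
    then show False using nn[of "1 - min (d / 2) 1"] d(1) by auto
  qed
  ultimately show "dsn q mu 1 < 0" by linarith
qed

text \<open>As \<open>lam\<close> increases to a first Dirichlet eigenvalue, the form at the constant \<open>1\<close> blows up to \<open>-\<infinity>\<close>.\<close>

lemma edge_form_at_left:
  assumes pos: "\<And>lam x. lam < mu \<Longrightarrow> x \<in> {0<..1} \<Longrightarrow> 0 < sn q lam x"
  shows "x \<in> {0..1} \<Longrightarrow> 0 \<le> sn q mu x"
    and "\<exists>K. \<forall>\<^sub>F lam in at_left mu. edge_form q lam 1 1 \<le> K"
    and "sn q mu 1 = 0 \<Longrightarrow> \<forall>\<^sub>F lam in at_left mu. edge_form q lam 1 1 \<le> K"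
proof -
  have lt: "\<forall>\<^sub>F lam in at_left mu. lam < mu" by (simp add: eventually_at_filter)
  have nn: "0 \<le> sn q mu x" if x: "x \<in> {0..1}" for x
  proof (cases "x = 0")
    case False
    have "((\<lambda>lam. sn q lam x) \<longlongrightarrow> sn q mu x) (at_left mu)"
      using fundamental_param_tendsto(2)[OF q x] by (rule filterlim_mono) (auto intro: at_le)
    then show ?thesis
      by (rule tendsto_lowerbound)
        (use lt x False pos in \<open>auto elim!: eventually_mono intro!: less_imp_le\<close>)
  qed (simp add: sn(2)[OF q])
  then show "x \<in> {0..1} \<Longrightarrow> 0 \<le> sn q mu x" .
  have bad: "\<forall>\<^sub>F lam in at_left mu. edge_form q lam 1 1 \<le> K" if s1: "sn q mu 1 = 0" for K
  proof -
    let ?N = "\<lambda>lam. cs q lam 1 - 2 + dsn q lam 1"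
    have d: "dsn q mu 1 < 0" using sn_nonneg_imp_pos(2)[OF nn s1] .
    \<comment> \<open>At a Dirichlet eigenvalue the Wronskian identity makes \<open>cs\<close> and
      \<open>dsn\<close> reciprocal, so both are negative. The numerator of the form has a negative
      limit while the denominator tends to 0 from above.\<close>
    have "cs q mu 1 * dsn q mu 1 = 1" using wronskian_cs_sn[OF q, of 1 mu] s1 by simp
    then have "cs q mu 1 < 0" using d by (metis mult_pos_neg not_less_iff_gr_or_eq mult_zero_left zero_less_one less_asym)
    then have N: "?N mu < 0" using d by simp
    have "(?N \<longlongrightarrow> ?N mu) (at_left mu)"
      by (rule tendsto_mono[of _ "at mu"]) (auto intro: at_le intro!: tendsto_intros fundamental_param_tendsto[OF q])
    moreover have "filterlim (\<lambda>lam. inverse (sn q lam 1)) at_top (at_left mu)"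
    proof (rule filterlim_inverse_at_top)
      have "((\<lambda>lam. sn q lam 1) \<longlongrightarrow> sn q mu 1) (at_left mu)"
        by (rule tendsto_mono[of _ "at mu"]) (auto intro: at_le intro!: fundamental_param_tendsto[OF q])
      then show "((\<lambda>lam. sn q lam 1) \<longlongrightarrow> 0) (at_left mu)" using s1 by simp
      show "\<forall>\<^sub>F lam in at_left mu. 0 < sn q lam 1"
        using lt by (rule eventually_mono) (use pos in auto)
    qed
    ultimately have "filterlim (\<lambda>lam. ?N lam * inverse (sn q lam 1)) at_bot (at_left mu)"
      using N by (intro filterlim_tendsto_neg_mult_at_bot)
    then have "\<forall>\<^sub>F lam in at_left mu. ?N lam * inverse (sn q lam 1) \<le> K"
      by (simp add: filterlim_at_bot)
    then show ?thesis by (simp add: edge_polar_def divide_inverse)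
  qed
  then show "sn q mu 1 = 0 \<Longrightarrow> \<forall>\<^sub>F lam in at_left mu. edge_form q lam 1 1 \<le> K" .
  show "\<exists>K. \<forall>\<^sub>F lam in at_left mu. edge_form q lam 1 1 \<le> K"
  proof (cases "sn q mu 1 = 0")
    case True
    then show ?thesis using bad by blast
  next
    case False
    have "((\<lambda>lam. edge_form q lam 1 1) \<longlongrightarrow> edge_form q mu 1 1) (at_left mu)"
      by (rule tendsto_mono[OF _ edge_polar_tendsto[OF False]]) (auto intro: at_le)
    then have "\<forall>\<^sub>F lam in at_left mu. edge_form q lam 1 1 < edge_form q mu 1 1 + 1"
      by (rule order_tendstoD) simp
    then show ?thesis by (intro exI[of _ "edge_form q mu 1 1 + 1"]) (auto elim: eventually_mono)
  qed
qed

text \<open>The equality case comes from the Riccati substitution \<open>u = y'/y\<close>, for which \<open>\<integral>q = [u] + \<integral>u\<^sup>2\<close>.\<close>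

lemma integral_ge_edge_form:
  assumes pos: "\<And>x. x \<in> {0<..1} \<Longrightarrow> 0 < sn q 0 x"
  shows "edge_form q 0 1 1 \<le> integral {0..1} q"
    and "edge_form q 0 1 1 = integral {0..1} q \<Longrightarrow> AE x\<in>{0<..<1} in lebesgue. q x = 0"
proof -
  define y where "y = bvp q 0 1 1"
  define dy where "dy = dbvp q 0 1 1"
  have s1: "sn q 0 1 \<noteq> 0" using pos[of 1] by simp
  have y: "sl_solution q 0 y dy" and y01: "y 0 = 1" "y 1 = 1"
    and form: "edge_form q 0 1 1 = dy 1 - dy 0"
    unfolding y_def dy_def using bvp[OF s1] bvp(4)[OF s1, of 1 1 1 1] by simp_all
  \<comment> \<open>The Wronskian of \<open>y\<close> and \<open>sn\<close> is the constant -1, so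
    \<open>y / sn\<close> decreases on (0, 1] to its positive value at 1. This makes the quotient
    \<open>dy / y\<close> available on the whole interval.\<close>
  have ypos: "0 < y x" if x: "x \<in> {0..1}" for x
  proof (cases "x = 0")
    case False
    have der: "((\<lambda>t. y t / sn q 0 t) has_real_derivative (dy t * sn q 0 t - y t * dsn q 0 t) / (sn q 0 t * sn q 0 t)) (at t within {x..1})"
      if t: "t \<in> {x..1}" for t
    proof (rule DERIV_subset)
      show "((\<lambda>t. y t / sn q 0 t) has_real_derivative (dy t * sn q 0 t - y t * dsn q 0 t) / (sn q 0 t * sn q 0 t)) (at t within {0..1})"
        using t x False pos[of t] by (intro DERIV_divide sl_solution_deriv[OF y] sl_solution_deriv[OF sn(1)[OF q]]) auto
    qed (use x in auto)
    have neg: "(dy t * sn q 0 t - y t * dsn q 0 t) / (sn q 0 t * sn q 0 t) \<le> 0" if t: "t \<in> {x..1}" for t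
      using wronskian[OF q y sn(1)[OF q, of 0], of t] t x by (simp add: y01 sn(2,3)[OF q])
    have "y 1 / sn q 0 1 \<le> y x / sn q 0 x"
    proof (rule DERIV_nonpos_imp_decreasing_open[where f = "\<lambda>t. y t / sn q 0 t" and a = x and b = 1])
      show "continuous_on {x..1} (\<lambda>t. y t / sn q 0 t)" using der by (rule DERIV_continuous_on)
      fix t assume t: "x < t" "t < 1"
      then show "\<exists>d. ((\<lambda>t. y t / sn q 0 t) has_real_derivative d) (at t) \<and> d \<le> 0"
        using der[of t] neg[of t] at_within_interior[of t "{x..1}"] by auto
    qed (use x in auto)
    moreover have "0 < y 1 / sn q 0 1" using pos[of 1] y01 by simp
    ultimately have "0 < y x / sn q 0 x" by linarith
    then show ?thesis using pos[of x] x False by (simp add: zero_less_divide_iff)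
  qed (simp add: y01)
  have inv: "has_ae_derivative (\<lambda>x. inverse (y x)) (\<lambda>x. - (dy x) / (y x)\<^sup>2)"
  proof (rule has_ae_derivative_C1)
    fix x :: real assume x: "x \<in> {0..1}"
    show "((\<lambda>x. inverse (y x)) has_real_derivative - (dy x) / (y x)\<^sup>2) (at x within {0..1})"
      using DERIV_inverse'[OF sl_solution_deriv[OF y x]] ypos[OF x]
      by (simp add: divide_inverse power2_eq_square mult_ac)
  next
    show "continuous_on {0..1} (\<lambda>x. - dy x / (y x)\<^sup>2)"
      using ypos by (intro continuous_intros sl_solution_continuous[OF y]) (auto simp: less_imp_neq[symmetric] order_less_imp_not_eq2)
  qed
  have "has_ae_derivative (\<lambda>x. dy x * inverse (y x)) (\<lambda>x. ((q x - 0) * y x) * inverse (y x) + dy x * (- (dy x) / (y x)\<^sup>2))"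
    by (intro has_ae_derivative_mult inv sl_solution_has_ae_derivative[OF y])
  then have "has_ae_derivative (\<lambda>x. dy x * inverse (y x)) (\<lambda>x. q x - (dy x / y x)\<^sup>2)"
  proof (rule has_ae_derivative_cong)
    fix x :: real assume "x \<in> {0<..<1}"
    then have "y x \<noteq> 0" using ypos[of x] by auto
    then show "(q x - 0) * y x * inverse (y x) + dy x * (- dy x / (y x)\<^sup>2) = q x - (dy x / y x)\<^sup>2"
      by (simp add: power_divide power2_eq_square)
  qed
  from has_ae_derivative_integral[OF this, of 1]
  have int: "((\<lambda>x. q x - (dy x / y x)\<^sup>2) has_integral edge_form q 0 1 1) {0..1}"
    by (simp add: form y01)
  have c: "continuous_on {0..1} (\<lambda>x. (dy x / y x)\<^sup>2)"
    using ypos by (intro continuous_intros sl_solution_continuous[OF y]) (auto simp: less_imp_neq[symmetric] order_less_imp_not_eq2)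
  then have ci: "(\<lambda>x. (dy x / y x)\<^sup>2) integrable_on {0..1}" by (rule integrable_continuous_interval)
  have eq: "integral {0..1} q = edge_form q 0 1 1 + integral {0..1} (\<lambda>x. (dy x / y x)\<^sup>2)"
    using integral_unique[OF has_integral_add[OF int integrable_integral[OF ci]]] by simp
  have nn: "0 \<le> integral {0..1} (\<lambda>x. (dy x / y x)\<^sup>2)"
    using ci by (rule integral_nonneg) simp
  then show "edge_form q 0 1 1 \<le> integral {0..1} q" using eq by simp
  assume "edge_form q 0 1 1 = integral {0..1} q"
  then have "integral {0..1} (\<lambda>x. (dy x / y x)\<^sup>2) = 0" using eq by simp
  then have "\<forall>x\<in>{0..1}. (dy x / y x)\<^sup>2 = 0"
    using integral_eq_0_iff[OF c] by simp
  then have dy0: "dy x = 0" if "x \<in> {0..1}" for x using ypos[OF that] that by force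
  obtain N where N: "negligible N" "\<And>x. x \<in> {0<..<1} - N \<Longrightarrow> (dy has_real_derivative (q x - 0) * y x) (at x)"
    using sl_solution_has_ae_derivative(2)[OF y] unfolding has_ae_derivative_def by blast
  have "q x = 0" if x: "x \<in> {0<..<1} - N" for x
  proof -
    have "((\<lambda>x. 0) has_real_derivative (q x - 0) * y x) (at x)"
      using N(2)[OF x]
      by (rule has_field_derivative_transform_within_open[of _ _ _ "{0<..<1}"]) (use x dy0 in auto)
    then have "(q x - 0) * y x = 0" using DERIV_unique[OF _ DERIV_const] by blast
    then show ?thesis using ypos[of x] x by simp
  qed
  then have "{x\<in>{0<..<1}. q x \<noteq> 0} \<subseteq> N" by auto
  then show "AE x\<in>{0<..<1} in lebesgue. q x = 0"
    unfolding AE_on_iff_negligible using N(1) negligible_subset by blast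
qed

end


section \<open>The bottom of the spectrum\<close>

lemma bounded_family_subseq:
  fixes f :: "nat \<Rightarrow> 'i \<Rightarrow> real"
  assumes "finite I" "\<And>n i. i \<in> I \<Longrightarrow> \<bar>f n i\<bar> \<le> B"
  shows "\<exists>r l. strict_mono (r :: nat \<Rightarrow> nat) \<and> (\<forall>i\<in>I. (\<lambda>n. f (r n) i) \<longlonglongrightarrow> l i)"
  using assms
proof (induction I rule: finite_induct)
  case empty
  then show ?case by (intro exI[of _ "\<lambda>n. n"]) (auto simp: strict_mono_def)
next
  case (insert j I)
  have "\<exists>r l. strict_mono (r :: nat \<Rightarrow> nat) \<and> (\<forall>i\<in>I. (\<lambda>n. f (r n) i) \<longlonglongrightarrow> l i)"
    by (rule insert.IH) (use insert.prems in auto)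
  then obtain r l where r: "strict_mono (r :: nat \<Rightarrow> nat)" "\<And>i. i \<in> I \<Longrightarrow> (\<lambda>n. f (r n) i) \<longlonglongrightarrow> l i"
    by blast
  have "\<forall>n. f (r n) j \<in> {-B..B}" using insert.prems[of j] by (auto simp: abs_le_iff minus_le_iff)
  then obtain s :: "nat \<Rightarrow> nat" and c where s: "strict_mono s" "((\<lambda>n. f (r n) j) \<circ> s) \<longlonglongrightarrow> c"
    using compact_imp_seq_compact[OF compact_Icc[of "-B" B]] unfolding seq_compact_def by metis
  show ?case
  proof (intro exI[of _ "r \<circ> s"] exI[of _ "l(j := c)"] conjI ballI)
    show "strict_mono (r \<circ> s)" using r(1) s(1) by (rule strict_mono_o)
    fix i assume i: "i \<in> insert j I"
    show "(\<lambda>n. f ((r \<circ> s) n) i) \<longlonglongrightarrow> (l(j := c)) i"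
    proof (cases "i = j")
      case True then show ?thesis using s(2) by (simp add: comp_def)
    next
      case False
      then have "(\<lambda>n. f (r n) i) \<longlonglongrightarrow> l i" using i r(2) by simp
      then show ?thesis using False LIMSEQ_subseq_LIMSEQ[OF _ s(1)] by (force simp: comp_def)
    qed
  qed
qed

text \<open>With the indicator of a vertex as \<open>\<psi>\<close> this measures the failure of
  Kirchhoff's condition there, for the function that solves the equation on the edges with vertex
  values \<open>\<phi>\<close>. Kernel vectors are therefore the vertex values of eigenfunctions, as
  long as \<open>lam\<close> is not a Dirichlet eigenvalue of an edge.\<close>

definition graph_polar ::
  "('v, 'e) pre_digraph \<Rightarrow> ('e \<Rightarrow> real \<Rightarrow> real) \<Rightarrow> real \<Rightarrow> ('v \<Rightarrow> real) \<Rightarrow> ('v \<Rightarrow> real) \<Rightarrow> real" where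
  "graph_polar G q lam \<phi> \<psi> =
     (\<Sum>e\<in>arcs G. edge_polar (q e) lam (\<phi> (tail G e)) (\<phi> (head G e)) (\<psi> (tail G e)) (\<psi> (head G e)))"

text \<open>The first conjunct says that \<open>lam\<close> lies below the Dirichlet spectrum of every edge.\<close>

definition below_spectrum :: "('v, 'e) pre_digraph \<Rightarrow> ('e \<Rightarrow> real \<Rightarrow> real) \<Rightarrow> real \<Rightarrow> bool" where
  "below_spectrum G q lam \<longleftrightarrow> (\<forall>e\<in>arcs G. \<forall>x\<in>{0<..1}. 0 < sn (q e) lam x) \<and>
     (\<forall>\<phi>. (\<exists>v\<in>verts G. \<phi> v \<noteq> 0) \<longrightarrow> 0 < graph_polar G q lam \<phi> \<phi>)"

lemma edge_polar_add_scale: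
  "edge_form q lam (a + t * a') (b + t * b') =
     edge_form q lam a b + 2 * t * edge_polar q lam a b a' b' + t\<^sup>2 * edge_form q lam a' b'"
proof -
  have eq: "cs q lam 1 * (a + t * a') * (a + t * a') - (a + t * a') * (b + t * b') - (a + t * a') * (b + t * b')
      + dsn q lam 1 * (b + t * b') * (b + t * b')
    = (cs q lam 1 * a * a - a * b - a * b + dsn q lam 1 * b * b)
      + 2 * t * (cs q lam 1 * a * a' - a * b' - a' * b + dsn q lam 1 * b * b')
      + t\<^sup>2 * (cs q lam 1 * a' * a' - a' * b' - a' * b' + dsn q lam 1 * b' * b')"
    by (simp add: algebra_simps power2_eq_square)
  have "(A + 2 * t * B + t\<^sup>2 * C) / s = A / s + 2 * t * (B / s) + t\<^sup>2 * (C / s)" for A B C s :: real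
    by (simp add: add_divide_distrib)
  then show ?thesis unfolding edge_polar_def eq .
qed

lemma graph_polar_add_scale:
  "graph_polar G q lam (\<lambda>v. \<phi> v + t * \<psi> v) (\<lambda>v. \<phi> v + t * \<psi> v) =
     graph_polar G q lam \<phi> \<phi> + 2 * t * graph_polar G q lam \<phi> \<psi> + t\<^sup>2 * graph_polar G q lam \<psi> \<psi>"
  by (simp add: graph_polar_def edge_polar_add_scale sum.distrib sum_distrib_left)

lemma graph_polar_scale:
  "graph_polar G q lam (\<lambda>v. t * \<phi> v) (\<lambda>v. t * \<phi> v) = t\<^sup>2 * graph_polar G q lam \<phi> \<phi>"
  using graph_polar_add_scale[of G q lam "\<lambda>v. 0" t \<phi>] by (simp add: graph_polar_def edge_polar_def)

lemma quadratic_nonneg_imp_zero: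
  fixes b c :: real
  assumes "\<And>t. 0 \<le> 2 * t * b + t\<^sup>2 * c"
  shows "b = 0"
proof (rule ccontr)
  assume b: "b \<noteq> 0"
  \<comment> \<open>The minimizer of the majorant
    \<open>2 * t * b + t\<^sup>2 * (\<bar>c\<bar> + 1)\<close>; the \<open>+ 1\<close> keeps the
    leading coefficient positive.\<close>
  define t where "t = - b / (\<bar>c\<bar> + 1)"
  have "2 * t * b + t\<^sup>2 * c \<le> 2 * t * b + t\<^sup>2 * (\<bar>c\<bar> + 1)" by (intro add_left_mono mult_left_mono) auto
  also have "t\<^sup>2 * (\<bar>c\<bar> + 1) = t * (t * (\<bar>c\<bar> + 1))" by (simp add: power2_eq_square)
  also have "t * (\<bar>c\<bar> + 1) = - b" using abs_ge_zero[of c] unfolding t_def by (subst nonzero_eq_divide_eq[symmetric]) linarith+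
  finally have "0 \<le> t * b" using assms[of t] by linarith
  moreover have "t * b = - (b\<^sup>2 / (\<bar>c\<bar> + 1))" by (simp add: t_def power2_eq_square)
  moreover have "0 < b\<^sup>2 / (\<bar>c\<bar> + 1)" using b by (intro divide_pos_pos) auto
  ultimately show False by linarith
qed

context
  fixes G :: "('v, 'e) pre_digraph" and q :: "'e \<Rightarrow> real \<Rightarrow> real"
  assumes fin: "fin_digraph G"
    and q: "\<And>e. e \<in> arcs G \<Longrightarrow> q e absolutely_integrable_on {0..1}"
    and incident: "\<And>v. v \<in> verts G \<Longrightarrow> \<exists>e\<in>arcs G. tail G e = v \<or> head G e = v"
begin

interpretation fin_digraph G by (rule fin)

lemma graph_polar_tendsto:
  assumes "\<And>e. e \<in> arcs G \<Longrightarrow> sn (q e) mu 1 \<noteq> 0"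
  shows "((\<lambda>lam. graph_polar G q lam \<phi> \<psi>) \<longlongrightarrow> graph_polar G q mu \<phi> \<psi>) (at mu)"
  unfolding graph_polar_def by (intro tendsto_sum edge_polar_tendsto q assms)

lemma below_spectrum_low: "\<forall>\<^sub>F lam in at_bot. below_spectrum G q lam"
proof -
  have "\<forall>\<^sub>F lam in at_bot. \<forall>e\<in>arcs G. (\<forall>x\<in>{0<..1}. 0 < sn (q e) lam x) \<and>
      (\<forall>a b. (a, b) \<noteq> (0, 0) \<longrightarrow> 0 < edge_form (q e) lam a b)"
    using edge_positive_low[OF q] by (intro eventually_ball_finite) auto
  then show ?thesis
  proof (rule eventually_mono)
    fix lam
    assume *: "\<forall>e\<in>arcs G. (\<forall>x\<in>{0<..1}. 0 < sn (q e) lam x) \<and>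
      (\<forall>a b. (a, b) \<noteq> (0, 0) \<longrightarrow> 0 < edge_form (q e) lam a b)"
    have "0 < graph_polar G q lam \<phi> \<phi>" if v: "v \<in> verts G" "\<phi> v \<noteq> 0" for \<phi> v
    proof -
      have nn: "0 \<le> edge_form (q e) lam a b" if "e \<in> arcs G" for e a b
        using * that by (cases "(a, b) = (0, 0)") (auto simp: edge_polar_def less_imp_le)
      obtain e where e: "e \<in> arcs G" "tail G e = v \<or> head G e = v" using incident[OF v(1)] by blast
      have "0 < edge_form (q e) lam (\<phi> (tail G e)) (\<phi> (head G e))" using * e v(2) by auto
      then show ?thesis unfolding graph_polar_def using nn e(1) by (intro sum_pos2[of _ e]) auto
    qed
    then show "below_spectrum G q lam" unfolding below_spectrum_def using * by blast
  qed
qed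

text \<open>If an edge reached its first Dirichlet eigenvalue at \<open>mu\<close>, its form at the
  constant 1 would tend to -infinity while the other edges stay bounded above by the constants
  \<open>K\<close>, contradicting positivity below \<open>mu\<close>. Without a pole the form is
  continuous at \<open>mu\<close> and its sign passes to the limit.\<close>

lemma below_spectrum_closed:
  assumes below: "\<And>lam. lam < mu \<Longrightarrow> below_spectrum G q lam" and arcs: "arcs G \<noteq> {}"
  shows "e \<in> arcs G \<Longrightarrow> x \<in> {0<..1} \<Longrightarrow> 0 < sn (q e) mu x"
    and "0 \<le> graph_polar G q mu \<phi> \<phi>"
proof -
  have pos: "0 < sn (q e) lam x" if "lam < mu" "e \<in> arcs G" "x \<in> {0<..1}" for lam e x
    using below[OF that(1)] that unfolding below_spectrum_def by blast
  have lt: "\<forall>\<^sub>F lam in at_left mu. lam < mu" by (simp add: eventually_at_filter)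
  have ne: "verts G \<noteq> {}" using arcs tail_in_verts by blast
  have nz: "sn (q e) mu 1 \<noteq> 0" if e: "e \<in> arcs G" for e
  proof
    assume e0: "sn (q e) mu 1 = 0"
    have "\<forall>e'\<in>arcs G. \<exists>K. \<forall>\<^sub>F lam in at_left mu. edge_form (q e') lam 1 1 \<le> K"
      using edge_form_at_left(2)[OF q pos] by blast
    then obtain K where K: "\<forall>e'\<in>arcs G. \<forall>\<^sub>F lam in at_left mu. edge_form (q e') lam 1 1 \<le> K e'"
      by metis
    have "\<forall>\<^sub>F lam in at_left mu. \<forall>e'\<in>arcs G. edge_form (q e') lam 1 1 \<le> K e'"
      using K by (intro eventually_ball_finite) auto
    moreover have "\<forall>\<^sub>F lam in at_left mu. edge_form (q e) lam 1 1 \<le> - (\<Sum>e'\<in>arcs G - {e}. K e')"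
      using edge_form_at_left(3)[OF q[OF e] pos e0] e by blast
    ultimately have "\<forall>\<^sub>F lam in at_left mu. False"
      using lt
    proof eventually_elim
      case (elim lam)
      have "0 < graph_polar G q lam (\<lambda>v. 1) (\<lambda>v. 1)"
        using below[OF elim(3)] ne unfolding below_spectrum_def by auto
      also have "\<dots> = edge_form (q e) lam 1 1 + (\<Sum>e'\<in>arcs G - {e}. edge_form (q e') lam 1 1)"
        unfolding graph_polar_def using e by (simp add: sum.remove)
      also have "\<dots> \<le> - (\<Sum>e'\<in>arcs G - {e}. K e') + (\<Sum>e'\<in>arcs G - {e}. K e')"
        using elim by (intro add_mono sum_mono) auto
      finally show False by simp
    qed
    then show False by simp
  qed
  show "0 < sn (q e) mu x" if e: "e \<in> arcs G" and x: "x \<in> {0<..1}"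
  proof -
    have nn: "0 \<le> sn (q e) mu t" if "t \<in> {0..1}" for t
      using edge_form_at_left(1)[OF q[OF e] pos[OF _ e] that] by blast
    show ?thesis
      using sn_nonneg_imp_pos(1)[OF q[OF e] nn, of x] nn[of 1] nz[OF e] x by (cases "x = 1") auto
  qed
  show "0 \<le> graph_polar G q mu \<phi> \<phi>"
  proof (cases "\<exists>v\<in>verts G. \<phi> v \<noteq> 0")
    case True
    have "((\<lambda>lam. graph_polar G q lam \<phi> \<phi>) \<longlongrightarrow> graph_polar G q mu \<phi> \<phi>) (at_left mu)"
      by (rule tendsto_mono[OF _ graph_polar_tendsto[OF nz]]) (auto intro: at_le)
    then show ?thesis
    proof (rule tendsto_lowerbound)
      show "\<forall>\<^sub>F lam in at_left mu. 0 \<le> graph_polar G q lam \<phi> \<phi>"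
        using lt
      proof eventually_elim
        case (elim lam)
        then show ?case using below[OF elim] True unfolding below_spectrum_def by (simp add: less_imp_le)
      qed
    qed simp
  next
    case False
    then show ?thesis unfolding graph_polar_def by (intro sum_nonneg) (auto simp: edge_polar_def)
  qed
qed

text \<open>The edgewise solutions with boundary values from \<open>\<phi>\<close> are continuous at
  the vertices by construction; testing the kernel condition with the indicator of a vertex gives
  Kirchhoff's condition there.\<close>

lemma eigenvalue_of_polar_kernel:
  assumes sn: "\<And>e. e \<in> arcs G \<Longrightarrow> sn (q e) mu 1 \<noteq> 0"
    and ker: "\<And>\<psi>. graph_polar G q mu \<phi> \<psi> = 0" and v: "v \<in> verts G" "\<phi> v \<noteq> 0"
  shows "is_eigenvalue G q mu"
proof -
  define y where "y = (\<lambda>e x. if e \<in> arcs G \<and> x \<in> {0..1} then bvp (q e) mu (\<phi> (tail G e)) (\<phi> (head G e)) x else 0)"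
  define dy where "dy = (\<lambda>e. dbvp (q e) mu (\<phi> (tail G e)) (\<phi> (head G e)))"
  have y01: "y e 0 = \<phi> (tail G e)" "y e 1 = \<phi> (head G e)" if "e \<in> arcs G" for e
    using bvp(2,3)[OF q[OF that] sn[OF that]] that by (auto simp: y_def)
  have "y \<in> eigenspace G q mu"
    unfolding eigenspace_def
  proof (intro CollectI conjI exI[of _ dy] ballI)
    show "\<forall>e x. e \<notin> arcs G \<or> x \<notin> {0..1} \<longrightarrow> y e x = 0" by (auto simp: y_def)
    show "sl_solution (q e) mu (y e) (dy e)" if e: "e \<in> arcs G" for e
      using bvp(1)[OF q[OF e] sn[OF e]] unfolding dy_def
      by (rule sl_solution_cong) (use e in \<open>auto simp: y_def\<close>)
    show "continuity_condition G y"
      unfolding continuity_condition_def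
      by (intro ballI) (use y01 in \<open>auto intro!: exI[of _ "\<phi> _"]\<close>)
    show "kirchhoff_condition G dy"
      unfolding kirchhoff_condition_def
    proof
      fix w assume "w \<in> verts G"
      define \<psi> where "\<psi> = (\<lambda>u. if u = w then 1 else 0 :: real)"
      have "0 = graph_polar G q mu \<phi> \<psi>" using ker by simp
      also have "\<dots> = (\<Sum>e\<in>arcs G. \<psi> (head G e) * dy e 1 - \<psi> (tail G e) * dy e 0)"
        unfolding graph_polar_def dy_def using bvp(4)[OF q sn] by (intro sum.cong) auto
      also have "\<dots> = (\<Sum>e\<in>arcs G. if head G e = w then dy e 1 else 0) - (\<Sum>e\<in>arcs G. if tail G e = w then dy e 0 else 0)"
        unfolding sum_subtractf[symmetric] by (intro sum.cong) (auto simp: \<psi>_def)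
      finally show "(\<Sum>e | e \<in> arcs G \<and> tail G e = w. dy e 0) = (\<Sum>e | e \<in> arcs G \<and> head G e = w. dy e 1)"
        by (simp add: sum.inter_filter)
    qed
  qed
  moreover obtain e where e: "e \<in> arcs G" "tail G e = v \<or> head G e = v" using incident[OF v(1)] by blast
  then have "y \<noteq> 0" using y01[OF e(1)] v(2) by (metis zero_fun_apply)
  ultimately show ?thesis unfolding is_eigenvalue_def by blast
qed

text \<open>If positivity failed arbitrarily close above \<open>mu\<close>, normalized vectors with
  nonpositive form would accumulate at a unit vector \<open>l\<close> on which the form at
  \<open>mu\<close> is 0. For a nonnegative form a null vector lies in the kernel, so
  \<open>mu\<close> would be an eigenvalue.\<close>

lemma below_spectrum_step:
  assumes below: "\<And>lam. lam < mu \<Longrightarrow> below_spectrum G q lam" and arcs: "arcs G \<noteq> {}"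
    and nev: "\<not> is_eigenvalue G q mu"
  shows "\<exists>d>0. \<forall>lam<mu + d. below_spectrum G q lam"
proof (rule ccontr)
  assume contr: "\<not> (\<exists>d>0. \<forall>lam<mu + d. below_spectrum G q lam)"
  have snpos: "0 < sn (q e) mu x" if "e \<in> arcs G" "x \<in> {0<..1}" for e x
    by (rule below_spectrum_closed(1)[where mu = mu]) (use below arcs that in auto)
  have nonneg: "0 \<le> graph_polar G q mu \<phi> \<phi>" for \<phi>
    by (rule below_spectrum_closed(2)[where mu = mu]) (use below arcs in auto)
  have nz: "sn (q e) mu 1 \<noteq> 0" if "e \<in> arcs G" for e using snpos[OF that, of 1] by simp
  have "\<forall>\<^sub>F lam in at mu. \<forall>e\<in>arcs G. \<forall>x\<in>{0<..1}. 0 < sn (q e) lam x"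
    using sn_positive_open[OF q snpos] by (intro eventually_ball_finite) auto
  then obtain d0 where d0: "0 < d0" "\<And>lam. \<bar>lam - mu\<bar> < d0 \<Longrightarrow> \<forall>e\<in>arcs G. \<forall>x\<in>{0<..1}. 0 < sn (q e) lam x"
  proof -
    from \<open>\<forall>\<^sub>F lam in at mu. _ lam\<close> obtain d0 where "0 < d0"
      and *: "\<And>lam. lam \<noteq> mu \<Longrightarrow> \<bar>lam - mu\<bar> < d0 \<Longrightarrow> \<forall>e\<in>arcs G. \<forall>x\<in>{0<..1}. 0 < sn (q e) lam x"
      unfolding eventually_at dist_real_def by auto
    have "\<forall>e\<in>arcs G. \<forall>x\<in>{0<..1}. 0 < sn (q e) lam x" if "\<bar>lam - mu\<bar> < d0" for lam
      using *[OF _ that] snpos by (cases "lam = mu") auto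
    with \<open>0 < d0\<close> show thesis by (rule that)
  qed
  have "\<exists>lam \<phi>. \<bar>lam - mu\<bar> < inverse (real (Suc n)) \<and> (\<Sum>v\<in>verts G. (\<phi> v)\<^sup>2) = 1 \<and> graph_polar G q lam \<phi> \<phi> \<le> 0" for n
  proof -
    define d where "d = min d0 (inverse (real (Suc n)))"
    have d: "0 < d" using d0(1) by (simp add: d_def)
    obtain lam where lam: "lam < mu + d" "\<not> below_spectrum G q lam"
      using contr d by blast
    then have "mu \<le> lam" using below by force
    then have near: "\<bar>lam - mu\<bar> < d" using lam by simp
    then have "\<forall>e\<in>arcs G. \<forall>x\<in>{0<..1}. 0 < sn (q e) lam x" using d0(2)[of lam] by (simp add: d_def)
    then obtain \<phi> v where \<phi>: "v \<in> verts G" "\<phi> v \<noteq> 0" "graph_polar G q lam \<phi> \<phi> \<le> 0"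
      using lam(2) unfolding below_spectrum_def by (auto simp: not_less)
    define N where "N = (\<Sum>v\<in>verts G. (\<phi> v)\<^sup>2)"
    have N: "0 < N" unfolding N_def using \<phi>(1,2) by (intro sum_pos2[of _ v]) auto
    have "(\<Sum>v\<in>verts G. (1 / sqrt N * \<phi> v)\<^sup>2) = (\<Sum>v\<in>verts G. (\<phi> v)\<^sup>2 / N)"
      using N by (intro sum.cong) (auto simp: power_divide power_mult_distrib)
    also have "\<dots> = 1" unfolding sum_divide_distrib[symmetric] N_def[symmetric] using N by simp
    finally have 1: "(\<Sum>v\<in>verts G. (1 / sqrt N * \<phi> v)\<^sup>2) = 1" .
    have "graph_polar G q lam (\<lambda>v. 1 / sqrt N * \<phi> v) (\<lambda>v. 1 / sqrt N * \<phi> v) \<le> 0"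
      unfolding graph_polar_scale using \<phi>(3) by (intro mult_nonneg_nonpos) auto
    then show ?thesis using 1 near by (intro exI[of _ lam] exI[of _ "\<lambda>v. 1 / sqrt N * \<phi> v"]) (auto simp: d_def)
  qed
  then obtain lam \<phi> where lam: "\<And>n. \<bar>lam n - mu\<bar> < inverse (real (Suc n))"
    and \<phi>: "\<And>n. (\<Sum>v\<in>verts G. (\<phi> n v)\<^sup>2) = 1" "\<And>n. graph_polar G q (lam n) (\<phi> n) (\<phi> n) \<le> 0"
    by metis
  have "\<bar>\<phi> n v\<bar> \<le> 1" if v: "v \<in> verts G" for n v
  proof -
    have "(\<phi> n v)\<^sup>2 \<le> (\<Sum>v\<in>verts G. (\<phi> n v)\<^sup>2)" using v by (intro member_le_sum) auto
    then show ?thesis using \<phi>(1)[of n] by (simp add: abs_square_le_1)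
  qed
  then have "\<exists>r l. strict_mono (r :: nat \<Rightarrow> nat) \<and> (\<forall>v\<in>verts G. (\<lambda>n. \<phi> (r n) v) \<longlonglongrightarrow> l v)"
    by (intro bounded_family_subseq[of "verts G" \<phi> 1]) auto
  then obtain r l where r: "strict_mono (r :: nat \<Rightarrow> nat)" "\<And>v. v \<in> verts G \<Longrightarrow> (\<lambda>n. \<phi> (r n) v) \<longlonglongrightarrow> l v"
    by blast
  have "(\<lambda>n. lam n - mu) \<longlonglongrightarrow> 0"
    by (rule Lim_null_comparison[OF _ LIMSEQ_inverse_real_of_nat]) (use lam in \<open>auto intro!: always_eventually less_imp_le\<close>)
  then have "(\<lambda>n. lam (r n) - mu) \<longlonglongrightarrow> 0"
    using LIMSEQ_subseq_LIMSEQ[OF _ r(1)] by (auto simp: comp_def)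
  then have lam_lim: "(\<lambda>n. lam (r n)) \<longlonglongrightarrow> mu" by (simp add: LIM_zero_iff)
  have comp: "(\<lambda>n. f (lam (r n))) \<longlonglongrightarrow> f mu" if "(f \<longlongrightarrow> f mu) (at mu)" for f :: "real \<Rightarrow> real"
    using isCont_tendsto_compose[OF _ lam_lim, of f] that by (simp add: isCont_def)
  have "(\<lambda>n. graph_polar G q (lam (r n)) (\<phi> (r n)) (\<phi> (r n))) \<longlonglongrightarrow> graph_polar G q mu l l"
    unfolding graph_polar_def edge_polar_def
    by (intro tendsto_intros comp fundamental_param_tendsto[OF q] r(2) nz) auto
  then have "graph_polar G q mu l l \<le> 0"
    by (rule LIMSEQ_le_const2) (use \<phi>(2) in blast)
  then have l0: "graph_polar G q mu l l = 0" using nonneg[of l] by auto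
  have "(\<lambda>n. \<Sum>v\<in>verts G. (\<phi> (r n) v)\<^sup>2) \<longlonglongrightarrow> (\<Sum>v\<in>verts G. (l v)\<^sup>2)"
    by (intro tendsto_intros r(2))
  then have "(\<Sum>v\<in>verts G. (l v)\<^sup>2) = 1" using \<phi>(1) by (simp add: LIMSEQ_const_iff)
  then obtain v where v: "v \<in> verts G" "l v \<noteq> 0" by (metis (no_types, lifting) power_zero_numeral sum.neutral zero_neq_one)
  have "graph_polar G q mu l \<psi> = 0" for \<psi>
  proof (rule quadratic_nonneg_imp_zero)
    fix t
    show "0 \<le> 2 * t * graph_polar G q mu l \<psi> + t\<^sup>2 * graph_polar G q mu \<psi> \<psi>"
      using nonneg[of "\<lambda>v. l v + t * \<psi> v"]
      unfolding graph_polar_add_scale l0 by simp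
  qed
  from eigenvalue_of_polar_kernel[OF nz this v] show False using nev by blast
qed

text \<open>Continuation in \<open>lam\<close> from -infinity. The set \<open>S\<close> is capped at
  0 so that it has a supremum, and a supremum below 0 could be pushed further by
  \<open>below_spectrum_step\<close>, negative numbers not being eigenvalues.\<close>

lemma below_spectrum_negative:
  assumes nev: "\<And>lam. lam < 0 \<Longrightarrow> \<not> is_eigenvalue G q lam" and arcs: "arcs G \<noteq> {}" and "lam < 0"
  shows "below_spectrum G q lam"
proof -
  define S where "S = {mu. mu \<le> 0 \<and> (\<forall>lam<mu. below_spectrum G q lam)}"
  obtain L where L: "\<And>lam. lam \<le> L \<Longrightarrow> below_spectrum G q lam"
    using below_spectrum_low unfolding eventually_at_bot_linorder by blast
  have S_ne: "min L 0 \<in> S" using L by (auto simp: S_def)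
  have bdd: "bdd_above S" by (rule bdd_aboveI[of _ 0]) (simp add: S_def)
  define mu where "mu = Sup S"
  have below: "below_spectrum G q lam" if lt: "lam < mu" for lam
  proof -
    obtain s where "s \<in> S" "lam < s"
      using lt less_cSup_iff[OF _ bdd, of lam] S_ne unfolding mu_def by blast
    then show ?thesis by (simp add: S_def)
  qed
  have "S \<noteq> {}" using S_ne by blast
  then have "mu \<le> 0" unfolding mu_def by (rule cSup_least) (simp add: S_def)
  have "mu = 0"
  proof (rule ccontr)
    assume "mu \<noteq> 0"
    then have "mu < 0" using \<open>mu \<le> 0\<close> by simp
    obtain d where d: "0 < d" "\<And>lam. lam < mu + d \<Longrightarrow> below_spectrum G q lam"
      using below_spectrum_step[where mu = mu] below arcs nev[OF \<open>mu < 0\<close>] by blast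
    have "min (mu + d) 0 \<in> S" using d(2) by (auto simp: S_def)
    then have "min (mu + d) 0 \<le> mu" unfolding mu_def using bdd by (rule cSup_upper)
    then show False using d(1) \<open>mu < 0\<close> by simp
  qed
  then show ?thesis using below \<open>lam < 0\<close> by simp
qed

text \<open>Strict positivity cannot be expected at the eigenvalue 0 itself; what survives the limit
  from below is nonnegativity of the form and positivity of \<open>sn\<close>. At the constant 1
  every edge contributes at most the integral of its potential, so a nonpositive total forces
  equality on each edge, the rigid case of \<open>integral_ge_edge_form\<close>.\<close>

theorem smallest_eigenvalue_zero_imp_potential_zero:
  assumes small: "is_smallest_eigenvalue G q 0" and arcs: "arcs G \<noteq> {}"
    and Q: "(\<Sum>e\<in>arcs G. integral {0..1} (q e)) \<le> 0" and e: "e \<in> arcs G"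
  shows "AE x\<in>{0<..<1} in lebesgue. q e x = 0"
proof -
  have below: "below_spectrum G q lam" if "lam < 0" for lam
    using below_spectrum_negative[OF _ arcs that] small unfolding is_smallest_eigenvalue_def by force
  have pos: "0 < sn (q e) 0 x" if "e \<in> arcs G" "x \<in> {0<..1}" for e x
    by (rule below_spectrum_closed(1)[where mu = 0]) (use below arcs that in auto)
  have nonneg: "0 \<le> graph_polar G q 0 \<phi> \<phi>" for \<phi>
    by (rule below_spectrum_closed(2)[where mu = 0]) (use below arcs in auto)
  have le: "edge_form (q e) 0 1 1 \<le> integral {0..1} (q e)" if "e \<in> arcs G" for e
    using integral_ge_edge_form(1)[OF q pos] that by blast
  have "0 \<le> graph_polar G q 0 (\<lambda>v. 1) (\<lambda>v. 1)" by (rule nonneg)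
  also have "\<dots> = (\<Sum>e\<in>arcs G. edge_form (q e) 0 1 1)" by (simp add: graph_polar_def)
  finally have "(\<Sum>e\<in>arcs G. integral {0..1} (q e) - edge_form (q e) 0 1 1) \<le> 0"
    using Q by (simp add: sum_subtractf)
  moreover have "0 \<le> (\<Sum>e\<in>arcs G. integral {0..1} (q e) - edge_form (q e) 0 1 1)"
    using le by (intro sum_nonneg) auto
  ultimately have "(\<Sum>e\<in>arcs G. integral {0..1} (q e) - edge_form (q e) 0 1 1) = 0" by simp
  then have "\<forall>e\<in>arcs G. integral {0..1} (q e) - edge_form (q e) 0 1 1 = 0"
    by (subst (asm) sum_nonneg_eq_0_iff) (auto simp: le)
  then have "edge_form (q e) 0 1 1 = integral {0..1} (q e)" using e by simp
  from integral_ge_edge_form(2)[OF q[OF e] pos[OF e] this] show ?thesis by blast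
qed

end


section \<open>Orthonormal families\<close>

text \<open>Vectors are functions of which only the values on the finite set \<open>J\<close> count.
  Arcs, or two copies of them, thereby serve directly as coordinates.\<close>

definition inner_on :: "'j set \<Rightarrow> ('j \<Rightarrow> real) \<Rightarrow> ('j \<Rightarrow> real) \<Rightarrow> real" where
  "inner_on J f g = (\<Sum>j\<in>J. f j * g j)"

definition orthonormal_on :: "'j set \<Rightarrow> 'i set \<Rightarrow> ('i \<Rightarrow> 'j \<Rightarrow> real) \<Rightarrow> bool" where
  "orthonormal_on J I u \<longleftrightarrow> (\<forall>i\<in>I. \<forall>k\<in>I. inner_on J (u i) (u k) = of_bool (i = k))"

lemma inner_on_commute: "inner_on J f g = inner_on J g f"
  by (simp add: inner_on_def mult.commute)

lemma inner_on_sum_left: "inner_on J (\<lambda>j. \<Sum>i\<in>I. c i * f i j) g = (\<Sum>i\<in>I. c i * inner_on J (f i) g)"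
  unfolding inner_on_def sum_distrib_left sum_distrib_right
  by (subst sum.swap) (simp add: mult.assoc)

lemma inner_on_diff_left: "inner_on J (\<lambda>j. f j - g j) h = inner_on J f h - inner_on J g h"
  by (simp add: inner_on_def left_diff_distrib sum_subtractf)

lemma inner_on_scale_left: "inner_on J (\<lambda>j. c * f j) g = c * inner_on J f g"
  by (simp add: inner_on_def sum_distrib_left mult.assoc)

text \<open>The result is a coefficient matrix rather than a list of vectors because the same
  combinations are later formed of other objects: of vertex potentials whose gradients are the
  \<open>x i\<close>, and of eigenfunctions whose initial data are the \<open>x i\<close>.\<close>

lemma gram_schmidt:
  fixes x :: "'i \<Rightarrow> 'j \<Rightarrow> real"
  assumes "finite I" and "finite J"
    and "\<And>c. (\<forall>j\<in>J. (\<Sum>i\<in>I. c i * x i j) = 0) \<Longrightarrow> \<forall>i\<in>I. c i = 0"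
  shows "\<exists>A. orthonormal_on J I (\<lambda>i j. \<Sum>l\<in>I. A i l * x l j)"
  using assms(1,3)
proof (induction I rule: finite_induct)
  case empty
  then show ?case by (simp add: orthonormal_on_def)
next
  case (insert k I)
  have "\<exists>A. orthonormal_on J I (\<lambda>i j. \<Sum>l\<in>I. A i l * x l j)"
  proof (rule insert.IH)
    fix c assume c: "\<forall>j\<in>J. (\<Sum>i\<in>I. c i * x i j) = 0"
    have "\<forall>i\<in>insert k I. (c(k := 0)) i = 0"
    proof (rule insert.prems, rule ballI)
      fix j assume "j \<in> J"
      have "(\<Sum>i\<in>I. (c(k := 0)) i * x i j) = (\<Sum>i\<in>I. c i * x i j)"
        using insert.hyps(2) by (intro sum.cong) auto
      then show "(\<Sum>i\<in>insert k I. (c(k := 0)) i * x i j) = 0"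
        using c \<open>j \<in> J\<close> insert.hyps by simp
    qed
    then show "\<forall>i\<in>I. c i = 0" using insert.hyps(2) by (metis fun_upd_other insertCI)
  qed
  then obtain A where A: "orthonormal_on J I (\<lambda>i j. \<Sum>l\<in>I. A i l * x l j)" by blast
  define u where "u = (\<lambda>i j. \<Sum>l\<in>I. A i l * x l j)"
  have u: "inner_on J (u i) (u i') = of_bool (i = i')" if "i \<in> I" "i' \<in> I" for i i'
    using A that by (simp add: orthonormal_on_def u_def)
  \<comment> \<open>The coefficients of \<open>x k\<close> minus its projection onto the span of the
    \<open>u i\<close>. The coefficient 1 at \<open>k\<close> is what linear independence
    contradicts if the difference \<open>v\<close> is null.\<close>
  define d where "d = (\<lambda>l. if l = k then 1 else - (\<Sum>i\<in>I. inner_on J (x k) (u i) * A i l))"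
  define v where "v = (\<lambda>j. \<Sum>l\<in>insert k I. d l * x l j)"
  have v: "v = (\<lambda>j. x k j - (\<Sum>i\<in>I. inner_on J (x k) (u i) * u i j))"
  proof
    fix j
    have "v j = x k j + (\<Sum>l\<in>I. d l * x l j)" using insert.hyps by (simp add: v_def d_def)
    also have "(\<Sum>l\<in>I. d l * x l j) = (\<Sum>l\<in>I. - (\<Sum>i\<in>I. inner_on J (x k) (u i) * A i l) * x l j)"
      using insert.hyps(2) by (intro sum.cong) (auto simp: d_def)
    also have "\<dots> = - (\<Sum>l\<in>I. \<Sum>i\<in>I. inner_on J (x k) (u i) * (A i l * x l j))"
      by (simp add: sum_distrib_right sum_negf mult.assoc)
    also have "\<dots> = - (\<Sum>i\<in>I. inner_on J (x k) (u i) * u i j)"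
      unfolding u_def sum_distrib_left by (subst sum.swap) simp
    finally show "v j = x k j - (\<Sum>i\<in>I. inner_on J (x k) (u i) * u i j)" by simp
  qed
  have vu: "inner_on J v (u i) = 0" if i: "i \<in> I" for i
  proof -
    have "inner_on J v (u i) = inner_on J (x k) (u i) - (\<Sum>i'\<in>I. inner_on J (x k) (u i') * of_bool (i' = i))"
      unfolding v inner_on_diff_left inner_on_sum_left using u i by (auto intro!: sum.cong)
    also have "\<dots> = 0" using insert.hyps(1) i by (simp add: of_bool_def if_distrib cong: if_cong)
    finally show ?thesis .
  qed
  define N where "N = inner_on J v v"
  have "N \<noteq> 0"
  proof
    assume "N = 0"
    then have "\<forall>j\<in>J. v j = 0"
      using assms(2) unfolding N_def inner_on_def by (simp add: sum_nonneg_eq_0_iff)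
    then have "\<forall>i\<in>insert k I. d i = 0" unfolding v_def by (intro insert.prems)
    then show False by (simp add: d_def)
  qed
  moreover have "0 \<le> N" unfolding N_def inner_on_def by (intro sum_nonneg) simp
  ultimately have N: "0 < N" by simp
  define B where "B = (\<lambda>i l. if i = k then d l / sqrt N else if l = k then 0 else A i l)"
  have Bk: "(\<lambda>j. \<Sum>l\<in>insert k I. B k l * x l j) = (\<lambda>j. 1 / sqrt N * v j)"
    unfolding v_def sum_distrib_left by (simp add: B_def)
  have Bi: "(\<lambda>j. \<Sum>l\<in>insert k I. B i l * x l j) = u i" if "i \<in> I" for i
    unfolding u_def using insert.hyps that by (auto simp: B_def intro!: ext sum.cong)
  have vv: "inner_on J (\<lambda>j. 1 / sqrt N * v j) (\<lambda>j. 1 / sqrt N * v j) = 1"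
  proof -
    have "inner_on J (\<lambda>j. c * v j) (\<lambda>j. c * v j) = c * (c * inner_on J v v)" for c
      by (simp add: inner_on_def sum_distrib_left mult_ac)
    from this[of "1 / sqrt N"] have "inner_on J (\<lambda>j. 1 / sqrt N * v j) (\<lambda>j. 1 / sqrt N * v j) = 1 / sqrt N * (1 / sqrt N * N)"
      by (simp only: N_def[symmetric])
    then show ?thesis using N by simp
  qed
  have "orthonormal_on J (insert k I) (\<lambda>i j. \<Sum>l\<in>insert k I. B i l * x l j)"
    unfolding orthonormal_on_def
  proof (intro ballI)
    fix i i' assume i: "i \<in> insert k I" "i' \<in> insert k I"
    consider "i = k" "i' = k" | "i = k" "i' \<in> I" "i' \<noteq> k" | "i \<in> I" "i' = k" "i \<noteq> k" | "i \<in> I" "i' \<in> I"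
      using i insert.hyps(2) by blast
    then show "inner_on J (\<lambda>j. \<Sum>l\<in>insert k I. B i l * x l j) (\<lambda>j. \<Sum>l\<in>insert k I. B i' l * x l j) = of_bool (i = i')"
    proof cases
      case 1 then show ?thesis unfolding 1 Bk using vv by simp
    next
      case 2
      show ?thesis unfolding 2(1) Bk Bi[OF 2(2)] inner_on_scale_left vu[OF 2(2)] using 2 by simp
    next
      case 3
      show ?thesis unfolding 3(2) Bk Bi[OF 3(1)] inner_on_commute[of J "u i"] inner_on_scale_left vu[OF 3(1)] using 3 by simp
    next
      case 4
      show ?thesis unfolding Bi[OF 4(1)] Bi[OF 4(2)] using u 4 by simp
    qed
  qed
  then show ?case by blast
qed

text \<open>Compare traces: \<open>\<Sum>\<^sub>j \<parallel>e\<^sub>j - P e\<^sub>j\<parallel>\<^sup>2 = card J - card I\<close> for the projection \<open>P\<close> onto the span.\<close>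

lemma orthonormal_on_defect:
  assumes "finite I" "finite J" and u: "orthonormal_on J I u"
  defines "D \<equiv> (\<lambda>j k. of_bool (j = k) - (\<Sum>i\<in>I. u i j * u i k))"
  shows "(\<Sum>j\<in>J. \<Sum>k\<in>J. (D j k)\<^sup>2) = real (card J) - real (card I)"
proof -
  have row: "(\<Sum>k\<in>J. (D j k)\<^sup>2) = 1 - (\<Sum>i\<in>I. (u i j)\<^sup>2)" if j: "j \<in> J" for j
  proof -
    let ?p = "\<lambda>k. \<Sum>i\<in>I. u i j * u i k"
    have pp: "inner_on J ?p ?p = (\<Sum>i\<in>I. (u i j)\<^sup>2)"
    proof -
      have "inner_on J ?p ?p = (\<Sum>i\<in>I. u i j * inner_on J ?p (u i))"
        unfolding inner_on_sum_left[of J "\<lambda>i. u i j" u I ?p] by (simp add: inner_on_commute)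
      also have "\<dots> = (\<Sum>i\<in>I. u i j * (\<Sum>i'\<in>I. u i' j * of_bool (i' = i)))"
        unfolding inner_on_sum_left using u by (intro sum.cong refl) (auto simp: orthonormal_on_def intro!: sum.cong)
      also have "\<dots> = (\<Sum>i\<in>I. (u i j)\<^sup>2)"
        using assms(1) by (intro sum.cong) (auto simp: of_bool_def if_distrib power2_eq_square cong: if_cong)
      finally show ?thesis .
    qed
    have "(\<Sum>k\<in>J. (D j k)\<^sup>2) = (\<Sum>k\<in>J. of_bool (j = k) - 2 * (of_bool (j = k) * ?p k) + ?p k * ?p k)"
      unfolding D_def by (intro sum.cong) (auto simp: power2_eq_square algebra_simps)
    also have "\<dots> = (\<Sum>k\<in>J. of_bool (j = k)) - 2 * (\<Sum>k\<in>J. of_bool (j = k) * ?p k) + inner_on J ?p ?p"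
      unfolding inner_on_def by (simp add: sum.distrib sum_subtractf sum_distrib_left)
    also have "(\<Sum>k\<in>J. of_bool (j = k) :: real) = 1" using assms(2) j by (simp add: of_bool_def)
    also have "(\<Sum>k\<in>J. of_bool (j = k) * ?p k) = ?p j"
      using assms(2) j by (simp add: of_bool_def if_distrib[of "\<lambda>c. c * _"] cong: if_cong)
    finally show ?thesis unfolding pp by (simp add: power2_eq_square)
  qed
  have "(\<Sum>j\<in>J. \<Sum>k\<in>J. (D j k)\<^sup>2) = (\<Sum>j\<in>J. 1 - (\<Sum>i\<in>I. (u i j)\<^sup>2))"
    using row by (intro sum.cong) auto
  also have "\<dots> = real (card J) - (\<Sum>i\<in>I. \<Sum>j\<in>J. (u i j)\<^sup>2)"
    by (simp add: sum_subtractf) (rule sum.swap)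
  also have "(\<Sum>i\<in>I. \<Sum>j\<in>J. (u i j)\<^sup>2) = (\<Sum>i\<in>I. 1)"
    using u by (intro sum.cong) (auto simp: orthonormal_on_def inner_on_def power2_eq_square)
  finally show ?thesis by simp
qed

lemma orthonormal_on_card_le:
  assumes "finite I" "finite J" "orthonormal_on J I u"
  shows "card I \<le> card J"
proof -
  have "0 \<le> real (card J) - real (card I)"
    unfolding orthonormal_on_defect[OF assms, symmetric] by (intro sum_nonneg) simp
  then show ?thesis by simp
qed

text \<open>A square matrix with orthonormal rows has orthonormal columns: the defect is a vanishing
  sum of squares.\<close>

lemma orthonormal_on_complete:
  assumes fin: "finite I" "finite J" and u: "orthonormal_on J I u" and card: "card I = card J"
    and jk: "j \<in> J" "k \<in> J"
  shows "(\<Sum>i\<in>I. u i j * u i k) = of_bool (j = k)"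
proof -
  let ?D = "\<lambda>j k. of_bool (j = k) - (\<Sum>i\<in>I. u i j * u i k)"
  have "(\<Sum>j\<in>J. \<Sum>k\<in>J. (?D j k)\<^sup>2) = 0"
    using orthonormal_on_defect[OF fin u] card by simp
  then have "(\<Sum>k\<in>J. (?D j k)\<^sup>2) = 0"
    using fin(2) jk(1) by (subst (asm) sum_nonneg_eq_0_iff) (auto intro: sum_nonneg)
  then have "(?D j k)\<^sup>2 = 0"
    using fin(2) jk(2) by (subst (asm) sum_nonneg_eq_0_iff) auto
  then show ?thesis by simp
qed


section \<open>Flows, gradients and effective resistance\<close>

text \<open>The circulations, that is, the cycle space of the graph. A loop counts on both sides and
  is unconstrained.\<close>

definition flow :: "('v, 'e) pre_digraph \<Rightarrow> ('e \<Rightarrow> real) \<Rightarrow> bool" where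
  "flow G b \<longleftrightarrow> (\<forall>v\<in>verts G. (\<Sum>e | e \<in> arcs G \<and> tail G e = v. b e) = (\<Sum>e | e \<in> arcs G \<and> head G e = v. b e))"

text \<open>Connectedness refers to the symmetric closure of the arcs, so the property must pass
  along an arc in both directions.\<close>

lemma connected_verts_induct:
  assumes wf: "wf_digraph G" and con: "Digraph_Component.connected G"
    and v0: "v0 \<in> verts G" "P v0"
    and step: "\<And>e. e \<in> arcs G \<Longrightarrow> P (tail G e) \<longleftrightarrow> P (head G e)"
    and v: "v \<in> verts G"
  shows "P v"
proof -
  interpret wf_digraph G by (rule wf)
  have "(v0, v) \<in> rtrancl_on (verts G) ((arcs_ends G)\<^sup>s)"
    using con v0(1) v unfolding connected_conv by blast
  then show ?thesis
  proof (induction rule: rtrancl_on_induct)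
    case (step a b)
    then obtain e where "e \<in> arcs G" "(a, b) = (tail G e, head G e) \<or> (b, a) = (tail G e, head G e)"
      unfolding symcl_def arcs_ends_conv by auto
    then show ?case using assms(5)[of e] step by auto
  qed (use v0 in auto)
qed

context
  fixes G :: "('v, 'e) pre_digraph"
  assumes fin: "fin_digraph G"
begin

interpretation fin_digraph G by (rule fin)

lemma sum_tail_group: "(\<Sum>e\<in>arcs G. (b e :: real) * \<phi> (tail G e)) = (\<Sum>v\<in>verts G. \<phi> v * (\<Sum>e | e \<in> arcs G \<and> tail G e = v. b e))"
proof -
  have "(\<Sum>e\<in>arcs G. b e * \<phi> (tail G e)) = (\<Sum>v\<in>verts G. \<Sum>e | e \<in> arcs G \<and> tail G e = v. b e * \<phi> (tail G e))"
    by (rule sum.group[symmetric]) auto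
  also have "\<dots> = (\<Sum>v\<in>verts G. \<phi> v * (\<Sum>e | e \<in> arcs G \<and> tail G e = v. b e))"
  proof (rule sum.cong[OF refl])
    fix v
    show "(\<Sum>e | e \<in> arcs G \<and> tail G e = v. b e * \<phi> (tail G e)) = \<phi> v * (\<Sum>e | e \<in> arcs G \<and> tail G e = v. b e)"
      unfolding sum_distrib_left by (rule sum.cong) auto
  qed
  finally show ?thesis .
qed

lemma sum_head_group: "(\<Sum>e\<in>arcs G. (b e :: real) * \<phi> (head G e)) = (\<Sum>v\<in>verts G. \<phi> v * (\<Sum>e | e \<in> arcs G \<and> head G e = v. b e))"
proof -
  have "(\<Sum>e\<in>arcs G. b e * \<phi> (head G e)) = (\<Sum>v\<in>verts G. \<Sum>e | e \<in> arcs G \<and> head G e = v. b e * \<phi> (head G e))"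
    by (rule sum.group[symmetric]) auto
  also have "\<dots> = (\<Sum>v\<in>verts G. \<phi> v * (\<Sum>e | e \<in> arcs G \<and> head G e = v. b e))"
  proof (rule sum.cong[OF refl])
    fix v
    show "(\<Sum>e | e \<in> arcs G \<and> head G e = v. b e * \<phi> (head G e)) = \<phi> v * (\<Sum>e | e \<in> arcs G \<and> head G e = v. b e)"
      unfolding sum_distrib_left by (rule sum.cong) auto
  qed
  finally show ?thesis .
qed

lemma flow_gradient_orthogonal:
  assumes "flow G b"
  shows "(\<Sum>e\<in>arcs G. b e * (\<phi> (head G e) - \<phi> (tail G e))) = 0"
  using assms unfolding right_diff_distrib sum_subtractf sum_head_group sum_tail_group flow_def
  by simp

lemma flow_loop: "e0 \<in> arcs G \<Longrightarrow> tail G e0 = head G e0 \<Longrightarrow> flow G (\<lambda>e. of_bool (e = e0))"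
  unfolding flow_def by (auto simp: of_bool_def)

text \<open>The difference of two unit current potentials has a gradient that is also a circulation.
  Circulations are orthogonal to gradients, so it is orthogonal to itself and vanishes; the
  description by \<open>THE\<close> is therefore well defined.\<close>

lemma edge_resistance_eq:
  assumes \<phi>: "unit_current_potential G (tail G e0) (head G e0) \<phi>" and e0: "e0 \<in> arcs G"
  shows "edge_resistance G e0 = \<phi> (tail G e0) - \<phi> (head G e0)"
  unfolding edge_resistance_def effective_resistance_def
proof (rule the_equality)
  show "\<exists>\<psi>. unit_current_potential G (tail G e0) (head G e0) \<psi> \<and>
      \<phi> (tail G e0) - \<phi> (head G e0) = \<psi> (tail G e0) - \<psi> (head G e0)"
    using \<phi> by blast
  fix r assume "\<exists>\<psi>. unit_current_potential G (tail G e0) (head G e0) \<psi> \<and> r = \<psi> (tail G e0) - \<psi> (head G e0)"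
  then obtain \<psi> where \<psi>: "unit_current_potential G (tail G e0) (head G e0) \<psi>" "r = \<psi> (tail G e0) - \<psi> (head G e0)"
    by blast
  define h where "h = (\<lambda>v. \<phi> v - \<psi> v)"
  define c where "c = (\<lambda>e. h (tail G e) - h (head G e))"
  have "flow G c"
    unfolding flow_def
  proof
    fix v assume "v \<in> verts G"
    then have "(\<Sum>e | e \<in> arcs G \<and> tail G e = v. \<phi> (tail G e) - \<phi> (head G e)) - (\<Sum>e | e \<in> arcs G \<and> head G e = v. \<phi> (tail G e) - \<phi> (head G e))
      = (\<Sum>e | e \<in> arcs G \<and> tail G e = v. \<psi> (tail G e) - \<psi> (head G e)) - (\<Sum>e | e \<in> arcs G \<and> head G e = v. \<psi> (tail G e) - \<psi> (head G e))"
      using \<phi> \<psi>(1) unfolding unit_current_potential_def by simp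
    moreover have split: "sum c S = (\<Sum>e\<in>S. \<phi> (tail G e) - \<phi> (head G e)) - (\<Sum>e\<in>S. \<psi> (tail G e) - \<psi> (head G e))" for S
      unfolding sum_subtractf[of "\<lambda>e. \<phi> (tail G e) - \<phi> (head G e)", symmetric]
      by (rule sum.cong) (auto simp: c_def h_def)
    ultimately show "(\<Sum>e | e \<in> arcs G \<and> tail G e = v. c e) = (\<Sum>e | e \<in> arcs G \<and> head G e = v. c e)"
      unfolding split by linarith
  qed
  from flow_gradient_orthogonal[OF this, of h] have "(\<Sum>e\<in>arcs G. (c e)\<^sup>2) = 0"
    by (simp add: c_def power2_eq_square algebra_simps sum_subtractf sum_negf[symmetric] sum.distrib)
  then have "c e0 = 0" using e0 by (simp add: sum_nonneg_eq_0_iff)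
  then show "r = \<phi> (tail G e0) - \<phi> (head G e0)" by (simp add: \<psi>(2) c_def h_def)
qed

text \<open>Gradients of vertex indicators are dependent only through the constants: a combination
  with zero gradient is constant on a connected graph. Leaving out \<open>v0\<close> makes that
  constant 0.\<close>

lemma orthonormal_gradients:
  assumes con: "Digraph_Component.connected G" and v0: "v0 \<in> verts G"
  obtains \<psi> where "orthonormal_on (arcs G) (verts G - {v0}) (\<lambda>v e. \<psi> v (head G e) - \<psi> v (tail G e))"
proof -
  let ?I = "verts G - {v0}"
  let ?x = "\<lambda>v e. of_bool (head G e = v) - of_bool (tail G e = v) :: real"
  have "\<exists>A. orthonormal_on (arcs G) ?I (\<lambda>i j. \<Sum>l\<in>?I. A i l * ?x l j)"
  proof (rule gram_schmidt)
    fix c assume c: "\<forall>e\<in>arcs G. (\<Sum>v\<in>?I. c v * ?x v e) = 0"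
    define \<phi> where "\<phi> = (\<lambda>w. \<Sum>v\<in>?I. c v * of_bool (w = v))"
    have eq: "\<phi> (head G e) = \<phi> (tail G e)" if "e \<in> arcs G" for e
      using c that by (simp add: \<phi>_def right_diff_distrib sum_subtractf)
    have "\<phi> v0 = 0" by (auto simp: \<phi>_def intro!: sum.neutral)
    then have "\<phi> v = 0" if "v \<in> verts G" for v
      using connected_verts_induct[OF _ con v0, of "\<lambda>v. \<phi> v = 0" v] eq that wf_digraph by simp
    moreover have "\<phi> v = c v" if "v \<in> ?I" for v
      using that by (simp add: \<phi>_def of_bool_def if_distrib cong: if_cong)
    ultimately show "\<forall>v\<in>?I. c v = 0" by simp
  qed auto
  then obtain A where A: "orthonormal_on (arcs G) ?I (\<lambda>i j. \<Sum>l\<in>?I. A i l * ?x l j)" by blast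
  show thesis
  proof (rule that)
    show "orthonormal_on (arcs G) ?I (\<lambda>v e. (\<lambda>w. \<Sum>l\<in>?I. A v l * of_bool (w = l)) (head G e) - (\<lambda>w. \<Sum>l\<in>?I. A v l * of_bool (w = l)) (tail G e))"
      using A by (simp add: right_diff_distrib sum_subtractf)
  qed
qed

lemma connected_card_le:
  assumes "Digraph_Component.connected G"
  shows "card (verts G) \<le> card (arcs G) + 1"
proof (cases "verts G = {}")
  case False
  then obtain v0 where v0: "v0 \<in> verts G" by blast
  obtain \<psi> where "orthonormal_on (arcs G) (verts G - {v0}) (\<lambda>v e. \<psi> v (head G e) - \<psi> v (tail G e))"
    using orthonormal_gradients[OF assms v0] by blast
  then have "card (verts G - {v0}) \<le> card (arcs G)" by (intro orthonormal_on_card_le) auto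
  then show ?thesis using v0 by simp
qed simp

text \<open>By the count of dimensions the circulations \<open>\<beta>\<close> and the gradients
  form a complete orthonormal system. The indicator of \<open>e0\<close> minus its circulation part
  is thus the potential difference of some \<open>\<phi>\<close>. Subtracting circulations does not
  change the net current at a vertex, so this difference still carries a unit current from tail to
  head of \<open>e0\<close>, and its value at \<open>e0\<close> is the effective resistance.\<close>

lemma orthonormal_flows_resistance:
  assumes con: "Digraph_Component.connected G" and I: "finite I" "card I + card (verts G) = card (arcs G) + 1"
    and \<beta>: "orthonormal_on (arcs G) I \<beta>" "\<And>i. i \<in> I \<Longrightarrow> flow G (\<beta> i)"
    and e0: "e0 \<in> arcs G"
  shows "(\<Sum>i\<in>I. (\<beta> i e0)\<^sup>2) = 1 - edge_resistance G e0"
    and "tail G e0 = head G e0 \<Longrightarrow> (\<Sum>i\<in>I. (\<beta> i e0)\<^sup>2) = 1"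
proof -
  have v0: "tail G e0 \<in> verts G" using e0 by simp
  let ?V = "verts G - {tail G e0}"
  obtain \<psi> where \<psi>: "orthonormal_on (arcs G) ?V (\<lambda>v e. \<psi> v (head G e) - \<psi> v (tail G e))"
    using orthonormal_gradients[OF con v0] by blast
  define u where "u = (\<lambda>s e. case s of Inl i \<Rightarrow> \<beta> i e | Inr v \<Rightarrow> \<psi> v (head G e) - \<psi> v (tail G e))"
  have u: "orthonormal_on (arcs G) (I <+> ?V) u"
    unfolding orthonormal_on_def
  proof (intro ballI)
    fix s t assume st: "s \<in> I <+> ?V" "t \<in> I <+> ?V"
    have mixed: "inner_on (arcs G) (\<beta> i) (\<lambda>e. \<psi> v (head G e) - \<psi> v (tail G e)) = 0" if "i \<in> I" for i v
      unfolding inner_on_def by (rule flow_gradient_orthogonal[OF \<beta>(2)[OF that]])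
    show "inner_on (arcs G) (u s) (u t) = of_bool (s = t)"
      using st \<beta>(1) \<psi> mixed mixed[unfolded inner_on_commute[of _ "\<beta> _"]]
      unfolding orthonormal_on_def u_def by auto
  qed
  have card: "card (I <+> ?V) = card (arcs G)"
  proof -
    have "card (verts G) \<ge> 1" using v0 by (metis One_nat_def Suc_leI card_gt_0_iff empty_iff finite_verts)
    then show ?thesis using I v0 by (simp add: card_Plus)
  qed
  \<comment> \<open>The sign turns gradients, taken as head minus tail, into potential drops from
    tail to head.\<close>
  define \<phi> where "\<phi> = (\<lambda>w. - (\<Sum>v\<in>?V. (\<psi> v (head G e0) - \<psi> v (tail G e0)) * \<psi> v w))"
  have eq: "of_bool (e = e0) - (\<Sum>i\<in>I. \<beta> i e0 * \<beta> i e) = \<phi> (tail G e) - \<phi> (head G e)" if e: "e \<in> arcs G" for e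
  proof -
    have "of_bool (e0 = e) = (\<Sum>s\<in>I <+> ?V. u s e0 * u s e)"
      using orthonormal_on_complete[OF _ _ u card e0 e] I(1) by simp
    also have "\<dots> = (\<Sum>i\<in>I. \<beta> i e0 * \<beta> i e) + (\<Sum>v\<in>?V. (\<psi> v (head G e0) - \<psi> v (tail G e0)) * (\<psi> v (head G e) - \<psi> v (tail G e)))"
      using I(1) by (simp add: sum.Plus u_def)
    also have "(\<Sum>v\<in>?V. (\<psi> v (head G e0) - \<psi> v (tail G e0)) * (\<psi> v (head G e) - \<psi> v (tail G e))) = \<phi> (tail G e) - \<phi> (head G e)"
      unfolding \<phi>_def by (simp add: right_diff_distrib[of "\<psi> _ _ - \<psi> _ _"] sum_subtractf)
    finally show ?thesis by (simp add: eq_commute)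
  qed
  have "unit_current_potential G (tail G e0) (head G e0) \<phi>"
    unfolding unit_current_potential_def
  proof
    fix v assume v: "v \<in> verts G"
    have t: "(\<Sum>e | e \<in> arcs G \<and> f e = v. \<phi> (tail G e) - \<phi> (head G e))
        = of_bool (v = f e0) - (\<Sum>i\<in>I. \<beta> i e0 * (\<Sum>e | e \<in> arcs G \<and> f e = v. \<beta> i e))" for f
    proof -
      have "(\<Sum>e | e \<in> arcs G \<and> f e = v. \<phi> (tail G e) - \<phi> (head G e))
        = (\<Sum>e | e \<in> arcs G \<and> f e = v. of_bool (e = e0) - (\<Sum>i\<in>I. \<beta> i e0 * \<beta> i e))"
        by (intro sum.cong) (auto simp: eq)
      also have "\<dots> = (\<Sum>e | e \<in> arcs G \<and> f e = v. of_bool (e = e0)) - (\<Sum>e | e \<in> arcs G \<and> f e = v. \<Sum>i\<in>I. \<beta> i e0 * \<beta> i e)"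
        by (rule sum_subtractf)
      also have "(\<Sum>e | e \<in> arcs G \<and> f e = v. of_bool (e = e0)) = (of_bool (v = f e0) :: real)"
        using e0 by (auto simp: of_bool_def)
      also have "(\<Sum>e | e \<in> arcs G \<and> f e = v. \<Sum>i\<in>I. \<beta> i e0 * \<beta> i e) = (\<Sum>i\<in>I. \<beta> i e0 * (\<Sum>e | e \<in> arcs G \<and> f e = v. \<beta> i e))"
        unfolding sum_distrib_left by (rule sum.swap)
      finally show ?thesis .
    qed
    have "(\<Sum>i\<in>I. \<beta> i e0 * (\<Sum>e | e \<in> arcs G \<and> tail G e = v. \<beta> i e)) = (\<Sum>i\<in>I. \<beta> i e0 * (\<Sum>e | e \<in> arcs G \<and> head G e = v. \<beta> i e))"
      using \<beta>(2) v unfolding flow_def by (intro sum.cong) auto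
    then show "(\<Sum>e | e \<in> arcs G \<and> tail G e = v. \<phi> (tail G e) - \<phi> (head G e))
        - (\<Sum>e | e \<in> arcs G \<and> head G e = v. \<phi> (tail G e) - \<phi> (head G e))
        = of_bool (v = tail G e0) - of_bool (v = head G e0)"
      unfolding t by simp
  qed
  from edge_resistance_eq[OF this e0]
  show "(\<Sum>i\<in>I. (\<beta> i e0)\<^sup>2) = 1 - edge_resistance G e0"
    using eq[OF e0] by (simp add: power2_eq_square)
  show "(\<Sum>i\<in>I. (\<beta> i e0)\<^sup>2) = 1" if "tail G e0 = head G e0"
    using eq[OF e0] that by (simp add: power2_eq_square)
qed

lemma weights_sum_zero:
  assumes con: "Digraph_Component.connected G" and I: "finite I" "card I + card (verts G) = card (arcs G) + 1"
    and \<beta>: "orthonormal_on (arcs G) I \<beta>" "\<And>i. i \<in> I \<Longrightarrow> flow G (\<beta> i)"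
    and Q: "\<And>i b. i \<in> I \<Longrightarrow> flow G b \<Longrightarrow> (\<Sum>e\<in>arcs G. Q e * \<beta> i e * b e) = 0"
    and r: "r < 1" "\<And>e. e \<in> arcs G \<Longrightarrow> nonloop G e \<Longrightarrow> edge_resistance G e = r"
  shows "(\<Sum>e\<in>arcs G. Q e) = 0"
proof -
  have weighted: "Q e * (\<Sum>i\<in>I. (\<beta> i e)\<^sup>2) = (1 - r) * Q e" if e: "e \<in> arcs G" for e
  proof (cases "nonloop G e")
    case True
    then show ?thesis using orthonormal_flows_resistance(1)[OF con I \<beta> e] r(2)[OF e] by simp
  next
    case False
    then have loop: "tail G e = head G e" by (simp add: nonloop_def)
    \<comment> \<open>Tested against the circulation around the loop itself. Since the squares of
      the \<open>\<beta> i e\<close> add up to 1 on a loop, \<open>Q e\<close> is 0 and the weighted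
      identity holds there whatever \<open>r\<close> is.\<close>
    have "Q e * \<beta> i e = 0" if "i \<in> I" for i
      using Q[OF that flow_loop[OF e loop]] e by (simp add: of_bool_def if_distrib cong: if_cong)
    then have "(\<Sum>i\<in>I. Q e * \<beta> i e * \<beta> i e) = 0" by (intro sum.neutral) auto
    then have "Q e * (\<Sum>i\<in>I. (\<beta> i e)\<^sup>2) = 0" by (simp add: sum_distrib_left power2_eq_square mult.assoc)
    then show ?thesis using orthonormal_flows_resistance(2)[OF con I \<beta> e loop] by simp
  qed
  have "(1 - r) * (\<Sum>e\<in>arcs G. Q e) = (\<Sum>e\<in>arcs G. (1 - r) * Q e)" by (rule sum_distrib_left)
  also have "\<dots> = (\<Sum>e\<in>arcs G. Q e * (\<Sum>i\<in>I. (\<beta> i e)\<^sup>2))"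
    by (rule sum.cong) (auto simp: weighted)
  also have "\<dots> = (\<Sum>i\<in>I. \<Sum>e\<in>arcs G. Q e * \<beta> i e * \<beta> i e)"
    unfolding sum_distrib_left by (subst sum.swap) (simp add: power2_eq_square mult.assoc)
  also have "\<dots> = 0" using Q \<beta>(2) by simp
  finally show ?thesis using r(1) by simp
qed

end


section \<open>Oscillatory integrals\<close>

text \<open>Measurability provides continuous functions \<open>h n\<close> converging almost
  everywhere, but without a dominating function. Clamping \<open>g\<close> and the
  \<open>h n\<close> at the same height \<open>k\<close> supplies one, and for large
  \<open>k\<close> clamping changes \<open>g\<close> little in the mean.\<close>

lemma L1_approx_continuous:
  fixes g :: "real \<Rightarrow> real"
  assumes g: "g absolutely_integrable_on {0..1}" and e: "0 < e"
  obtains h where "continuous_on {0..1} h" "integral {0..1} (\<lambda>x. \<bar>g x - h x\<bar>) < e"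
proof -
  define clamp where "clamp = (\<lambda>k x :: real. max (- k) (min k x))"
  have clamp_cont: "continuous_on A (\<lambda>x. clamp k (f x))" if "continuous_on A f" for A k and f :: "real \<Rightarrow> real"
    unfolding clamp_def by (intro continuous_intros that)
  have gi: "g integrable_on {0..1}" and agi: "(\<lambda>x. \<bar>g x\<bar>) integrable_on {0..1}"
    using g by (auto simp: absolutely_integrable_on_def)
  have "g \<in> borel_measurable (lebesgue_on {0..1})" using gi by (rule integrable_imp_measurable)
  then have "g measurable_on {0..1}" by (simp add: measurable_on_iff_borel_measurable)
  then obtain N h where N: "negligible N" and h: "\<And>n. continuous_on UNIV (h n)"
    and lim: "\<And>x. x \<notin> N \<Longrightarrow> (\<lambda>n. h n x) \<longlonglongrightarrow> (if x \<in> {0..1} then g x else 0)"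
    unfolding measurable_on_def by blast
  have cg: "(\<lambda>x. clamp (real k) (g x)) absolutely_integrable_on {0..1}" for k
  proof -
    have c: "(\<lambda>x :: real. c) absolutely_integrable_on {0..1}" for c :: real
      by (rule absolutely_integrable_continuous_real) (rule continuous_on_const)
    show ?thesis unfolding clamp_def
      by (intro absolutely_integrable_max_1 absolutely_integrable_min_1 c g)
  qed
  have "(\<lambda>k. integral {0..1} (\<lambda>x. \<bar>g x - clamp (real k) (g x)\<bar>)) \<longlonglongrightarrow> integral {0..1} (\<lambda>x :: real. 0 :: real)"
  proof (rule dominated_convergence(2)[OF _ agi])
    fix k
    have "(\<lambda>x. g x - clamp (real k) (g x)) absolutely_integrable_on {0..1}"
      by (intro set_integral_diff g cg)
    then show "(\<lambda>x. \<bar>g x - clamp (real k) (g x)\<bar>) integrable_on {0..1}"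
      by (simp add: absolutely_integrable_on_def)
    show "norm \<bar>g x - clamp (real k) (g x)\<bar> \<le> \<bar>g x\<bar>" for x
      by (auto simp: clamp_def)
  next
    fix x
    obtain n0 :: nat where n0: "\<bar>g x\<bar> \<le> real n0" using real_arch_simple by blast
    show "(\<lambda>k. \<bar>g x - clamp (real k) (g x)\<bar>) \<longlonglongrightarrow> 0"
    proof (rule tendsto_eventually)
      show "\<forall>\<^sub>F k in sequentially. \<bar>g x - clamp (real k) (g x)\<bar> = 0"
        unfolding eventually_sequentially
      proof (intro exI[of _ n0] allI impI)
        fix k assume "n0 \<le> k"
        then have "\<bar>g x\<bar> \<le> real k" using n0 by (meson of_nat_mono order_trans)
        then show "\<bar>g x - clamp (real k) (g x)\<bar> = 0" by (auto simp: clamp_def)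
      qed
    qed
  qed
  then have "(\<lambda>k. integral {0..1} (\<lambda>x. \<bar>g x - clamp (real k) (g x)\<bar>)) \<longlonglongrightarrow> 0" by simp
  then have "\<forall>\<^sub>F k in sequentially. integral {0..1} (\<lambda>x. \<bar>g x - clamp (real k) (g x)\<bar>) < e / 2"
    using e by (intro order_tendstoD) auto
  then obtain k where k: "integral {0..1} (\<lambda>x. \<bar>g x - clamp (real k) (g x)\<bar>) < e / 2"
    unfolding eventually_sequentially by blast
  let ?c = "clamp (real k)"
  have di: "(\<lambda>x. \<bar>?c (g x) - ?c (h n x)\<bar>) integrable_on {0..1}" for n
  proof -
    have "continuous_on {0..1} (\<lambda>x. ?c (h n x))"
      by (rule clamp_cont) (rule continuous_on_subset[OF h subset_UNIV])
    then have "(\<lambda>x. ?c (h n x)) absolutely_integrable_on {0..1}" by (rule absolutely_integrable_continuous_real)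
    from set_integral_diff(1)[OF cg this] show ?thesis by (simp add: absolutely_integrable_on_def)
  qed
  define f where "f = (\<lambda>n x. if x \<in> N then 0 else \<bar>?c (g x) - ?c (h n x)\<bar>)"
  have "(\<lambda>n. integral {0..1} (f n)) \<longlonglongrightarrow> integral {0..1} (\<lambda>x :: real. 0 :: real)"
  proof (rule dominated_convergence(2))
    show "f n integrable_on {0..1}" for n
      by (rule integrable_spike[OF di N]) (simp add: f_def)
    show "(\<lambda>x :: real. 2 * real k) integrable_on {0..1}" by (rule integrable_const_ivl)
    show "norm (f n x) \<le> 2 * real k" for n x by (auto simp: f_def clamp_def)
    fix x :: real assume x: "x \<in> {0..1}"
    show "(\<lambda>n. f n x) \<longlonglongrightarrow> 0"
    proof (cases "x \<in> N")
      case False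
      have "(\<lambda>n. \<bar>?c (g x) - ?c (h n x)\<bar>) \<longlonglongrightarrow> \<bar>?c (g x) - ?c (g x)\<bar>"
        unfolding clamp_def using lim[OF False] x by (intro tendsto_intros) auto
      then show ?thesis using False by (simp add: f_def)
    qed (simp add: f_def)
  qed
  moreover have "integral {0..1} (f n) = integral {0..1} (\<lambda>x. \<bar>?c (g x) - ?c (h n x)\<bar>)" for n
    by (rule integral_spike[OF N]) (simp add: f_def)
  ultimately have "(\<lambda>n. integral {0..1} (\<lambda>x. \<bar>?c (g x) - ?c (h n x)\<bar>)) \<longlonglongrightarrow> 0" by simp
  then have "\<forall>\<^sub>F n in sequentially. integral {0..1} (\<lambda>x. \<bar>?c (g x) - ?c (h n x)\<bar>) < e / 2"
    using e by (intro order_tendstoD) auto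
  then obtain n where n: "integral {0..1} (\<lambda>x. \<bar>?c (g x) - ?c (h n x)\<bar>) < e / 2"
    unfolding eventually_sequentially by blast
  show thesis
  proof (rule that)
    show c: "continuous_on {0..1} (\<lambda>x. ?c (h n x))"
      by (rule clamp_cont) (rule continuous_on_subset[OF h subset_UNIV])
    have i1: "(\<lambda>x. \<bar>g x - ?c (g x)\<bar>) integrable_on {0..1}"
      using set_integral_diff(1)[OF g cg] by (simp add: absolutely_integrable_on_def)
    have i2: "(\<lambda>x. \<bar>g x - ?c (h n x)\<bar>) integrable_on {0..1}"
      using set_integral_diff(1)[OF g absolutely_integrable_continuous_real[OF c]] by (simp add: absolutely_integrable_on_def)
    have "integral {0..1} (\<lambda>x. \<bar>g x - ?c (h n x)\<bar>) \<le> integral {0..1} (\<lambda>x. \<bar>g x - ?c (g x)\<bar> + \<bar>?c (g x) - ?c (h n x)\<bar>)"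
      by (intro integral_le i2 integrable_add i1 di) auto
    also have "\<dots> < e" using k n by (simp add: integral_add[OF i1 di])
    finally show "integral {0..1} (\<lambda>x. \<bar>g x - ?c (h n x)\<bar>) < e" .
  qed
qed

text \<open>Polynomials are dense in L^1 and can be integrated by parts, which gains
  \<open>1 / w\<close>; the error of approximation is uniform in the frequency. The phase
  \<open>c\<close> treats sine and cosine at once.\<close>

lemma riemann_lebesgue:
  fixes g :: "real \<Rightarrow> real"
  assumes g: "g absolutely_integrable_on {0..1}" and s: "filterlim s at_top F"
  shows "((\<lambda>n. integral {0..1} (\<lambda>t. g t * cos (s n * t + c))) \<longlongrightarrow> 0) F"
proof (rule tendstoI)
  fix e :: real assume e: "0 < e"
  obtain h where h: "continuous_on {0..1} h" "integral {0..1} (\<lambda>x. \<bar>g x - h x\<bar>) < e / 4"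
    using L1_approx_continuous[OF g, of "e / 4"] e by auto
  obtain p where p: "real_polynomial_function p" "\<And>x. x \<in> {0..1} \<Longrightarrow> \<bar>h x - p x\<bar> < e / 4"
    using Stone_Weierstrass_real_polynomial_function[OF compact_Icc h(1), of "e / 4"] e by auto
  obtain p' where p': "real_polynomial_function p'" "\<And>x. (p has_real_derivative p' x) (at x)"
    using has_real_derivative_polynomial_function[OF p(1)] by blast
  have pc: "continuous_on A p" "continuous_on A p'" for A
    using p(1) p'(1) by (simp_all add: continuous_on_polymonial_function real_polynomial_function_eq)
  obtain B where B: "\<And>x. x \<in> {0..1} \<Longrightarrow> \<bar>p' x\<bar> \<le> B"
    using continuous_on_interval_bounded[OF pc(2)] by blast
  define K where "K = \<bar>p 1\<bar> + \<bar>p 0\<bar> + B"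
  have cosc: "continuous_on A (\<lambda>t. cos (w * t + c))" and sinc: "continuous_on A (\<lambda>t. sin (w * t + c))" for A w
    by (intro continuous_intros)+
  have poly: "\<bar>integral {0..1} (\<lambda>t. p t * cos (w * t + c))\<bar> \<le> K / w" if w: "0 < w" for w
  proof -
    have hi: "((\<lambda>t. p' t * (sin (w * t + c) / w) + p t * cos (w * t + c)) has_integral
        p 1 * (sin (w * 1 + c) / w) - p 0 * (sin (w * 0 + c) / w)) {0..1}"
    proof (rule fundamental_theorem_of_calculus)
      fix x :: real
      have "((\<lambda>t. p t * (sin (w * t + c) / w)) has_real_derivative p' x * (sin (w * x + c) / w) + p x * cos (w * x + c)) (at x)"
        using w by (auto intro!: derivative_eq_intros p'(2) simp: field_simps)
      then show "((\<lambda>t. p t * (sin (w * t + c) / w)) has_vector_derivative p' x * (sin (w * x + c) / w) + p x * cos (w * x + c)) (at x within {0..1})"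
        using has_real_derivative_iff_has_vector_derivative has_vector_derivative_at_within by blast
    qed simp
    have i: "(\<lambda>t. p' t * (sin (w * t + c) / w)) integrable_on {0..1}" "(\<lambda>t. p t * cos (w * t + c)) integrable_on {0..1}"
      using w by (auto intro!: integrable_continuous_interval continuous_intros pc)
    have eq: "integral {0..1} (\<lambda>t. p t * cos (w * t + c))
      = p 1 * (sin (w * 1 + c) / w) - p 0 * (sin (w * 0 + c) / w) - integral {0..1} (\<lambda>t. p' t * (sin (w * t + c) / w))"
      using integral_unique[OF hi] unfolding integral_add[OF i] by linarith
    have sw: "\<bar>a * (sin x / w)\<bar> \<le> \<bar>a\<bar> / w" for a x
      using w mult_left_mono[OF abs_sin_le_one[of x], of "\<bar>a\<bar>"] by (simp add: abs_mult divide_right_mono)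
    have "norm (integral {0..1} (\<lambda>t. p' t * (sin (w * t + c) / w))) \<le> integral {0..1} (\<lambda>t :: real. B / w)"
    proof (rule integral_norm_bound_integral[OF i(1)])
      fix t :: real assume "t \<in> {0..1}"
      then show "norm (p' t * (sin (w * t + c) / w)) \<le> B / w"
        using sw[of "p' t" "w * t + c"] divide_right_mono[OF B[of t], of w] w by simp
    qed (rule integrable_const_ivl)
    then have "\<bar>integral {0..1} (\<lambda>t. p' t * (sin (w * t + c) / w))\<bar> \<le> B / w" by simp
    then show ?thesis
      using sw[of "p 1" "w * 1 + c"] sw[of "p 0" "w * 0 + c"] unfolding eq K_def add_divide_distrib by linarith
  qed
  have diff: "\<bar>integral {0..1} (\<lambda>t. g t * cos (w * t + c)) - integral {0..1} (\<lambda>t. p t * cos (w * t + c))\<bar> < e / 2" for w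
  proof -
    have gc: "(\<lambda>t. g t * cos (w * t + c)) integrable_on {0..1}"
      using absolutely_integrable_mult_continuous[OF g cosc] by (simp add: absolutely_integrable_on_def)
    have pci: "(\<lambda>t. p t * cos (w * t + c)) integrable_on {0..1}"
      by (intro integrable_continuous_interval continuous_intros pc)
    have ghi: "(\<lambda>x. \<bar>g x - h x\<bar>) integrable_on {0..1}"
      using set_integral_diff(1)[OF g absolutely_integrable_continuous_real[OF h(1)]] by (simp add: absolutely_integrable_on_def)
    have "norm (integral {0..1} (\<lambda>t. g t * cos (w * t + c) - p t * cos (w * t + c))) \<le> integral {0..1} (\<lambda>t. \<bar>g t - h t\<bar> + e / 4)"
    proof (rule integral_norm_bound_integral)
      fix t :: real assume t: "t \<in> {0..1}"
      have "\<bar>g t - p t\<bar> * \<bar>cos (w * t + c)\<bar> \<le> \<bar>g t - p t\<bar> * 1" by (intro mult_left_mono) auto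
      also have "\<dots> \<le> \<bar>g t - h t\<bar> + e / 4" using p(2)[OF t] abs_triangle_ineq[of "g t - h t" "h t - p t"] by simp
      finally show "norm (g t * cos (w * t + c) - p t * cos (w * t + c)) \<le> \<bar>g t - h t\<bar> + e / 4"
        by (simp add: left_diff_distrib[symmetric] abs_mult)
    qed (intro integrable_diff gc pci integrable_add ghi integrable_const_ivl)+
    also have "\<dots> = integral {0..1} (\<lambda>t. \<bar>g t - h t\<bar>) + e / 4"
      by (subst integral_add[OF ghi integrable_const_ivl]) simp
    finally show ?thesis using h(2) by (simp add: integral_diff[OF gc pci])
  qed
  have "((\<lambda>n. K / s n) \<longlongrightarrow> 0) F"
    using s by (intro tendsto_divide_0[OF tendsto_const] filterlim_at_top_imp_at_infinity)
  then have "\<forall>\<^sub>F n in F. K / s n < e / 2" using e by (intro order_tendstoD) auto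
  moreover have "\<forall>\<^sub>F n in F. 0 < s n" using s unfolding filterlim_at_top_dense by blast
  ultimately show "\<forall>\<^sub>F n in F. dist (integral {0..1} (\<lambda>t. g t * cos (s n * t + c))) 0 < e"
  proof eventually_elim
    case (elim n)
    have "\<bar>integral {0..1} (\<lambda>t. g t * cos (s n * t + c))\<bar> < e"
      using elim(1) poly[OF elim(2)] diff[of "s n"] by linarith
    then show ?case by (simp add: dist_real_def)
  qed
qed

text \<open>Products of trigonometric functions of frequency \<open>w\<close> split into means, 1/2
  for each square and 0 for the mixed product, and terms of frequency \<open>2 * w\<close>, which
  vanish by \<open>riemann_lebesgue\<close>. The phase \<open>- (pi / 2)\<close> produces the sine
  of the double angle.\<close>

lemma oscillating_product_limit:
  fixes u v :: "nat \<Rightarrow> real \<Rightarrow> real"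
  assumes g: "g absolutely_integrable_on {0..1}" and w: "filterlim w at_top sequentially"
    and lim: "a \<longlonglongrightarrow> a0" "b \<longlonglongrightarrow> b0" "c \<longlonglongrightarrow> c0" "d \<longlonglongrightarrow> d0" "r \<longlonglongrightarrow> 0" "s \<longlonglongrightarrow> 0"
    and cont: "\<And>n. continuous_on {0..1} (u n)" "\<And>n. continuous_on {0..1} (v n)"
    and u: "\<forall>\<^sub>F n in sequentially. \<forall>t\<in>{0..1}. \<bar>u n t - (a n * cos (w n * t) + b n * sin (w n * t))\<bar> \<le> r n"
    and v: "\<forall>\<^sub>F n in sequentially. \<forall>t\<in>{0..1}. \<bar>v n t - (c n * cos (w n * t) + d n * sin (w n * t))\<bar> \<le> s n"
  shows "(\<lambda>n. integral {0..1} (\<lambda>t. g t * (u n t * v n t))) \<longlonglongrightarrow> (a0 * c0 + b0 * d0) / 2 * integral {0..1} g"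
proof -
  define U where "U = (\<lambda>n t. a n * cos (w n * t) + b n * sin (w n * t))"
  define V where "V = (\<lambda>n t. c n * cos (w n * t) + d n * sin (w n * t))"
  have UVc: "continuous_on {0..1} (U n)" "continuous_on {0..1} (V n)" for n
    unfolding U_def V_def by (intro continuous_intros)+
  have gm: "(\<lambda>t. g t * f t) integrable_on {0..1}" if "continuous_on {0..1} f" for f
    using absolutely_integrable_mult_continuous[OF g that] by (simp add: absolutely_integrable_on_def)
  have gi: "g integrable_on {0..1}" and agi: "(\<lambda>t. \<bar>g t\<bar>) integrable_on {0..1}"
    using g by (simp_all add: absolutely_integrable_on_def)
  have w2: "filterlim (\<lambda>n. 2 * w n) at_top sequentially"
    by (rule filterlim_tendsto_pos_mult_at_top[OF tendsto_const _ w]) simp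
  note RLc = riemann_lebesgue[OF g w2, of 0]
  note RLs = riemann_lebesgue[OF g w2, of "- (pi / 2)"]
  have UV: "integral {0..1} (\<lambda>t. g t * (U n t * V n t)) = (a n * c n + b n * d n) / 2 * integral {0..1} g
      + (a n * c n - b n * d n) / 2 * integral {0..1} (\<lambda>t. g t * cos (2 * w n * t + 0))
      + (a n * d n + b n * c n) / 2 * integral {0..1} (\<lambda>t. g t * cos (2 * w n * t + - (pi / 2)))" for n
  proof -
    have cc: "continuous_on {0..1} (\<lambda>t. cos (2 * w n * t + x))" for x by (intro continuous_intros)
    have "g t * (U n t * V n t) = ((a n * c n + b n * d n) / 2 * g t
      + (a n * c n - b n * d n) / 2 * (g t * cos (2 * w n * t + 0)))
      + (a n * d n + b n * c n) / 2 * (g t * cos (2 * w n * t + - (pi / 2)))" for t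
    proof -
      have 1: "cos (2 * w n * t + 0) = 2 * (cos (w n * t))\<^sup>2 - 1"
        using cos_double_cos[of "w n * t"] by (simp add: mult.assoc)
      have 2: "cos (2 * w n * t + - (pi / 2)) = 2 * sin (w n * t) * cos (w n * t)"
        using sin_double[of "w n * t"] by (simp add: mult.assoc cos_sin_eq[of "_ - _"] cos_diff)
      have 3: "sin (w n * t) * sin (w n * t) = 1 - (cos (w n * t))\<^sup>2"
        using sin_squared_eq[of "w n * t"] by (simp add: power2_eq_square)
      have UVeq: "U n t * V n t = a n * c n * (cos (w n * t))\<^sup>2 + (a n * d n + b n * c n) * (sin (w n * t) * cos (w n * t))
          + b n * d n * (sin (w n * t) * sin (w n * t))"
        by (simp add: U_def V_def algebra_simps power2_eq_square)
      show ?thesis unfolding UVeq 1 2 3 by (simp add: field_simps)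
    qed
    moreover have "integral {0..1} (\<lambda>t. ((a n * c n + b n * d n) / 2 * g t
      + (a n * c n - b n * d n) / 2 * (g t * cos (2 * w n * t + 0)))
      + (a n * d n + b n * c n) / 2 * (g t * cos (2 * w n * t + - (pi / 2)))) =
      (a n * c n + b n * d n) / 2 * integral {0..1} g
      + (a n * c n - b n * d n) / 2 * integral {0..1} (\<lambda>t. g t * cos (2 * w n * t + 0))
      + (a n * d n + b n * c n) / 2 * integral {0..1} (\<lambda>t. g t * cos (2 * w n * t + - (pi / 2)))"
      by (rule integral_unique, intro has_integral_add has_integral_mult_right integrable_integral gi gm cc)
    ultimately show ?thesis by simp
  qed
  have limUV: "(\<lambda>n. integral {0..1} (\<lambda>t. g t * (U n t * V n t))) \<longlonglongrightarrow>
      (a0 * c0 + b0 * d0) / 2 * integral {0..1} g + (a0 * c0 - b0 * d0) / 2 * 0 + (a0 * d0 + b0 * c0) / 2 * 0"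
    unfolding UV by (intro tendsto_intros lim RLc RLs) auto
  \<comment> \<open>Bounds \<open>\<bar>u - U\<bar> * \<bar>v\<bar> + \<bar>U\<bar> * \<bar>v -
    V\<bar>\<close>, where \<open>\<bar>v\<bar>\<close> is at most its trigonometric part plus the
    remainder \<open>s n\<close>.\<close>
  define E where "E = (\<lambda>n. r n * (\<bar>c n\<bar> + \<bar>d n\<bar> + s n) + (\<bar>a n\<bar> + \<bar>b n\<bar>) * s n)"
  have "E \<longlonglongrightarrow> 0 * (\<bar>c0\<bar> + \<bar>d0\<bar> + 0) + (\<bar>a0\<bar> + \<bar>b0\<bar>) * 0"
    unfolding E_def by (intro tendsto_intros lim)
  then have "(\<lambda>n. E n * integral {0..1} (\<lambda>t. \<bar>g t\<bar>)) \<longlonglongrightarrow> (0 * (\<bar>c0\<bar> + \<bar>d0\<bar> + 0) + (\<bar>a0\<bar> + \<bar>b0\<bar>) * 0) * integral {0..1} (\<lambda>t. \<bar>g t\<bar>)"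
    by (intro tendsto_intros)
  then have Elim: "(\<lambda>n. E n * integral {0..1} (\<lambda>t. \<bar>g t\<bar>)) \<longlonglongrightarrow> 0" by simp
  have trig: "\<bar>x * cos z + y * sin z\<bar> \<le> \<bar>x\<bar> + \<bar>y\<bar>" for x y z :: real
    using mult_left_mono[OF abs_cos_le_one[of z], of "\<bar>x\<bar>"] mult_left_mono[OF abs_sin_le_one[of z], of "\<bar>y\<bar>"]
      abs_triangle_ineq[of "x * cos z" "y * sin z"] by (simp add: abs_mult)
  have "(\<lambda>n. integral {0..1} (\<lambda>t. g t * (u n t * v n t)) - integral {0..1} (\<lambda>t. g t * (U n t * V n t))) \<longlonglongrightarrow> 0"
  proof (rule Lim_null_comparison[OF _ Elim])
    show "\<forall>\<^sub>F n in sequentially. norm (integral {0..1} (\<lambda>t. g t * (u n t * v n t)) - integral {0..1} (\<lambda>t. g t * (U n t * V n t)))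
        \<le> E n * integral {0..1} (\<lambda>t. \<bar>g t\<bar>)"
      using u v
    proof eventually_elim
      case (elim n)
      have i: "(\<lambda>t. g t * (u n t * v n t)) integrable_on {0..1}" "(\<lambda>t. g t * (U n t * V n t)) integrable_on {0..1}"
        by (intro gm continuous_intros cont UVc)+
      have "norm (integral {0..1} (\<lambda>t. g t * (u n t * v n t) - g t * (U n t * V n t))) \<le> integral {0..1} (\<lambda>t. E n * \<bar>g t\<bar>)"
      proof (rule integral_norm_bound_integral)
        show "(\<lambda>t. g t * (u n t * v n t) - g t * (U n t * V n t)) integrable_on {0..1}"
          by (rule integrable_diff[OF i])
        show "(\<lambda>t. E n * \<bar>g t\<bar>) integrable_on {0..1}" by (rule integrable_on_mult_right[OF agi])
        fix t :: real assume t: "t \<in> {0..1}"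
        have du: "\<bar>u n t - U n t\<bar> \<le> r n" and dv: "\<bar>v n t - V n t\<bar> \<le> s n" using elim t by (auto simp: U_def V_def)
        have "\<bar>V n t\<bar> \<le> \<bar>c n\<bar> + \<bar>d n\<bar>" "\<bar>U n t\<bar> \<le> \<bar>a n\<bar> + \<bar>b n\<bar>" unfolding U_def V_def by (rule trig)+
        then have "\<bar>v n t\<bar> \<le> \<bar>c n\<bar> + \<bar>d n\<bar> + s n" and UB: "\<bar>U n t\<bar> \<le> \<bar>a n\<bar> + \<bar>b n\<bar>"
          using dv abs_triangle_ineq[of "V n t" "v n t - V n t"] by auto
        then have "\<bar>u n t - U n t\<bar> * \<bar>v n t\<bar> \<le> r n * (\<bar>c n\<bar> + \<bar>d n\<bar> + s n)"
          using du by (intro mult_mono) auto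
        moreover have "\<bar>U n t\<bar> * \<bar>v n t - V n t\<bar> \<le> (\<bar>a n\<bar> + \<bar>b n\<bar>) * s n"
          using dv UB by (intro mult_mono) auto
        moreover have "u n t * v n t - U n t * V n t = (u n t - U n t) * v n t + U n t * (v n t - V n t)"
          by (simp add: algebra_simps)
        ultimately have "\<bar>u n t * v n t - U n t * V n t\<bar> \<le> E n"
          unfolding E_def using abs_triangle_ineq[of "(u n t - U n t) * v n t" "U n t * (v n t - V n t)"]
          by (simp add: abs_mult)
        then have "\<bar>g t\<bar> * \<bar>u n t * v n t - U n t * V n t\<bar> \<le> \<bar>g t\<bar> * E n" by (intro mult_left_mono) auto
        then show "norm (g t * (u n t * v n t) - g t * (U n t * V n t)) \<le> E n * \<bar>g t\<bar>"
          by (simp add: right_diff_distrib[symmetric] abs_mult mult.commute)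
      qed
      then show ?case by (simp add: integral_diff[OF i])
    qed
  qed
  from tendsto_add[OF this limUV] show ?thesis by simp
qed

section \<open>High-frequency asymptotics of solutions\<close>

lemma sl_solution_sin:
  "sl_solution (\<lambda>x. 0) (w\<^sup>2) (\<lambda>t. sin (w * (x - t))) (\<lambda>t. - w * cos (w * (x - t)))"
  by (rule sl_solution_smooth) (auto intro!: derivative_eq_intros simp: power2_eq_square)

text \<open>Green's identity against \<open>sin (w * (x - t))\<close> is the variation of constants
  formula with perturbation \<open>q - (lam - w\<^sup>2)\<close>, whose L^1 norm is at most
  \<open>P\<close>; the \<open>+ 1\<close> absorbs \<open>lam - w\<^sup>2\<close>. The error is at
  most \<open>P / w\<close> times the maximum \<open>N\<close> of \<open>\<bar>y\<bar>\<close>, and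
  \<open>2 * P \<le> w\<close> closes the circle: \<open>N \<le> A + N / 2\<close>.\<close>

lemma sl_solution_oscillation:
  assumes q: "q absolutely_integrable_on {0..1}" and y: "sl_solution q lam y dy"
    and w: "0 < w" "2 * (integral {0..1} (\<lambda>t. \<bar>q t\<bar>) + 1) \<le> w" and lam: "\<bar>lam - w\<^sup>2\<bar> \<le> 1" and x: "x \<in> {0..1}"
  shows "\<bar>y x - (y 0 * cos (w * x) + dy 0 / w * sin (w * x))\<bar>
    \<le> 2 * (integral {0..1} (\<lambda>t. \<bar>q t\<bar>) + 1) / w * (\<bar>y 0\<bar> + \<bar>dy 0 / w\<bar>)"
proof -
  define P where "P = integral {0..1} (\<lambda>t. \<bar>q t\<bar>) + 1"
  define A where "A = \<bar>y 0\<bar> + \<bar>dy 0 / w\<bar>"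
  define p where "p = (\<lambda>t. q t - (lam - w\<^sup>2))"
  have p: "p absolutely_integrable_on {0..1}" unfolding p_def by (rule absolutely_integrable_diff_const[OF q])
  have pP: "integral {0..1} (\<lambda>t. \<bar>p t\<bar>) \<le> P"
    unfolding p_def P_def using integral_abs_diff_le[OF q, of "lam - w\<^sup>2"] lam by simp
  have pi: "(\<lambda>t. \<bar>p t\<bar>) integrable_on {0..1}" using p by (simp add: absolutely_integrable_on_def)
  note yc = sl_solution_continuous(1)[OF y]
  have "continuous_on {0..1} (\<lambda>t. \<bar>y t\<bar>)" by (intro continuous_intros yc)
  then have "\<exists>x0\<in>{0..1}. \<forall>t\<in>{0..1}. \<bar>y t\<bar> \<le> \<bar>y x0\<bar>" by (intro continuous_attains_sup) auto
  then obtain x0 where x0: "x0 \<in> {0..1}" "\<And>t. t \<in> {0..1} \<Longrightarrow> \<bar>y t\<bar> \<le> \<bar>y x0\<bar>" by blast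
  define N where "N = \<bar>y x0\<bar>"
  have diff: "\<bar>y x - (y 0 * cos (w * x) + dy 0 / w * sin (w * x))\<bar> \<le> P / w * N" if x: "x \<in> {0..1}" for x
  proof -
    have x': "0 \<le> x" "x \<le> 1" using x by auto
    have "((\<lambda>t. p t * (y t * sin (w * (x - t)))) has_integral
        dy x * sin (w * (x - x)) - y x * (- w * cos (w * (x - x))) - (dy 0 * sin (w * (x - 0)) - y 0 * (- w * cos (w * (x - 0))))) {0..x}"
      using sl_green[OF y sl_solution_sin[of w x] x'] by (simp add: p_def algebra_simps)
    then have "integral {0..x} (\<lambda>t. p t * (y t * sin (w * (x - t)))) = w * (y x - (y 0 * cos (w * x) + dy 0 / w * sin (w * x)))"
      using w(1) by (simp add: integral_unique field_simps)
    moreover have "\<bar>integral {0..x} (\<lambda>t. p t * (y t * sin (w * (x - t))))\<bar> \<le> integral {0..x} (\<lambda>t. \<bar>p t\<bar> * N)"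
    proof (rule weighted_integral_bound[OF p _ _ x'])
      show "continuous_on {0..1} (\<lambda>t. y t * sin (w * (x - t)))" by (intro continuous_intros yc)
      show "\<bar>y t * sin (w * (x - t))\<bar> \<le> N" if "0 \<le> t" "t \<le> x" for t
        using mult_mono[OF x0(2)[of t] abs_sin_le_one[of "w * (x - t)"]] that x by (simp add: abs_mult N_def)
    qed (rule continuous_on_const)
    moreover have "integral {0..x} (\<lambda>t. \<bar>p t\<bar> * N) \<le> P * N"
    proof -
      have "integral {0..x} (\<lambda>t. \<bar>p t\<bar>) \<le> integral {0..1} (\<lambda>t. \<bar>p t\<bar>)"
        using x by (intro integral_subset_le pi integrable_on_subinterval[OF pi]) auto
      then have "integral {0..x} (\<lambda>t. \<bar>p t\<bar>) * N \<le> P * N" using pP by (intro mult_right_mono) (auto simp: N_def)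
      then show ?thesis by simp
    qed
    ultimately have "w * \<bar>y x - (y 0 * cos (w * x) + dy 0 / w * sin (w * x))\<bar> \<le> P * N"
      using w(1) by (simp add: abs_mult)
    then show ?thesis using w(1) by (simp add: field_simps)
  qed
  have "N \<le> 2 * A"
  proof -
    have "\<bar>y 0 * cos (w * x0) + dy 0 / w * sin (w * x0)\<bar> \<le> A"
      unfolding A_def
      using mult_left_mono[OF abs_cos_le_one[of "w * x0"], of "\<bar>y 0\<bar>"] mult_left_mono[OF abs_sin_le_one[of "w * x0"], of "\<bar>dy 0 / w\<bar>"]
        abs_triangle_ineq[of "y 0 * cos (w * x0)" "dy 0 / w * sin (w * x0)"]
      unfolding abs_mult[symmetric] by linarith
    then have "N \<le> A + P / w * N" using diff[OF x0(1)] unfolding N_def by linarith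
    moreover have "P / w * N \<le> 1 / 2 * N"
      using w by (intro mult_right_mono) (auto simp: P_def N_def field_simps)
    ultimately show ?thesis by linarith
  qed
  moreover have "0 \<le> P" unfolding P_def using integral_nonneg[of "\<lambda>t. \<bar>q t\<bar>" "{0..1}"] q by (simp add: absolutely_integrable_on_def)
  ultimately have "P / w * N \<le> P / w * (2 * A)" using w(1) by (intro mult_left_mono) auto
  also have "P / w * (2 * A) = 2 * P / w * A" by simp
  finally have "P / w * N \<le> 2 * P / w * A" .
  with diff[OF x] show ?thesis unfolding P_def[symmetric] A_def[symmetric] by (rule order_trans)
qed

context
  fixes q :: "real \<Rightarrow> real" and w lam t :: "nat \<Rightarrow> real" and y dy :: "nat \<Rightarrow> real \<Rightarrow> real" and \<alpha> \<beta> :: real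
  assumes q: "q absolutely_integrable_on {0..1}" and y: "\<And>n. sl_solution q (lam n) (y n) (dy n)"
    and w: "filterlim w at_top sequentially" and lam: "(\<lambda>n. lam n - (w n)\<^sup>2) \<longlonglongrightarrow> 0"
    and t: "\<And>n. \<bar>t n\<bar> = 1"
    and a: "(\<lambda>n. t n * y n 0) \<longlonglongrightarrow> \<alpha>" and b: "(\<lambda>n. t n * (dy n 0 / w n)) \<longlonglongrightarrow> \<beta>"
begin

text \<open>The error in \<open>sl_solution_oscillation\<close> is O(1/w) times the size of the
  initial data, which stays bounded because \<open>a\<close> and \<open>b\<close> state convergence.
  The sign \<open>t n\<close> multiplies the whole solution and leaves the estimate
  unchanged.\<close>

lemma remainder_limit:
  "\<exists>r. r \<longlonglongrightarrow> 0 \<and> (\<forall>\<^sub>F n in sequentially. \<forall>x\<in>{0..1}.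
     \<bar>t n * y n x - (t n * y n 0 * cos (w n * x) + t n * (dy n 0 / w n) * sin (w n * x))\<bar> \<le> r n)"
proof (intro exI conjI)
  let ?P = "integral {0..1} (\<lambda>t. \<bar>q t\<bar>) + 1"
  let ?r = "\<lambda>n. 2 * ?P / w n * (\<bar>t n * y n 0\<bar> + \<bar>t n * (dy n 0 / w n)\<bar>)"
  have "(\<lambda>n. 2 * ?P / w n) \<longlonglongrightarrow> 0"
    using w by (intro tendsto_divide_0[OF tendsto_const] filterlim_at_top_imp_at_infinity)
  then have "?r \<longlonglongrightarrow> 0 * (\<bar>\<alpha>\<bar> + \<bar>\<beta>\<bar>)" by (intro tendsto_intros a b)
  then show "?r \<longlonglongrightarrow> 0" by simp
  have "\<forall>\<^sub>F n in sequentially. max 1 (2 * ?P) \<le> w n" using w unfolding filterlim_at_top by blast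
  moreover have "\<forall>\<^sub>F n in sequentially. \<bar>lam n - (w n)\<^sup>2\<bar> < 1"
    using tendsto_rabs[OF lam] by (intro order_tendstoD) auto
  ultimately show "\<forall>\<^sub>F n in sequentially. \<forall>x\<in>{0..1}.
     \<bar>t n * y n x - (t n * y n 0 * cos (w n * x) + t n * (dy n 0 / w n) * sin (w n * x))\<bar> \<le> ?r n"
  proof eventually_elim
    case (elim n)
    show ?case
    proof
      fix x :: real assume x: "x \<in> {0..1}"
      have "\<bar>t n * y n x - (t n * y n 0 * cos (w n * x) + t n * (dy n 0 / w n) * sin (w n * x))\<bar>
        = \<bar>t n\<bar> * \<bar>y n x - (y n 0 * cos (w n * x) + dy n 0 / w n * sin (w n * x))\<bar>"
        unfolding abs_mult[symmetric] by (simp add: algebra_simps)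
      also have "\<dots> \<le> 2 * ?P / w n * (\<bar>y n 0\<bar> + \<bar>dy n 0 / w n\<bar>)"
        using sl_solution_oscillation[OF q y _ _ _ x, of "w n" n] elim by (simp add: t)
      finally show "\<bar>t n * y n x - (t n * y n 0 * cos (w n * x) + t n * (dy n 0 / w n) * sin (w n * x))\<bar> \<le> ?r n"
        by (simp add: abs_mult[of "t n"] t)
    qed
  qed
qed

lemma trig_pairing_limit:
  assumes g: "g absolutely_integrable_on {0..1}"
  shows "(\<lambda>n. integral {0..1} (\<lambda>x. g x * ((t n * y n x) * (c * cos (w n * x) + d * sin (w n * x))))) \<longlonglongrightarrow> (\<alpha> * c + \<beta> * d) / 2 * integral {0..1} g"
proof -
  obtain r where r: "r \<longlonglongrightarrow> 0" "\<forall>\<^sub>F n in sequentially. \<forall>x\<in>{0..1}.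
     \<bar>t n * y n x - (t n * y n 0 * cos (w n * x) + t n * (dy n 0 / w n) * sin (w n * x))\<bar> \<le> r n"
    using remainder_limit by blast
  show ?thesis
    by (rule oscillating_product_limit[OF g w a b tendsto_const tendsto_const r(1) tendsto_const _ _ r(2)])
      (auto intro!: continuous_intros sl_solution_continuous[OF y])
qed

text \<open>The weight is the one that \<open>sl_green\<close> produces against a trigonometric
  function of frequency \<open>w n\<close>. Its part \<open>lam n - (w n)\<^sup>2\<close> tends to 0
  in front of a convergent integral, so only \<open>q\<close> survives.\<close>

lemma test_function_limit:
  "(\<lambda>n. integral {0..1} (\<lambda>x. (q x - lam n + (w n)\<^sup>2) * ((t n * y n x) * (c * cos (w n * x) + d * sin (w n * x))))) \<longlonglongrightarrow> (\<alpha> * c + \<beta> * d) / 2 * integral {0..1} q"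
proof -
  have one: "(\<lambda>x :: real. 1 :: real) absolutely_integrable_on {0..1::real}"
    by (rule absolutely_integrable_continuous_real) (rule continuous_on_const)
  let ?v = "\<lambda>n x. (t n * y n x) * (c * cos (w n * x) + d * sin (w n * x))"
  have vc: "continuous_on {0..1} (?v n)" for n by (intro continuous_intros sl_solution_continuous[OF y])
  have "integral {0..1} (\<lambda>x. (q x - lam n + (w n)\<^sup>2) * ?v n x) = integral {0..1} (\<lambda>x. q x * ?v n x) - (lam n - (w n)\<^sup>2) * integral {0..1} (\<lambda>x. 1 * ?v n x)" for n
  proof -
    have i1: "(\<lambda>x. q x * ?v n x) integrable_on {0..1}"
      using absolutely_integrable_mult_continuous[OF q vc] by (simp add: absolutely_integrable_on_def)
    have i2: "(\<lambda>x. 1 * ?v n x) integrable_on {0..1}" using vc by (simp add: integrable_continuous_interval)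
    have "((\<lambda>x. q x * ?v n x - (lam n - (w n)\<^sup>2) * (1 * ?v n x)) has_integral
      integral {0..1} (\<lambda>x. q x * ?v n x) - (lam n - (w n)\<^sup>2) * integral {0..1} (\<lambda>x. 1 * ?v n x)) {0..1}"
      by (intro has_integral_diff has_integral_mult_right integrable_integral i1 i2)
    then show ?thesis by (subst integral_unique[symmetric], assumption) (simp add: algebra_simps)
  qed
  moreover have "(\<lambda>n. integral {0..1} (\<lambda>x. q x * ?v n x) - (lam n - (w n)\<^sup>2) * integral {0..1} (\<lambda>x. 1 * ?v n x))
      \<longlonglongrightarrow> (\<alpha> * c + \<beta> * d) / 2 * integral {0..1} q - 0 * ((\<alpha> * c + \<beta> * d) / 2 * integral {0..1} (\<lambda>x :: real. 1))"
    by (intro tendsto_intros lam trig_pairing_limit q one)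
  ultimately show ?thesis by simp
qed

end


section \<open>Eigenfunctions and their initial data\<close>

text \<open>Compared with \<open>eigenspace\<close>, the derivative is explicit, so that it can be
  combined linearly along with the function, and nothing is required outside [0, 1].\<close>

definition eigenpair ::
  "('v, 'e) pre_digraph \<Rightarrow> ('e \<Rightarrow> real \<Rightarrow> real) \<Rightarrow> real \<Rightarrow> ('e \<Rightarrow> real \<Rightarrow> real) \<Rightarrow> ('e \<Rightarrow> real \<Rightarrow> real) \<Rightarrow> bool" where
  "eigenpair G q lam y dy \<longleftrightarrow> (\<forall>e\<in>arcs G. sl_solution (q e) lam (y e) (dy e)) \<and>
     continuity_condition G y \<and> kirchhoff_condition G dy"

lemma eigenpair_zero: "eigenpair G q lam (\<lambda>e x. 0) (\<lambda>e x. 0)"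
proof -
  have "sl_solution (q e) lam (\<lambda>x. 0) (\<lambda>x. 0)" for e
    unfolding sl_solution_iff by (auto intro!: has_ae_derivative_C1)
  then show ?thesis
    by (auto simp: eigenpair_def continuity_condition_def kirchhoff_condition_def intro!: exI[of _ "0 :: real"])
qed

lemma eigenpair_add_scale:
  assumes "eigenpair G q lam y dy" "eigenpair G q lam w dw"
  shows "eigenpair G q lam (\<lambda>e x. y e x + c * w e x) (\<lambda>e x. dy e x + c * dw e x)"
  unfolding eigenpair_def
proof (intro conjI ballI)
  show "sl_solution (q e) lam (\<lambda>x. y e x + c * w e x) (\<lambda>x. dy e x + c * dw e x)" if "e \<in> arcs G" for e
    using sl_solution_lincomb[of "q e" lam "y e" "dy e" "w e" "dw e" 1 c] assms that by (simp add: eigenpair_def)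
  show "continuity_condition G (\<lambda>e x. y e x + c * w e x)"
    unfolding continuity_condition_def
  proof
    fix v assume v: "v \<in> verts G"
    obtain a where a: "\<forall>e\<in>arcs G. (tail G e = v \<longrightarrow> y e 0 = a) \<and> (head G e = v \<longrightarrow> y e 1 = a)"
      using assms(1) v unfolding eigenpair_def continuity_condition_def by blast
    obtain b where b: "\<forall>e\<in>arcs G. (tail G e = v \<longrightarrow> w e 0 = b) \<and> (head G e = v \<longrightarrow> w e 1 = b)"
      using assms(2) v unfolding eigenpair_def continuity_condition_def by blast
    show "\<exists>d. \<forall>e\<in>arcs G. (tail G e = v \<longrightarrow> y e 0 + c * w e 0 = d) \<and> (head G e = v \<longrightarrow> y e 1 + c * w e 1 = d)"
      using a b by (intro exI[of _ "a + c * b"]) simp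
  qed
  show "kirchhoff_condition G (\<lambda>e x. dy e x + c * dw e x)"
    using assms unfolding eigenpair_def kirchhoff_condition_def
    by (simp add: sum.distrib sum_distrib_left[symmetric])
qed

lemma eigenpair_sum:
  assumes "finite B" "\<And>b. b \<in> B \<Longrightarrow> eigenpair G q lam (y b) (dy b)"
  shows "eigenpair G q lam (\<lambda>e x. \<Sum>b\<in>B. c b * y b e x) (\<lambda>e x. \<Sum>b\<in>B. c b * dy b e x)"
  using assms
proof (induction B rule: finite_induct)
  case empty
  then show ?case by (simp add: eigenpair_zero)
next
  case (insert b B)
  have "eigenpair G q lam (\<lambda>e x. (\<Sum>b\<in>B. c b * y b e x) + c b * y b e x) (\<lambda>e x. (\<Sum>b\<in>B. c b * dy b e x) + c b * dy b e x)"
    by (rule eigenpair_add_scale) (use insert in auto)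
  then show ?case using insert.hyps by (simp add: add.commute)
qed

lemma eigenpair_vertex_values:
  assumes "eigenpair G q lam y dy" "wf_digraph G"
  obtains \<phi> where "\<And>e. e \<in> arcs G \<Longrightarrow> y e 0 = \<phi> (tail G e)" "\<And>e. e \<in> arcs G \<Longrightarrow> y e 1 = \<phi> (head G e)"
proof -
  interpret wf_digraph G by (rule assms(2))
  have "\<forall>v. \<exists>c. v \<in> verts G \<longrightarrow> (\<forall>e\<in>arcs G. (tail G e = v \<longrightarrow> y e 0 = c) \<and> (head G e = v \<longrightarrow> y e 1 = c))"
    using assms(1) unfolding eigenpair_def continuity_condition_def by blast
  then obtain \<phi> where "\<And>v. v \<in> verts G \<Longrightarrow> \<forall>e\<in>arcs G. (tail G e = v \<longrightarrow> y e 0 = \<phi> v) \<and> (head G e = v \<longrightarrow> y e 1 = \<phi> v)"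
    by metis
  then show thesis by (intro that[of \<phi>]) auto
qed

lemma kirchhoff_sum:
  assumes "kirchhoff_condition G dy" "fin_digraph G"
  shows "(\<Sum>e\<in>arcs G. dy e 1 * \<phi> (head G e) - dy e 0 * \<phi> (tail G e)) = 0"
  using assms(1) sum_head_group[OF assms(2), of "\<lambda>e. dy e 1" \<phi>] sum_tail_group[OF assms(2), of "\<lambda>e. dy e 0" \<phi>]
  unfolding kirchhoff_condition_def by (simp add: sum_subtractf)

text \<open>Self-adjointness: by Green's identity the two eigenvalues differ by boundary terms in
  which the derivatives of one function meet the vertex values of the other, and Kirchhoff's
  condition cancels these.\<close>

lemma eigenpair_orthogonal:
  assumes y: "eigenpair G q lam y dy" and w: "eigenpair G q mu w dw" and ne: "lam \<noteq> mu" and fin: "fin_digraph G"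
  shows "(\<Sum>e\<in>arcs G. integral {0..1} (\<lambda>x. y e x * w e x)) = 0"
proof -
  have wf: "wf_digraph G" using fin by (simp add: fin_digraph_def)
  obtain \<phi> where \<phi>: "\<And>e. e \<in> arcs G \<Longrightarrow> y e 0 = \<phi> (tail G e)" "\<And>e. e \<in> arcs G \<Longrightarrow> y e 1 = \<phi> (head G e)"
    by (rule eigenpair_vertex_values[OF y wf]) blast
  obtain \<psi> where \<psi>: "\<And>e. e \<in> arcs G \<Longrightarrow> w e 0 = \<psi> (tail G e)" "\<And>e. e \<in> arcs G \<Longrightarrow> w e 1 = \<psi> (head G e)"
    by (rule eigenpair_vertex_values[OF w wf]) blast
  have "(mu - lam) * integral {0..1} (\<lambda>x. y e x * w e x) =
      (dy e 1 * \<psi> (head G e) - dy e 0 * \<psi> (tail G e)) - (dw e 1 * \<phi> (head G e) - dw e 0 * \<phi> (tail G e))"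
    if e: "e \<in> arcs G" for e
  proof -
    have "sl_solution (q e) lam (y e) (dy e)" "sl_solution (q e) mu (w e) (dw e)"
      using y w e by (auto simp: eigenpair_def)
    from sl_green[OF this, of 1] have "((\<lambda>x. (mu - lam) * (y e x * w e x)) has_integral
        (dy e 1 * w e 1 - y e 1 * dw e 1) - (dy e 0 * w e 0 - y e 0 * dw e 0)) {0..1}"
      by simp
    then have "integral {0..1} (\<lambda>x. (mu - lam) * (y e x * w e x)) = (dy e 1 * w e 1 - y e 1 * dw e 1) - (dy e 0 * w e 0 - y e 0 * dw e 0)"
      by (rule integral_unique)
    then show ?thesis
      unfolding integral_mult_right \<phi>[OF e] \<psi>[OF e] by (simp only: algebra_simps)
  qed
  then have "(mu - lam) * (\<Sum>e\<in>arcs G. integral {0..1} (\<lambda>x. y e x * w e x)) =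
      (\<Sum>e\<in>arcs G. dy e 1 * \<psi> (head G e) - dy e 0 * \<psi> (tail G e)) - (\<Sum>e\<in>arcs G. dw e 1 * \<phi> (head G e) - dw e 0 * \<phi> (tail G e))"
    unfolding sum_distrib_left sum_subtractf[of "\<lambda>e. dy e 1 * _ e - _ e", symmetric] sum_subtractf[symmetric]
    by (intro sum.cong) auto
  also have "\<dots> = 0"
    using kirchhoff_sum[of G dy \<psi>] kirchhoff_sum[of G dw \<phi>] y w fin by (simp add: eigenpair_def)
  finally show ?thesis using ne by simp
qed

text \<open>For an eigenvalue near \<open>w\<^sup>2\<close> these approximate the coefficients of \<open>cos (w x)\<close> and \<open>sin (w x)\<close>.\<close>

definition initial_data :: "real \<Rightarrow> ('e \<Rightarrow> real \<Rightarrow> real) \<Rightarrow> ('e \<Rightarrow> real \<Rightarrow> real) \<Rightarrow> 'e + 'e \<Rightarrow> real" where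
  "initial_data w y dy = case_sum (\<lambda>e. y e 0) (\<lambda>e. dy e 0 / w)"

section \<open>Orthonormal initial data for eigenfunctions\<close>

lemma sum_fun_apply2: "(\<Sum>b\<in>B. f b) e x = (\<Sum>b\<in>B. f b e x)" for f :: "'b \<Rightarrow> 'e \<Rightarrow> real \<Rightarrow> real"
  by (induction B rule: infinite_finite_induct) (auto simp: plus_fun_def)

context
  fixes G :: "('v, 'e) pre_digraph" and q :: "'e \<Rightarrow> real \<Rightarrow> real"
  assumes fin: "fin_digraph G"
    and q: "\<And>e. e \<in> arcs G \<Longrightarrow> q e absolutely_integrable_on {0..1}"
begin

interpretation fin_digraph G by (rule fin)
interpretation VS: vector_space "fun_scale :: real \<Rightarrow> ('e \<Rightarrow> real \<Rightarrow> real) \<Rightarrow> _" by (rule vector_space_fun_scale)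

text \<open>A solution with zero initial data vanishes, so the initial data of a basis of the
  eigenspace are linearly independent and Gram-Schmidt applies to them. Dividing the derivative by
  \<open>w\<close> loses nothing because \<open>w\<close> is nonzero.\<close>

lemma eigenspace_frame:
  assumes w: "w \<noteq> 0"
  shows "\<exists>z dz. (\<forall>i<eigenvalue_multiplicity G q lam. eigenpair G q lam (z i) (dz i)) \<and>
    orthonormal_on (arcs G <+> arcs G) {..<eigenvalue_multiplicity G q lam} (\<lambda>i. initial_data w (z i) (dz i))"
proof (cases "eigenvalue_multiplicity G q lam = 0")
  case True
  then show ?thesis by (simp add: orthonormal_on_def)
next
  case False
  define d where "d = eigenvalue_multiplicity G q lam"
  obtain B where B: "B \<subseteq> eigenspace G q lam" "VS.independent B" "card B = d"
    unfolding d_def eigenvalue_multiplicity_def using VS.basis_exists[of "eigenspace G q lam"] by metis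
  \<comment> \<open>An infinite set has cardinality 0 by convention, which is excluded in this
    case.\<close>
  have finB: "finite B" using B(3) False d_def card_ge_0_finite by force
  have "\<forall>b\<in>B. \<exists>db. eigenpair G q lam b db"
    using B(1) unfolding eigenspace_def eigenpair_def by blast
  then obtain db where db: "\<And>b. b \<in> B \<Longrightarrow> eigenpair G q lam b (db b)" by metis
  have "\<exists>A. orthonormal_on (arcs G <+> arcs G) B (\<lambda>i j. \<Sum>l\<in>B. A i l * initial_data w l (db l) j)"
  proof (rule gram_schmidt[OF finB])
    show "finite (arcs G <+> arcs G)" by simp
    fix c assume c: "\<forall>j\<in>arcs G <+> arcs G. (\<Sum>b\<in>B. c b * initial_data w b (db b) j) = 0"
    have zero: "(\<Sum>b\<in>B. c b * b e x) = 0" for e x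
    proof (cases "e \<in> arcs G \<and> x \<in> {0..1}")
      case True
      then have e: "e \<in> arcs G" by simp
      have "sl_solution (q e) lam (\<lambda>x. \<Sum>b\<in>B. c b * b e x) (\<lambda>x. \<Sum>b\<in>B. c b * db b e x)"
        using eigenpair_sum[of B G q lam "\<lambda>b. b" db c] finB db e by (simp add: eigenpair_def)
      moreover have "(\<Sum>b\<in>B. c b * b e 0) = 0"
        using c e by (force simp: initial_data_def)
      moreover have "(\<Sum>b\<in>B. c b * db b e 0) = 0"
      proof -
        have "(\<Sum>b\<in>B. c b * (db b e 0 / w)) = 0" using c e by (force simp: initial_data_def)
        then have "(\<Sum>b\<in>B. c b * db b e 0) / w = 0" by (simp add: sum_divide_distrib)
        then show ?thesis using w by simp
      qed
      ultimately show ?thesis using sl_solution_zero[OF q[OF e]] True by blast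
    next
      case False
      then show ?thesis using B(1) by (intro sum.neutral) (auto simp: eigenspace_def)
    qed
    have "(\<Sum>b\<in>B. fun_scale (c b) b) = 0"
      by (intro ext) (simp add: sum_fun_apply2 fun_scale_def zero)
    then show "\<forall>b\<in>B. c b = 0" using VS.independentD[OF B(2) finB subset_refl] by blast
  qed
  then obtain A where A: "orthonormal_on (arcs G <+> arcs G) B (\<lambda>i j. \<Sum>l\<in>B. A i l * initial_data w l (db l) j)" by blast
  obtain h where h: "bij_betw h {..<d} B"
    using ex_bij_betw_nat_finite[OF finB] B(3) by (metis atLeast0LessThan)
  define z where "z = (\<lambda>i e x. \<Sum>l\<in>B. A (h i) l * l e x)"
  define dz where "dz = (\<lambda>i e x. \<Sum>l\<in>B. A (h i) l * db l e x)"
  have id: "initial_data w (z i) (dz i) = (\<lambda>j. \<Sum>l\<in>B. A (h i) l * initial_data w l (db l) j)" for i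
    by (intro ext) (auto simp: initial_data_def z_def dz_def sum_divide_distrib split: sum.split)
  show ?thesis
  proof (rule exI[of _ z], rule exI[of _ dz], intro conjI allI impI)
    show "eigenpair G q lam (z i) (dz i)" for i
      unfolding z_def dz_def using eigenpair_sum[of B G q lam "\<lambda>b. b" db "A (h i)"] finB db by simp
    show "orthonormal_on (arcs G <+> arcs G) {..<eigenvalue_multiplicity G q lam} (\<lambda>i. initial_data w (z i) (dz i))"
      unfolding orthonormal_on_def d_def[symmetric] id
    proof (intro ballI)
      fix i k assume ik: "i \<in> {..<d}" "k \<in> {..<d}"
      then have "h i \<in> B" "h k \<in> B" "h i = h k \<longleftrightarrow> i = k"
        using h unfolding bij_betw_def inj_on_def by auto
      then show "inner_on (arcs G <+> arcs G) (\<lambda>j. \<Sum>l\<in>B. A (h i) l * initial_data w l (db l) j)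
          (\<lambda>j. \<Sum>l\<in>B. A (h k) l * initial_data w l (db l) j) = of_bool (i = k)"
        using A unfolding orthonormal_on_def by simp
    qed
  qed
qed

text \<open>Choosing \<open>m\<close> of the pairs of an eigenvalue in \<open>F\<close> and an index
  below its multiplicity. Orthonormality is claimed only within one eigenvalue: initial data
  belonging to distinct eigenvalues need not be orthogonal.\<close>

lemma eigenvalues_frame:
  assumes w: "w \<noteq> 0" and F: "finite F" "m \<le> (\<Sum>lam\<in>F. eigenvalue_multiplicity G q lam)"
  shows "\<exists>lam z dz. \<forall>i<m. lam i \<in> F \<and> eigenpair G q (lam i) (z i) (dz i) \<and>
    (\<forall>j<m. lam i = lam j \<longrightarrow>
       inner_on (arcs G <+> arcs G) (initial_data w (z i) (dz i)) (initial_data w (z j) (dz j)) = of_bool (i = j))"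
proof -
  let ?d = "eigenvalue_multiplicity G q"
  obtain z dz where z: "\<And>lam i. i < ?d lam \<Longrightarrow> eigenpair G q lam (z lam i) (dz lam i)"
    and on: "\<And>lam. orthonormal_on (arcs G <+> arcs G) {..<?d lam} (\<lambda>i. initial_data w (z lam i) (dz lam i))"
    using eigenspace_frame[OF w] by metis
  let ?T = "SIGMA lam:F. {..<?d lam}"
  have "card {..<m} \<le> card ?T" using F by simp
  moreover have "finite ?T" using F(1) by simp
  ultimately obtain h where h: "h ` {..<m} \<subseteq> ?T" "inj_on h {..<m}"
    using card_le_inj[of "{..<m}" ?T] by auto
  show ?thesis
  proof (rule exI[of _ "\<lambda>i. fst (h i)"], rule exI[of _ "\<lambda>i. z (fst (h i)) (snd (h i))"],
      rule exI[of _ "\<lambda>i. dz (fst (h i)) (snd (h i))"], intro allI impI conjI)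
    fix i assume i: "i < m"
    then have hi: "h i \<in> ?T" using h(1) by blast
    then show "fst (h i) \<in> F" "eigenpair G q (fst (h i)) (z (fst (h i)) (snd (h i))) (dz (fst (h i)) (snd (h i)))"
      using z by auto
    fix j assume j: "j < m" and eq: "fst (h i) = fst (h j)"
    have hj: "h j \<in> ?T" using h(1) j by blast
    have "snd (h i) = snd (h j) \<longleftrightarrow> i = j"
      using eq h(2) i j by (metis inj_onD lessThan_iff prod.expand)
    moreover have "inner_on (arcs G <+> arcs G) (initial_data w (z (fst (h i)) (snd (h i))) (dz (fst (h i)) (snd (h i))))
        (initial_data w (z (fst (h i)) (snd (h j))) (dz (fst (h i)) (snd (h j)))) = of_bool (snd (h i) = snd (h j))"
      using on[of "fst (h i)"] hi hj eq unfolding orthonormal_on_def by auto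
    ultimately show "inner_on (arcs G <+> arcs G) (initial_data w (z (fst (h i)) (snd (h i))) (dz (fst (h i)) (snd (h i))))
        (initial_data w (z (fst (h j)) (snd (h j))) (dz (fst (h j)) (snd (h j)))) = of_bool (i = j)"
      using eq by simp
  qed
qed

end

lemma inner_on_initial_data:
  assumes "finite E"
  shows "inner_on (E <+> E) (initial_data w y dy) (initial_data w z dz)
    = (\<Sum>e\<in>E. y e 0 * z e 0) + (\<Sum>e\<in>E. (dy e 0 / w) * (dz e 0 / w))"
  unfolding inner_on_def using assms by (simp add: sum.Plus initial_data_def)

text \<open>With \<open>sin w = 0\<close> the test function and its derivative return at 1 to
  \<open>cos w\<close> times their values at 0, so the boundary terms of Green's identity
  simplify.\<close>

lemma sl_solution_trig_pairing:
  assumes y: "sl_solution q lam y dy" and w: "sin w = 0"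
  shows "integral {0..1} (\<lambda>x. (q x - lam + w\<^sup>2) * ((t * y x) * (c * cos (w * x) + d * sin (w * x))))
    = t * (c * (cos w * dy 1 - dy 0) - d * w * (cos w * y 1 - y 0))"
proof -
  have "sl_solution (\<lambda>x. 0) (w\<^sup>2) (\<lambda>x. c * cos (w * x) + d * sin (w * x)) (\<lambda>x. w * (d * cos (w * x) - c * sin (w * x)))"
    by (rule sl_solution_smooth) (auto intro!: derivative_eq_intros simp: power2_eq_square algebra_simps)
  from has_integral_mult_right[OF sl_green[OF y this, of 1], of t]
  have "((\<lambda>x. (q x - lam + w\<^sup>2) * ((t * y x) * (c * cos (w * x) + d * sin (w * x)))) has_integral
     t * (c * (cos w * dy 1 - dy 0) - d * w * (cos w * y 1 - y 0))) {0..1}"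
    using w by (simp add: algebra_simps)
  then show ?thesis by (rule integral_unique)
qed


section \<open>High energy limits\<close>

text \<open>The gauge \<open>\<tau>\<close> reduces \<open>cos w = -1\<close> (odd \<open>k\<close> on a bipartite graph) to \<open>cos w = 1\<close>, where \<open>\<tau> = 1\<close> will do.\<close>

lemma limit_weights:
  fixes G :: "('v, 'e) pre_digraph" and q :: "'e \<Rightarrow> real \<Rightarrow> real"
    and w :: "nat \<Rightarrow> real" and \<tau> :: "nat \<Rightarrow> 'v \<Rightarrow> real" and lam :: "nat \<Rightarrow> nat \<Rightarrow> real"
    and y dy :: "nat \<Rightarrow> nat \<Rightarrow> 'e \<Rightarrow> real \<Rightarrow> real" and \<alpha> \<beta> :: "nat \<Rightarrow> 'e \<Rightarrow> real"
  assumes fin: "fin_digraph G" and con: "Digraph_Component.connected G"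
    and q: "\<And>e. e \<in> arcs G \<Longrightarrow> q e absolutely_integrable_on {0..1}"
    and r: "r < 1" "\<And>e. e \<in> arcs G \<Longrightarrow> nonloop G e \<Longrightarrow> edge_resistance G e = r"
    and m: "m + card (verts G) = card (arcs G) + 1"
    and w: "filterlim w at_top sequentially" "\<And>n. sin (w n) = 0"
    and \<tau>: "\<And>n v. \<bar>\<tau> n v\<bar> = 1" "\<And>n e. e \<in> arcs G \<Longrightarrow> \<tau> n (head G e) = cos (w n) * \<tau> n (tail G e)"
    and lam: "\<And>i. i < m \<Longrightarrow> (\<lambda>n. lam n i - (w n)\<^sup>2) \<longlonglongrightarrow> 0"
    and ep: "\<And>n i. i < m \<Longrightarrow> eigenpair G q (lam n i) (y n i) (dy n i)"
    and on: "\<And>n i j. i < m \<Longrightarrow> j < m \<Longrightarrow> lam n i = lam n j \<Longrightarrow>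
      inner_on (arcs G <+> arcs G) (initial_data (w n) (y n i) (dy n i)) (initial_data (w n) (y n j) (dy n j)) = of_bool (i = j)"
    and a: "\<And>i e. i < m \<Longrightarrow> e \<in> arcs G \<Longrightarrow> (\<lambda>n. \<tau> n (tail G e) * y n i e 0) \<longlonglongrightarrow> \<alpha> i e"
    and b: "\<And>i e. i < m \<Longrightarrow> e \<in> arcs G \<Longrightarrow> (\<lambda>n. \<tau> n (tail G e) * (dy n i e 0 / w n)) \<longlonglongrightarrow> \<beta> i e"
  shows "(\<Sum>e\<in>arcs G. integral {0..1} (q e)) = 0"
proof (rule ccontr)
  assume Q0: "(\<Sum>e\<in>arcs G. integral {0..1} (q e)) \<noteq> 0"
  interpret fin_digraph G by (rule fin)
  define Q where "Q = (\<lambda>e. integral {0..1} (q e))"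
  have sl: "sl_solution (q e) (lam n i) (y n i e) (dy n i e)" if "i < m" "e \<in> arcs G" for n i e
    using ep[OF that(1)] that(2) by (simp add: eigenpair_def)
  have \<tau>2: "\<tau> n v * \<tau> n v = 1" for n v using \<tau>(1)[of n v] by (metis abs_mult_self_eq mult_1)
  have cos2: "cos (w n) * cos (w n) = 1" for n
    using sin_cos_squared_add[of "w n"] w(2)[of n] by (simp add: power2_eq_square)
  have \<tau>c: "cos (w n) * \<tau> n (head G e) = \<tau> n (tail G e)" if "e \<in> arcs G" for n e
    using \<tau>(2)[OF that, of n] cos2[of n] by (simp add: mult.assoc[symmetric])
  \<comment> \<open>Each of these integrals is known in two ways: in the limit by
    \<open>Tlim\<close>, and exactly as boundary terms by \<open>Tcos\<close> and
    \<open>Tsin\<close>. The gauge absorbs \<open>cos (w n)\<close>, so each end of an edge carries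
    the \<open>\<tau>\<close> of its own vertex.\<close>
  define T where "T = (\<lambda>c d i e n. integral {0..1} (\<lambda>x. (q e x - lam n i + (w n)\<^sup>2) *
      ((\<tau> n (tail G e) * y n i e x) * (c * cos (w n * x) + d * sin (w n * x)))))"
  have Tlim: "T c d i e \<longlonglongrightarrow> (\<alpha> i e * c + \<beta> i e * d) / 2 * Q e" if "i < m" "e \<in> arcs G" for c d i e
    unfolding T_def Q_def
    by (rule test_function_limit[OF q[OF that(2)] sl[OF that] w(1) lam[OF that(1)] \<tau>(1) a[OF that] b[OF that]])
  have Tcos: "T 1 0 i e n = \<tau> n (head G e) * dy n i e 1 - \<tau> n (tail G e) * dy n i e 0" if "i < m" "e \<in> arcs G" for i e n
    unfolding T_def sl_solution_trig_pairing[OF sl[OF that] w(2)] \<tau>(2)[OF that(2)] by (simp add: algebra_simps)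
  have Tsin: "T 0 1 i e n = - w n * (\<tau> n (head G e) * y n i e 1 - \<tau> n (tail G e) * y n i e 0)" if "i < m" "e \<in> arcs G" for i e n
    unfolding T_def sl_solution_trig_pairing[OF sl[OF that] w(2)] \<tau>(2)[OF that(2)] by (simp add: algebra_simps)
  have winv: "(\<lambda>n. inverse (w n)) \<longlonglongrightarrow> 0"
    using w(1) by (intro tendsto_inverse_0_at_top)
  have wpos: "\<forall>\<^sub>F n in sequentially. 0 < w n" using w(1) unfolding filterlim_at_top_dense by blast

  \<comment> \<open>Divided by \<open>w n\<close>, the quantity in \<open>Tcos\<close> tends to 0:
    the scaled, gauged derivatives at the two ends of an edge have the same limit. Kirchhoff's
    condition then passes to \<open>\<beta>\<close>.\<close>
  have flow: "flow G (\<beta> i)" if i: "i < m" for i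
    unfolding flow_def
  proof
    fix v assume v: "v \<in> verts G"
    have "(\<lambda>n. \<Sum>e | e \<in> arcs G \<and> head G e = v. \<tau> n (tail G e) * (dy n i e 0 / w n) + T 1 0 i e n * inverse (w n))
        \<longlonglongrightarrow> (\<Sum>e | e \<in> arcs G \<and> head G e = v. \<beta> i e + (\<alpha> i e * 1 + \<beta> i e * 0) / 2 * Q e * 0)"
      by (intro tendsto_intros b Tlim winv i) auto
    moreover have "(\<lambda>n. \<Sum>e | e \<in> arcs G \<and> tail G e = v. \<tau> n (tail G e) * (dy n i e 0 / w n))
        \<longlonglongrightarrow> (\<Sum>e | e \<in> arcs G \<and> tail G e = v. \<beta> i e)"
      by (intro tendsto_intros b i) auto
    moreover have "(\<Sum>e | e \<in> arcs G \<and> tail G e = v. \<tau> n (tail G e) * (dy n i e 0 / w n))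
      = (\<Sum>e | e \<in> arcs G \<and> head G e = v. \<tau> n (tail G e) * (dy n i e 0 / w n) + T 1 0 i e n * inverse (w n))" for n
    proof -
      have "(\<Sum>e | e \<in> arcs G \<and> tail G e = v. \<tau> n (tail G e) * (dy n i e 0 / w n))
          = \<tau> n v / w n * (\<Sum>e | e \<in> arcs G \<and> tail G e = v. dy n i e 0)"
        unfolding sum_distrib_left by (intro sum.cong) auto
      also have "(\<Sum>e | e \<in> arcs G \<and> tail G e = v. dy n i e 0) = (\<Sum>e | e \<in> arcs G \<and> head G e = v. dy n i e 1)"
        using ep[OF i, of n] v unfolding eigenpair_def kirchhoff_condition_def by blast
      also have "\<tau> n v / w n * (\<Sum>e | e \<in> arcs G \<and> head G e = v. dy n i e 1)
          = (\<Sum>e | e \<in> arcs G \<and> head G e = v. \<tau> n (tail G e) * (dy n i e 0 / w n) + T 1 0 i e n * inverse (w n))"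
        unfolding sum_distrib_left
        by (intro sum.cong refl) (auto simp: Tcos[OF i] divide_inverse algebra_simps)
      finally show ?thesis .
    qed
    ultimately show "(\<Sum>e | e \<in> arcs G \<and> tail G e = v. \<beta> i e) = (\<Sum>e | e \<in> arcs G \<and> head G e = v. \<beta> i e)"
      using LIMSEQ_unique by force
  qed

  \<comment> \<open>Divided by \<open>w n\<close>, \<open>Tsin\<close> shows that gauged vertex
    values differ by o(1) across an edge. Connectedness spreads this over the graph.\<close>
  have const: "\<alpha> i e = \<alpha> i e'" if i: "i < m" and e: "e \<in> arcs G" and e': "e' \<in> arcs G" for i e e'
  proof -
    have "\<forall>n. \<exists>\<phi>. (\<forall>e\<in>arcs G. y n i e 0 = \<phi> (tail G e)) \<and> (\<forall>e\<in>arcs G. y n i e 1 = \<phi> (head G e))"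
      using eigenpair_vertex_values[OF ep[OF i] wf_digraph] by metis
    then obtain \<phi> where \<phi>: "\<And>n e. e \<in> arcs G \<Longrightarrow> y n i e 0 = \<phi> n (tail G e)" "\<And>n e. e \<in> arcs G \<Longrightarrow> y n i e 1 = \<phi> n (head G e)"
      by metis
    define f where "f = (\<lambda>n v. \<tau> n v * \<phi> n v)"
    have step: "(\<lambda>n. f n (head G e) - f n (tail G e)) \<longlonglongrightarrow> 0" if e: "e \<in> arcs G" for e
    proof -
      have "(\<lambda>n. - T 0 1 i e n * inverse (w n)) \<longlonglongrightarrow> - ((\<alpha> i e * 0 + \<beta> i e * 1) / 2 * Q e) * 0"
        by (intro tendsto_intros Tlim i e winv)
      then have "(\<lambda>n. - T 0 1 i e n * inverse (w n)) \<longlonglongrightarrow> 0" by simp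
      moreover have "\<forall>\<^sub>F n in sequentially. - T 0 1 i e n * inverse (w n) = f n (head G e) - f n (tail G e)"
        using wpos by eventually_elim (simp add: Tsin[OF i e] f_def \<phi>[OF e])
      ultimately show ?thesis by (rule Lim_transform_eventually)
    qed
    have "(\<lambda>n. f n (tail G e') - f n (tail G e)) \<longlonglongrightarrow> 0"
    proof (rule connected_verts_induct[OF wf_digraph con, of "tail G e" "\<lambda>v. (\<lambda>n. f n v - f n (tail G e)) \<longlonglongrightarrow> 0"])
      fix e1 assume e1: "e1 \<in> arcs G"
      show "((\<lambda>n. f n (tail G e1) - f n (tail G e)) \<longlonglongrightarrow> 0) \<longleftrightarrow> ((\<lambda>n. f n (head G e1) - f n (tail G e)) \<longlonglongrightarrow> 0)"
      proof
        assume "(\<lambda>n. f n (tail G e1) - f n (tail G e)) \<longlonglongrightarrow> 0"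
        from tendsto_add[OF this step[OF e1]] show "(\<lambda>n. f n (head G e1) - f n (tail G e)) \<longlonglongrightarrow> 0" by simp
      next
        assume "(\<lambda>n. f n (head G e1) - f n (tail G e)) \<longlonglongrightarrow> 0"
        from tendsto_diff[OF this step[OF e1]] show "(\<lambda>n. f n (tail G e1) - f n (tail G e)) \<longlonglongrightarrow> 0" by simp
      qed
    qed (use e e' in auto)
    moreover have "(\<lambda>n. f n (tail G e') - f n (tail G e)) \<longlonglongrightarrow> \<alpha> i e' - \<alpha> i e"
      unfolding f_def using tendsto_diff[OF a[OF i e'] a[OF i e]] by (simp add: \<phi>(1)[OF e] \<phi>(1)[OF e'])
    ultimately have "\<alpha> i e' - \<alpha> i e = 0" using LIMSEQ_unique by blast
    then show ?thesis by simp
  qed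

  \<comment> \<open>The boundary terms carry the growing factor \<open>w n\<close>, so they have to
    cancel exactly: they pair a circulation with a gradient.\<close>
  have sinid: "(\<Sum>e\<in>arcs G. Q e * \<beta> i e * c e) = 0" if i: "i < m" and c: "flow G c" for i c
  proof -
    have "(\<lambda>n. \<Sum>e\<in>arcs G. c e * T 0 1 i e n) \<longlonglongrightarrow> (\<Sum>e\<in>arcs G. c e * ((\<alpha> i e * 0 + \<beta> i e * 1) / 2 * Q e))"
      by (intro tendsto_intros Tlim i)
    moreover have "(\<Sum>e\<in>arcs G. c e * T 0 1 i e n) = 0" for n
    proof -
      obtain \<phi> where \<phi>: "\<And>e. e \<in> arcs G \<Longrightarrow> y n i e 0 = \<phi> (tail G e)" "\<And>e. e \<in> arcs G \<Longrightarrow> y n i e 1 = \<phi> (head G e)"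
        using eigenpair_vertex_values[OF ep[OF i] wf_digraph] by blast
      have "(\<Sum>e\<in>arcs G. c e * T 0 1 i e n) = - w n * (\<Sum>e\<in>arcs G. c e * ((\<lambda>v. \<tau> n v * \<phi> v) (head G e) - (\<lambda>v. \<tau> n v * \<phi> v) (tail G e)))"
        unfolding sum_distrib_left by (intro sum.cong) (auto simp: Tsin[OF i] \<phi>)
      then show ?thesis using flow_gradient_orthogonal[OF fin c, of "\<lambda>v. \<tau> n v * \<phi> v"] by simp
    qed
    ultimately have "(\<Sum>e\<in>arcs G. c e * (\<beta> i e / 2 * Q e)) = 0" by (simp add: LIMSEQ_const_iff)
    moreover have "(\<Sum>e\<in>arcs G. Q e * \<beta> i e * c e) = 2 * (\<Sum>e\<in>arcs G. c e * (\<beta> i e / 2 * Q e))"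
      unfolding sum_distrib_left by (intro sum.cong) auto
    ultimately show ?thesis by simp
  qed

  \<comment> \<open>Here the boundary terms are the sum of Kirchhoff's conditions weighted by
    \<open>\<tau> n\<close>.\<close>
  have cosid: "(\<Sum>e\<in>arcs G. \<alpha> i e * Q e) = 0" if i: "i < m" for i
  proof -
    have "(\<lambda>n. \<Sum>e\<in>arcs G. T 1 0 i e n) \<longlonglongrightarrow> (\<Sum>e\<in>arcs G. (\<alpha> i e * 1 + \<beta> i e * 0) / 2 * Q e)"
      by (intro tendsto_intros Tlim i)
    moreover have "(\<Sum>e\<in>arcs G. T 1 0 i e n) = 0" for n
    proof -
      have "(\<Sum>e\<in>arcs G. T 1 0 i e n) = (\<Sum>e\<in>arcs G. dy n i e 1 * \<tau> n (head G e) - dy n i e 0 * \<tau> n (tail G e))"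
        by (intro sum.cong) (auto simp: Tcos[OF i] mult.commute)
      then show ?thesis using kirchhoff_sum[of G "dy n i" "\<tau> n"] ep[OF i, of n] fin by (simp add: eigenpair_def)
    qed
    ultimately have "(\<Sum>e\<in>arcs G. \<alpha> i e / 2 * Q e) = 0" by (simp add: LIMSEQ_const_iff)
    moreover have "(\<Sum>e\<in>arcs G. \<alpha> i e * Q e) = 2 * (\<Sum>e\<in>arcs G. \<alpha> i e / 2 * Q e)"
      unfolding sum_distrib_left by (intro sum.cong) auto
    ultimately show ?thesis by simp
  qed

  have \<alpha>0: "\<alpha> i e = 0" if i: "i < m" and e: "e \<in> arcs G" for i e
  proof -
    have "(\<Sum>e'\<in>arcs G. \<alpha> i e' * Q e') = \<alpha> i e * (\<Sum>e'\<in>arcs G. Q e')"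
      unfolding sum_distrib_left using const[OF i e] by (intro sum.cong) auto
    then show ?thesis using cosid[OF i] Q0 by (simp add: Q_def)
  qed

  have orth: "orthonormal_on (arcs G) {..<m} \<beta>"
    unfolding orthonormal_on_def
  proof (intro ballI)
    fix i j assume "i \<in> {..<m}" "j \<in> {..<m}"
    then have i: "i < m" and j: "j < m" by auto
    define S where "S = (\<lambda>n. inner_on (arcs G <+> arcs G) (initial_data (w n) (y n i) (dy n i)) (initial_data (w n) (y n j) (dy n j)))"
    define L where "L = (\<lambda>n. \<Sum>e\<in>arcs G. integral {0..1} (\<lambda>x. y n i e x * y n j e x))"
    have S: "S \<longlonglongrightarrow> inner_on (arcs G) (\<beta> i) (\<beta> j)"
    proof -
      have Seq: "S n = (\<Sum>e\<in>arcs G. (\<tau> n (tail G e) * y n i e 0) * (\<tau> n (tail G e) * y n j e 0))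
          + (\<Sum>e\<in>arcs G. (\<tau> n (tail G e) * (dy n i e 0 / w n)) * (\<tau> n (tail G e) * (dy n j e 0 / w n)))" for n
      proof -
        have "(\<tau> n v * x) * (\<tau> n v * z) = (\<tau> n v * \<tau> n v) * (x * z)" for x z v
          by (simp only: mult_ac)
        then have eq: "(\<tau> n v * x) * (\<tau> n v * z) = x * z" for x z v
          by (simp only: \<tau>2 mult_1)
        show ?thesis unfolding S_def inner_on_initial_data[OF finite_arcs] by (simp only: eq)
      qed
      have "(\<lambda>n. S n) \<longlonglongrightarrow> (\<Sum>e\<in>arcs G. \<alpha> i e * \<alpha> j e) + (\<Sum>e\<in>arcs G. \<beta> i e * \<beta> j e)"
        unfolding Seq by (intro tendsto_intros a b i j)
      then show ?thesis by (simp add: inner_on_def \<alpha>0[OF i])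
    qed
    show "inner_on (arcs G) (\<beta> i) (\<beta> j) = of_bool (i = j)"
    proof (cases "i = j")
      case True
      then have "S n = 1" for n using on[OF i j, of n] by (simp add: S_def)
      then have "S \<longlonglongrightarrow> 1" by (simp add: tendsto_eventually)
      then show ?thesis using S LIMSEQ_unique True by force
    next
      case False
      have one: "(\<lambda>x :: real. 1 :: real) absolutely_integrable_on {0..1}"
        by (rule absolutely_integrable_continuous_real) (rule continuous_on_const)
      have L: "L \<longlonglongrightarrow> (\<Sum>e\<in>arcs G. (\<alpha> i e * \<alpha> j e + \<beta> i e * \<beta> j e) / 2 * integral {0..1} (\<lambda>x :: real. 1))"
        unfolding L_def
      proof (rule tendsto_sum)
        fix e assume e: "e \<in> arcs G"
        obtain ri where ri: "ri \<longlonglongrightarrow> 0" "\<forall>\<^sub>F n in sequentially. \<forall>x\<in>{0..1}.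
          \<bar>\<tau> n (tail G e) * y n i e x - (\<tau> n (tail G e) * y n i e 0 * cos (w n * x) + \<tau> n (tail G e) * (dy n i e 0 / w n) * sin (w n * x))\<bar> \<le> ri n"
          using remainder_limit[OF q[OF e] sl[OF i e] w(1) lam[OF i] \<tau>(1) a[OF i e] b[OF i e]] by blast
        obtain rj where rj: "rj \<longlonglongrightarrow> 0" "\<forall>\<^sub>F n in sequentially. \<forall>x\<in>{0..1}.
          \<bar>\<tau> n (tail G e) * y n j e x - (\<tau> n (tail G e) * y n j e 0 * cos (w n * x) + \<tau> n (tail G e) * (dy n j e 0 / w n) * sin (w n * x))\<bar> \<le> rj n"
          using remainder_limit[OF q[OF e] sl[OF j e] w(1) lam[OF j] \<tau>(1) a[OF j e] b[OF j e]] by blast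
        have lim: "(\<lambda>n. integral {0..1} (\<lambda>x. 1 * ((\<tau> n (tail G e) * y n i e x) * (\<tau> n (tail G e) * y n j e x))))
          \<longlonglongrightarrow> (\<alpha> i e * \<alpha> j e + \<beta> i e * \<beta> j e) / 2 * integral {0..1} (\<lambda>x :: real. 1)"
          by (rule oscillating_product_limit[OF one w(1) a[OF i e] b[OF i e] a[OF j e] b[OF j e] ri(1) rj(1) _ _ ri(2) rj(2)])
            (auto intro!: continuous_intros sl_solution_continuous[OF sl] i j e)
        have eq: "1 * ((\<tau> n (tail G e) * y n i e x) * (\<tau> n (tail G e) * y n j e x)) = y n i e x * y n j e x" for n x
        proof -
          have "1 * ((\<tau> n (tail G e) * y n i e x) * (\<tau> n (tail G e) * y n j e x)) = (\<tau> n (tail G e) * \<tau> n (tail G e)) * (y n i e x * y n j e x)"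
            by (simp only: mult_ac mult_1)
          then show ?thesis by (simp only: \<tau>2 mult_1)
        qed
        show "(\<lambda>n. integral {0..1} (\<lambda>x. y n i e x * y n j e x))
          \<longlonglongrightarrow> (\<alpha> i e * \<alpha> j e + \<beta> i e * \<beta> j e) / 2 * integral {0..1} (\<lambda>x :: real. 1)"
          using lim unfolding eq .
      qed
      also have "(\<Sum>e\<in>arcs G. (\<alpha> i e * \<alpha> j e + \<beta> i e * \<beta> j e) / 2 * integral {0..1} (\<lambda>x :: real. 1)) = inner_on (arcs G) (\<beta> i) (\<beta> j) / 2"
        unfolding inner_on_def sum_divide_distrib by (intro sum.cong) (auto simp: \<alpha>0[OF i])
      finally have L: "L \<longlonglongrightarrow> inner_on (arcs G) (\<beta> i) (\<beta> j) / 2" .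
      \<comment> \<open>For equal eigenvalues \<open>S n\<close> is 0, for distinct ones
        \<open>L n\<close> is. Multiplying the two spares the choice of a subsequence on which one
        case prevails; as the limit of \<open>L\<close> is half that of \<open>S\<close>, the limit
        inner product has square 0.\<close>
      have SL: "S n * L n = 0" for n
      proof (cases "lam n i = lam n j")
        case True
        then show ?thesis using on[OF i j] False by (simp add: S_def)
      next
        case ne: False
        then show ?thesis using eigenpair_orthogonal[OF ep[OF i] ep[OF j] ne fin] by (simp add: L_def)
      qed
      have "inner_on (arcs G) (\<beta> i) (\<beta> j) * (inner_on (arcs G) (\<beta> i) (\<beta> j) / 2) = 0"
        using tendsto_mult[OF S L] unfolding SL LIMSEQ_const_iff by simp
      then show ?thesis using False by simp
    qed
  qed
  have "(\<Sum>e\<in>arcs G. Q e) = 0"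
    by (rule weights_sum_zero[OF fin con, of "{..<m}" \<beta> Q r]) (use m orth flow sinid r in auto)
  then show False using Q0 by (simp add: Q_def)
qed

text \<open>The two cases of the theorem differ only in \<open>w\<close> and in the gauge provided
  by \<open>sgn\<close>. Orthonormality bounds the initial data, so one subsequence of
  \<open>K\<close> makes the finitely many gauged coordinates converge, as
  \<open>limit_weights\<close> requires; its conclusion is the bound on the total integral that
  \<open>smallest_eigenvalue_zero_imp_potential_zero\<close> needs.\<close>

lemma ambarzumian_core:
  fixes G :: "('v, 'e) pre_digraph" and q :: "'e \<Rightarrow> real \<Rightarrow> real" and w :: "nat \<Rightarrow> real"
  assumes fin: "fin_digraph G" and con: "Digraph_Component.connected G" and arcs: "arcs G \<noteq> {}"
    and q: "\<And>e. e \<in> arcs G \<Longrightarrow> q e absolutely_integrable_on {0<..<1}"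
    and r: "r < 1" "\<And>e. e \<in> arcs G \<Longrightarrow> nonloop G e \<Longrightarrow> edge_resistance G e = r"
    and w: "filterlim w at_top sequentially" "\<And>n. sin (w n) = 0" "\<And>n. 1 \<le> n \<Longrightarrow> 0 < w n"
    and sgn: "\<And>n. \<exists>\<tau>. (\<forall>v. \<bar>\<tau> v\<bar> = 1) \<and> (\<forall>e\<in>arcs G. \<tau> (head G e) = cos (w n) * \<tau> (tail G e))"
    and small: "is_smallest_eigenvalue G q 0"
    and near: "infinitely_often_eigenvalues_near G q (int (card (arcs G)) - int (card (verts G)) + 1) (\<lambda>k. (w k)\<^sup>2)"
    and e: "e \<in> arcs G"
  shows "AE x\<in>{0<..<1} in lebesgue. q e x = 0"
proof -
  interpret fin_digraph G by (rule fin)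
  have q01: "q e absolutely_integrable_on {0..1}" if "e \<in> arcs G" for e
    using q[OF that] by (simp add: absolutely_integrable_on_def integrable_on_open_interval_real)
  \<comment> \<open>Adding 1 before subtracting keeps the truncated subtraction exact, by
    \<open>connected_card_le\<close>, even on a tree.\<close>
  define m where "m = card (arcs G) + 1 - card (verts G)"
  have m: "m + card (verts G) = card (arcs G) + 1"
    using connected_card_le[OF fin con] by (simp add: m_def)
  then have mi: "int (card (arcs G)) - int (card (verts G)) + 1 = int m" by linarith
  obtain K \<epsilon> where K: "infinite K" "K \<subseteq> {1..}" and \<epsilon>: "(\<epsilon> \<longlongrightarrow> 0) (inf sequentially (principal K))"
    and F: "\<And>k. k \<in> K \<Longrightarrow> \<exists>F. finite F \<and> (\<forall>lam\<in>F. is_eigenvalue G q lam \<and> \<bar>lam - (w k)\<^sup>2\<bar> \<le> \<epsilon> k) \<and>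
        int m \<le> int (\<Sum>lam\<in>F. eigenvalue_multiplicity G q lam)"
    using near unfolding infinitely_often_eigenvalues_near_def mi by blast
  define R where "R = (\<lambda>k lam z dz. \<forall>i<m. \<bar>lam i - (w k)\<^sup>2\<bar> \<le> \<epsilon> k \<and> eigenpair G q (lam i) (z i) (dz i) \<and>
    (\<forall>j<m. lam i = lam j \<longrightarrow>
       inner_on (arcs G <+> arcs G) (initial_data (w k) (z i) (dz i)) (initial_data (w k) (z j) (dz j)) = of_bool (i = j)))"
  have frame: "\<exists>lam z dz. R k lam z dz" if k: "k \<in> K" for k
  proof -
    obtain F where F: "finite F" "\<And>lam. lam \<in> F \<Longrightarrow> \<bar>lam - (w k)\<^sup>2\<bar> \<le> \<epsilon> k"
      "m \<le> (\<Sum>lam\<in>F. eigenvalue_multiplicity G q lam)"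
      using F[OF k] by (auto simp del: of_nat_sum)
    have "w k \<noteq> 0" using w(3)[of k] k K(2) by auto
    from eigenvalues_frame[OF fin q01 this F(1,3)] obtain lam z dz where
      "\<forall>i<m. lam i \<in> F \<and> eigenpair G q (lam i) (z i) (dz i) \<and> (\<forall>j<m. lam i = lam j \<longrightarrow>
       inner_on (arcs G <+> arcs G) (initial_data (w k) (z i) (dz i)) (initial_data (w k) (z j) (dz j)) = of_bool (i = j))"
      by blast
    then have "R k lam z dz" using F(2) by (simp add: R_def)
    then show ?thesis by blast
  qed
  define k where "k = enumerate K"
  have kK: "k n \<in> K" for n unfolding k_def using enumerate_in_set[OF K(1)] .
  have "\<forall>n. \<exists>lam z dz. R (k n) lam z dz" using frame[OF kK] by blast
  then obtain lam z dz where R: "\<And>n. R (k n) (lam n) (z n) (dz n)"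
    by metis
  have lam: "\<bar>lam n i - (w (k n))\<^sup>2\<bar> \<le> \<epsilon> (k n)" if "i < m" for n i
    using R[of n] that by (simp add: R_def)
  have ep: "eigenpair G q (lam n i) (z n i) (dz n i)" if "i < m" for n i
    using R[of n] that by (simp add: R_def)
  have on: "inner_on (arcs G <+> arcs G) (initial_data (w (k n)) (z n i) (dz n i)) (initial_data (w (k n)) (z n j) (dz n j)) = of_bool (i = j)"
    if "i < m" "j < m" "lam n i = lam n j" for n i j
    using R[of n] that by (simp add: R_def)
  obtain \<tau> where \<tau>: "\<And>n v. \<bar>\<tau> n v\<bar> = 1" "\<And>n e. e \<in> arcs G \<Longrightarrow> \<tau> n (head G e) = cos (w (k n)) * \<tau> n (tail G e)"
  proof -
    have "\<forall>n. \<exists>\<tau>. (\<forall>v. \<bar>\<tau> v\<bar> = 1) \<and> (\<forall>e\<in>arcs G. \<tau> (head G e) = cos (w (k n)) * \<tau> (tail G e))"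
      using sgn by blast
    from choice[OF this] show thesis using that by blast
  qed
  have ktop: "filterlim k sequentially sequentially"
    unfolding k_def by (rule filterlim_subseq[OF strict_mono_enumerate[OF K(1)]])
  have "filterlim k (inf sequentially (principal K)) sequentially"
    using ktop kK by (simp add: filterlim_inf filterlim_principal k_def)
  from filterlim_compose[OF \<epsilon> this] have \<epsilon>k: "(\<lambda>n. \<epsilon> (k n)) \<longlonglongrightarrow> 0" .
  let ?J = "{..<m} \<times> (arcs G <+> arcs G)"
  \<comment> \<open>A coordinate \<open>Inl e\<close> holds a value and \<open>Inr e\<close> a
    scaled derivative; \<open>case_sum id id\<close> recovers the arc from either. As coordinates of
    unit vectors up to sign, all of them are bounded by 1.\<close>
  define c where "c = (\<lambda>n (i, j). \<tau> n (tail G (case_sum id id j)) * initial_data (w (k n)) (z n i) (dz n i) j)"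
  have "\<exists>s l. strict_mono (s :: nat \<Rightarrow> nat) \<and> (\<forall>p\<in>?J. (\<lambda>n. c (s n) p) \<longlonglongrightarrow> l p)"
  proof (rule bounded_family_subseq)
    show "finite ?J" by simp
    fix n p assume "p \<in> ?J"
    then obtain i j where p: "p = (i, j)" "i < m" "j \<in> arcs G <+> arcs G" by auto
    let ?x = "initial_data (w (k n)) (z n i) (dz n i)"
    have "(?x j)\<^sup>2 \<le> (\<Sum>j\<in>arcs G <+> arcs G. (?x j)\<^sup>2)" by (rule member_le_sum) (use p(3) in auto)
    also have "\<dots> = 1" using on[OF p(2) p(2), of n] by (simp add: inner_on_def power2_eq_square)
    finally have "\<bar>?x j\<bar> \<le> 1" by (simp add: abs_square_le_1)
    then show "\<bar>c n p\<bar> \<le> 1" by (simp add: p c_def abs_mult \<tau>(1))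
  qed
  then obtain s l where s: "strict_mono (s :: nat \<Rightarrow> nat)" and l: "\<And>p. p \<in> ?J \<Longrightarrow> (\<lambda>n. c (s n) p) \<longlonglongrightarrow> l p"
    by blast
  have stop: "filterlim s sequentially sequentially" by (rule filterlim_subseq[OF s])
  have "(\<Sum>e\<in>arcs G. integral {0..1} (q e)) = 0"
  proof (rule limit_weights[where w = "\<lambda>n. w (k (s n))" and \<tau> = "\<lambda>n. \<tau> (s n)" and lam = "\<lambda>n. lam (s n)"
        and y = "\<lambda>n. z (s n)" and dy = "\<lambda>n. dz (s n)" and m = m and r = r
        and \<alpha> = "\<lambda>i e. l (i, Inl e)" and \<beta> = "\<lambda>i e. l (i, Inr e)"])
    show "filterlim (\<lambda>n. w (k (s n))) at_top sequentially"
      by (rule filterlim_compose[OF w(1) filterlim_compose[OF ktop stop]])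
    fix i assume i: "i < m"
    have "(\<lambda>n. \<epsilon> (k (s n))) \<longlonglongrightarrow> 0" by (rule filterlim_compose[OF \<epsilon>k stop])
    then show "(\<lambda>n. lam (s n) i - (w (k (s n)))\<^sup>2) \<longlonglongrightarrow> 0"
      by (rule Lim_null_comparison[rotated]) (use lam[OF i] in auto)
    fix e assume e: "e \<in> arcs G"
    show "(\<lambda>n. \<tau> (s n) (tail G e) * z (s n) i e 0) \<longlonglongrightarrow> l (i, Inl e)"
      using l[of "(i, Inl e)", OF SigmaI[of i "{..<m}", OF _ InlI[OF e]]] i by (simp add: c_def initial_data_def)
    show "(\<lambda>n. \<tau> (s n) (tail G e) * (dz (s n) i e 0 / w (k (s n)))) \<longlonglongrightarrow> l (i, Inr e)"
      using l[of "(i, Inr e)", OF SigmaI[of i "{..<m}", OF _ InrI[OF e]]] i by (simp add: c_def initial_data_def)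
  qed (fact fin con q01 r m w(2) \<tau> ep on)+
  \<comment> \<open>No vertex is isolated, since the graph is connected and has an arc. Without
    this, a vertex value could be invisible to the quadratic form.\<close>
  moreover have "\<exists>e\<in>arcs G. tail G e = v \<or> head G e = v" if v: "v \<in> verts G" for v
    by (rule connected_verts_induct[OF wf_digraph con tail_in_verts[OF e] _ _ v]) (use e in auto)
  ultimately show ?thesis
    using smallest_eigenvalue_zero_imp_potential_zero[OF fin q01 _ small arcs _ e] by simp
qed

theorem theorem1p3:
  fixes G :: "('v, 'e) pre_digraph"
    and q :: "'e \<Rightarrow> real \<Rightarrow> real"
    and r :: real
  assumes "fin_digraph G"
    and "Digraph_Component.connected G"
    and "arcs G \<noteq> {}"
    and "\<forall>e\<in>arcs G. q e absolutely_integrable_on {0<..<1}"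
    and "r < 1"
    and "\<forall>e\<in>arcs G. nonloop G e \<longrightarrow> edge_resistance G e = r"
  shows "(is_smallest_eigenvalue G q 0 \<and>
          infinitely_often_eigenvalues_near G q
            (int (card (arcs G)) - int (card (verts G)) + 1) (\<lambda>k. (2 * real k * pi)\<^sup>2)
          \<longrightarrow> (\<forall>e\<in>arcs G. AE x\<in>{0<..<1} in lebesgue. q e x = 0))
       \<and> (bipartite G \<and> is_smallest_eigenvalue G q 0 \<and>
          infinitely_often_eigenvalues_near G q
            (int (card (arcs G)) - int (card (verts G)) + 1) (\<lambda>k. (real k * pi)\<^sup>2)
          \<longrightarrow> (\<forall>e\<in>arcs G. AE x\<in>{0<..<1} in lebesgue. q e x = 0))"
proof (intro conjI impI ballI; elim conjE)
  fix e assume e: "e \<in> arcs G" and small: "is_smallest_eigenvalue G q 0"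
    and near: "infinitely_often_eigenvalues_near G q
      (int (card (arcs G)) - int (card (verts G)) + 1) (\<lambda>k. (2 * real k * pi)\<^sup>2)"
  show "AE x\<in>{0<..<1} in lebesgue. q e x = 0"
  proof (rule ambarzumian_core[OF assms(1-3) _ assms(5) _ _ _ _ _ small near e])
    show "filterlim (\<lambda>k. 2 * real k * pi) at_top sequentially"
      by (intro filterlim_at_top_mult_tendsto_pos[OF tendsto_const pi_gt_zero]
          filterlim_tendsto_pos_mult_at_top[OF tendsto_const] filterlim_real_sequentially) simp
    show "\<exists>\<tau>. (\<forall>v. \<bar>\<tau> v\<bar> = 1) \<and> (\<forall>e\<in>arcs G. \<tau> (head G e) = cos (2 * real n * pi) * \<tau> (tail G e))" for n
      unfolding cos_2npi by (intro exI[of _ "\<lambda>v. 1"]) simp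
    show "sin (2 * real n * pi) = 0" for n using sin_2npi[of n] by simp
    show "q e absolutely_integrable_on {0<..<1}" if "e \<in> arcs G" for e using assms(4) that by blast
    show "edge_resistance G e = r" if "e \<in> arcs G" "nonloop G e" for e using assms(6) that by blast
    show "0 < 2 * real n * pi" if "1 \<le> n" for n using that by simp
  qed
next
  fix e assume e: "e \<in> arcs G" and small: "is_smallest_eigenvalue G q 0" and bip: "bipartite G"
    and near: "infinitely_often_eigenvalues_near G q
      (int (card (arcs G)) - int (card (verts G)) + 1) (\<lambda>k. (real k * pi)\<^sup>2)"
  obtain A B where "A \<union> B = verts G \<and> A \<inter> B = {} \<and>
      (\<forall>e\<in>arcs G. (tail G e \<in> A \<and> head G e \<in> B) \<or> (tail G e \<in> B \<and> head G e \<in> A))"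
    using bip unfolding bipartite_def by (elim exE)
  then have AB: "A \<inter> B = {}"
    "\<And>e. e \<in> arcs G \<Longrightarrow> (tail G e \<in> A \<and> head G e \<in> B) \<or> (tail G e \<in> B \<and> head G e \<in> A)"
    by simp_all
  show "AE x\<in>{0<..<1} in lebesgue. q e x = 0"
  proof (rule ambarzumian_core[OF assms(1-3) _ assms(5) _ _ _ _ _ small near e])
    show "filterlim (\<lambda>k. real k * pi) at_top sequentially"
      by (rule filterlim_at_top_mult_tendsto_pos[OF tendsto_const pi_gt_zero filterlim_real_sequentially])
    fix n
    have sq: "cos (real n * pi) * cos (real n * pi) = 1"
      using sin_cos_squared_add[of "real n * pi"] sin_npi[of n] by (simp add: power2_eq_square)
    then have abs: "\<bar>cos (real n * pi)\<bar> = 1"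
      by (simp only: abs_square_eq_1[symmetric] power2_eq_square)
    \<comment> \<open>Every arc passes between the two classes, where \<open>\<tau>\<close> changes
      by the factor \<open>cos (real n * pi)\<close>. The direction of the arc is irrelevant because
      this factor is its own inverse.\<close>
    define \<tau> where "\<tau> = (\<lambda>v. if v \<in> A then 1 else cos (real n * pi))"
    have "\<tau> (head G e) = cos (real n * pi) * \<tau> (tail G e)" if "e \<in> arcs G" for e
    proof (cases "tail G e \<in> A")
      case True
      then have "head G e \<notin> A" using AB(2)[OF that] AB(1) by blast
      with True show ?thesis by (simp add: \<tau>_def)
    next
      case False
      then have "head G e \<in> A" using AB(2)[OF that] by blast
      with False sq show ?thesis by (simp add: \<tau>_def)
    qed
    moreover have "\<bar>\<tau> v\<bar> = 1" for v using abs by (simp add: \<tau>_def)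
    ultimately show "\<exists>\<tau>. (\<forall>v. \<bar>\<tau> v\<bar> = 1) \<and> (\<forall>e\<in>arcs G. \<tau> (head G e) = cos (real n * pi) * \<tau> (tail G e))"
      by blast
    show "sin (real n * pi) = 0" by (rule sin_npi)
  next
    show "q e absolutely_integrable_on {0<..<1}" if "e \<in> arcs G" for e using assms(4) that by blast
    show "edge_resistance G e = r" if "e \<in> arcs G" "nonloop G e" for e using assms(6) that by blast
    show "0 < real n * pi" if "1 \<le> n" for n using that by simp
  qed
qed

end
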